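(* Let $\alpha,\beta\in(0,1)$, let $m\ge1$ be an integer, let $T>0$, and let $g:[0,1]\to[0,1]$ be measurable. There is a constant $M_0$, not depending on $\kappa$, such that the following holds. For any $\kappa>0$ there exists a constant $c>0$ such that the unique weak solution $\rho^\kappa:[0,T]\times[0,1]\to[0,1]$ of the porous medium equation with Robin boundary conditions with parameter $\kappa$ and initial condition $g$ satisfies the energy estimate $$\mathcal E^{\alpha,\beta}_{m,\kappa,c}(\rho^\kappa)\le M_0 .$$ As a consequence, for all $\kappa>0$, the weak solution $\rho^\kappa$ satisfies $$\partial_u(\rho^\kappa_s)^m(0)=\kappa(\rho^\kappa_s(0)-\alpha)\quad\text{and}\quad \partial_u(\rho^\kappa_s)^m(1)=\kappa(\beta-\rho^\kappa_s(1))$$ for almost every $s\in(0,T]$, and the set $\{(\rho^\kappa)^m:\kappa>0\}$ is bounded in $L^2(0,T;\mathcal H^1)$.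
   Context: Notation. $\langle\cdot,\cdot\rangle$ is the inner product of $L^2([0,1])$, with norm $\|\cdot\|_2$, and $\langle\langle G,H\rangle\rangle:=\int_0^T\langle G_s,H_s\rangle\,ds$. $\mathcal H^1$ is the set of locally summable $\varphi:(0,1)\to\mathbb R$ with a weak derivative $\partial_u\varphi\in L^2([0,1])$, with $\|\varphi\|_{\mathcal H^1}^2=\|\varphi\|_2^2+\|\partial_u\varphi\|_2^2$; $\varphi\in\mathcal H^1$ is extended to $[0,1]$ by $\varphi(0):=\varphi(0^+)$, $\varphi(1):=\varphi(1^-)$. $L^2(0,T;\mathcal H^1)$ is the set of measurable $\zeta:[0,T]\to\mathcal H^1$ with $\|\zeta\|^2_{L^2(0,T;\mathcal H^1)}:=\int_0^T\|\zeta_t\|_{\mathcal H^1}^2dt<\infty$. For $\rho\ge 0$ with $\rho^m\in L^2(0,T;\mathcal H^1)$, $\rho_s(0),\rho_s(1)$ are understood through this extension of $(\rho_s)^m$, for almost every $s$. $C^{n,p}([0,T]\times[0,1])$: functions $n$ times continuously differentiable in time and $p$ times in space. $\Delta=\partial_u^2$. Weak solution, Robin, $\kappa>0$: $\rho:[0,T]\times[0,1]\to[0,1]$ with $\rho^m\in L^2(0,T;\mathcal H^1)$ and, for all $t\in[0,T]$ and $G\in C^{1,2}([0,T]\times[0,1])$, $$\langle\rho_t,G_t\rangle-\langle g,G_0\rangle-\int_0^t\langle\rho_s,\partial_sG_s+(\rho_s)^{m-1}\Delta G_s\rangle ds+\int_0^t\{(\rho_s)^m(1)\partial_uG_s(1)-(\rho_s)^m(0)\partial_uG_s(0)\}ds-\kappa\int_0^t\{G_s(0)(\alpha-\rho_s(0))+G_s(1)(\beta-\rho_s(1))\}ds=0.$$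 Existence and uniqueness of this weak solution is taken as known. Energy functional. For $\gamma\in\{\alpha,\beta\}$ and $r\ge0$ let $P^\gamma_m(r)=\sum_{i=0}^{m-1}\gamma^{m-1-i}r^i$. Let $\mathcal B$ be the set of measurable $\xi:[0,T]\times[0,1]\to[0,\infty)$ such that $s\mapsto\xi_s(0)$ and $s\mapsto\xi_s(1)$ are measurable and bounded. For $\xi\in\mathcal B$ and $\kappa>0$, $L^2_{\kappa,\xi}([0,T]\times[0,1])$ is the Hilbert space of measurable $H:[0,T]\times[0,1]\to\mathbb R$ with $\langle\langle H,H\rangle\rangle^{\alpha,\beta}_{\kappa,\xi}<\infty$, where $$\langle\langle G,H\rangle\rangle^{\alpha,\beta}_{\kappa,\xi}=\langle\langle G,H\rangle\rangle+\int_0^T\Big\{\frac{P^\alpha_m(\xi_s(0))}{\kappa}G_s(0)H_s(0)+\frac{P^\beta_m(\xi_s(1))}{\kappa}G_s(1)H_s(1)\Big\}ds .$$ For $\xi^m\in L^2([0,T]\times[0,1])$ and $H\in C^{0,1}([0,T]\times[0,1])$ let $\mathcal T^{\alpha,\beta}_{\xi,m}(H)=\langle\langle\xi^m,\partial_uH\rangle\rangle+\int_0^T\{\alpha^mH_s(0)-\beta^mH_s(1)\}ds$. For $c>0$, $$\mathcal E^{\alpha,\beta}_{m,\kappa,c}(\xi)=\sup_{H\in C^{0,1}([0,T]\times[0,1])}\big\{\mathcal T^{\alpha,\beta}_{\xi,m}(H)-c\,\langle\langle H,H\rangle\rangle^{\alpha,\beta}_{\kappa,\xi}\big\}.$$ Meaning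 of $\partial_u(\rho^\kappa_s)^m(0)$ and $\partial_u(\rho^\kappa_s)^m(1)$: when $\mathcal E^{\alpha,\beta}_{m,\kappa,c}(\xi)<\infty$, $\partial_u\xi^m$ denotes the (unique) element of $L^2_{\kappa,\xi}([0,T]\times[0,1])$ with $\mathcal T^{\alpha,\beta}_{\xi,m}(H)=-\langle\langle\partial_u\xi^m,H\rangle\rangle^{\alpha,\beta}_{\kappa,\xi}$ for all $H\in C^{0,1}([0,T]\times[0,1])$; in the interior it is the weak derivative of $\xi^m$, and $\partial_u(\xi_s)^m(0),\partial_u(\xi_s)^m(1)$ are the values of this element at $u=0,1$. *)

theory Defs
  imports "HOL-Analysis.Analysis"
begin

section \<open>The space \<open>H\<^sup>1\<close> on the unit interval\<close>

definition ip :: "(real \<Rightarrow> real) \<Rightarrow> (real \<Rightarrow> real) \<Rightarrow> real" where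
  "ip \<phi> \<psi> = (LINT u | lebesgue_on {0..1}. \<phi> u * \<psi> u)"

definition L2 :: "(real \<Rightarrow> real) set" where
  "L2 = {\<phi>. \<phi> \<in> borel_measurable (lebesgue_on {0..1}) \<and>
            integrable (lebesgue_on {0..1}) (\<lambda>u. (\<phi> u)\<^sup>2)}"

definition locally_summable :: "(real \<Rightarrow> real) \<Rightarrow> bool" where
  "locally_summable \<phi> \<longleftrightarrow> (\<forall>a b. 0 < a \<and> b < 1 \<longrightarrow> integrable (lebesgue_on {a..b}) \<phi>)"

text \<open>Smooth functions with compact support contained in the open interval.\<close>

definition test_functions :: "(real \<Rightarrow> real) set" where
  "test_functions = {\<eta>. (\<forall>n. (deriv ^^ n) \<eta> differentiable_on UNIV) \<and>
                        closure {u. \<eta> u \<noteq> 0} \<subseteq> {0<..<1}}"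

definition is_weak_deriv :: "(real \<Rightarrow> real) \<Rightarrow> (real \<Rightarrow> real) \<Rightarrow> bool" where
  "is_weak_deriv \<phi> \<psi> \<longleftrightarrow> locally_summable \<phi> \<and> locally_summable \<psi> \<and>
     (\<forall>\<eta>\<in>test_functions.
        (LINT u | lebesgue_on {0<..<1}. \<phi> u * deriv \<eta> u) =
        - (LINT u | lebesgue_on {0<..<1}. \<psi> u * \<eta> u))"

text \<open>Elements are honest functions, not classes; only their values in the open unit interval
  (up to null sets) matter.\<close>

definition H1 :: "(real \<Rightarrow> real) set" where
  "H1 = {\<phi>. locally_summable \<phi> \<and> (\<exists>\<psi>\<in>L2. is_weak_deriv \<phi> \<psi>)}"

definition weak_deriv :: "(real \<Rightarrow> real) \<Rightarrow> real \<Rightarrow> real" where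
  "weak_deriv \<phi> = (SOME \<psi>. \<psi> \<in> L2 \<and> is_weak_deriv \<phi> \<psi>)"

definition H1_norm :: "(real \<Rightarrow> real) \<Rightarrow> real" where
  "H1_norm \<phi> = sqrt (ip \<phi> \<phi> + ip (weak_deriv \<phi>) (weak_deriv \<phi>))"

text \<open>The one-sided limit at \<open>a = 0\<close> or \<open>a = 1\<close>. It is taken along the continuous representative,
  since \<open>\<phi>\<close> itself is only determined up to a null set.\<close>

definition H1_value :: "(real \<Rightarrow> real) \<Rightarrow> real \<Rightarrow> real" where
  "H1_value \<phi> a = (THE l. \<exists>\<psi>. continuous_on {0<..<1} \<psi> \<and>
      (AE u in lebesgue_on {0<..<1}. \<psi> u = \<phi> u) \<and> (\<psi> \<longlongrightarrow> l) (at a within {0<..<1}))"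

definition H1_borel :: "(real \<Rightarrow> real) measure" where
  "H1_borel = sigma H1 {U. U \<subseteq> H1 \<and>
      (\<forall>\<phi>\<in>U. \<exists>r>0. \<forall>\<psi>\<in>H1. H1_norm (\<lambda>u. \<psi> u - \<phi> u) < r \<longrightarrow> \<psi> \<in> U)}"

text \<open>Membership is insensitive to null sets of times. In particular nothing is required of
  \<open>\<zeta> 0\<close>; this matters for weak solutions, whose initial datum need not have any regularity.\<close>

definition L2H1 :: "real \<Rightarrow> (real \<Rightarrow> real \<Rightarrow> real) set" where
  "L2H1 T = {\<zeta>. \<exists>\<eta> \<in> measurable (lebesgue_on {0..T}) H1_borel.
      (AE t in lebesgue_on {0..T}. \<zeta> t = \<eta> t) \<and>
      integrable (lebesgue_on {0..T}) (\<lambda>t. (H1_norm (\<eta> t))\<^sup>2)}"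

definition L2H1_norm :: "real \<Rightarrow> (real \<Rightarrow> real \<Rightarrow> real) \<Rightarrow> real" where
  "L2H1_norm T \<zeta> = sqrt (LINT t | lebesgue_on {0..T}. (H1_norm (\<zeta> t))\<^sup>2)"

section \<open>Test functions in space and time\<close>

text \<open>Derivatives are relative to \<open>[0,T]\<close> and \<open>[0,1]\<close>, hence one-sided at the end points.\<close>

definition dt :: "real \<Rightarrow> (real \<Rightarrow> real \<Rightarrow> real) \<Rightarrow> real \<Rightarrow> real \<Rightarrow> real" where
  "dt T G s u = vector_derivative (\<lambda>r. G r u) (at s within {0..T})"

definition du :: "(real \<Rightarrow> real \<Rightarrow> real) \<Rightarrow> real \<Rightarrow> real \<Rightarrow> real" where
  "du G s u = vector_derivative (G s) (at u within {0..1})"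

definition Cnp :: "nat \<Rightarrow> nat \<Rightarrow> real \<Rightarrow> (real \<Rightarrow> real \<Rightarrow> real) set" where
  "Cnp n p T = {G.
     (\<forall>j\<le>n. continuous_on ({0..T} \<times> {0..1}) (\<lambda>(s, u). (dt T ^^ j) G s u)) \<and>
     (\<forall>k\<le>p. continuous_on ({0..T} \<times> {0..1}) (\<lambda>(s, u). (du ^^ k) G s u)) \<and>
     (\<forall>j<n. \<forall>s\<in>{0..T}. \<forall>u\<in>{0..1}.
        (\<lambda>r. (dt T ^^ j) G r u) differentiable (at s within {0..T})) \<and>
     (\<forall>k<p. \<forall>s\<in>{0..T}. \<forall>u\<in>{0..1}.
        (du ^^ k) G s differentiable (at u within {0..1}))}"

section \<open>Weak solutions with Robin boundary conditions\<close>

text \<open>Redefines \<open>\<rho>\<^sub>s(0)\<close> and \<open>\<rho>\<^sub>s(1)\<close> through the boundary values of \<open>(\<rho>\<^sub>s)\<^sup>m\<close>, for every \<open>s\<close> for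
  which these exist.\<close>

definition bdry_ext :: "nat \<Rightarrow> (real \<Rightarrow> real \<Rightarrow> real) \<Rightarrow> real \<Rightarrow> real \<Rightarrow> real" where
  "bdry_ext m \<rho> s u =
     (if u \<in> {0, 1} \<and> (\<lambda>v. \<rho> s v ^ m) \<in> H1 then root m (H1_value (\<lambda>v. \<rho> s v ^ m) u) else \<rho> s u)"

text \<open>Since the equation is imposed at every time, every section \<open>\<rho>\<^sub>t\<close> has to be measurable; joint
  Lebesgue measurability would only give this for almost every time.\<close>

definition robin_weak_solution ::
  "real \<Rightarrow> real \<Rightarrow> nat \<Rightarrow> real \<Rightarrow> (real \<Rightarrow> real) \<Rightarrow> real \<Rightarrow> (real \<Rightarrow> real \<Rightarrow> real) \<Rightarrow> bool" where
  "robin_weak_solution \<alpha> \<beta> m T g \<kappa> \<rho> \<longleftrightarrow>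
     (\<lambda>(s, u). \<rho> s u) \<in> borel_measurable (lebesgue_on ({0..T} \<times> {0..1})) \<and>
     (\<forall>s\<in>{0..T}. \<rho> s \<in> borel_measurable (lebesgue_on {0..1})) \<and>
     (\<forall>s\<in>{0..T}. \<forall>u\<in>{0..1}. \<rho> s u \<in> {0..1}) \<and>
     (\<lambda>s u. \<rho> s u ^ m) \<in> L2H1 T \<and>
     (\<forall>t\<in>{0..T}. \<forall>G\<in>Cnp 1 2 T.
        ip (\<rho> t) (G t) - ip g (G 0)
        - (LINT s | lebesgue_on {0..t}.
             ip (\<rho> s) (\<lambda>u. dt T G s u + \<rho> s u ^ (m - 1) * du (du G) s u))
        + (LINT s | lebesgue_on {0..t}.
             bdry_ext m \<rho> s 1 ^ m * du G s 1 - bdry_ext m \<rho> s 0 ^ m * du G s 0)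
        - \<kappa> * (LINT s | lebesgue_on {0..t}.
             G s 0 * (\<alpha> - bdry_ext m \<rho> s 0) + G s 1 * (\<beta> - bdry_ext m \<rho> s 1)) = 0)"

section \<open>The energy functional\<close>

definition P :: "nat \<Rightarrow> real \<Rightarrow> real \<Rightarrow> real" where
  "P m \<gamma> r = (\<Sum>i<m. \<gamma> ^ (m - 1 - i) * r ^ i)"

definition ipT :: "real \<Rightarrow> (real \<Rightarrow> real \<Rightarrow> real) \<Rightarrow> (real \<Rightarrow> real \<Rightarrow> real) \<Rightarrow> real" where
  "ipT T G H = (LINT s | lebesgue_on {0..T}. ip (G s) (H s))"

definition ip_bdry :: "real \<Rightarrow> real \<Rightarrow> nat \<Rightarrow> real \<Rightarrow> real \<Rightarrow> (real \<Rightarrow> real \<Rightarrow> real) \<Rightarrow>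
    (real \<Rightarrow> real \<Rightarrow> real) \<Rightarrow> (real \<Rightarrow> real \<Rightarrow> real) \<Rightarrow> real" where
  "ip_bdry \<alpha> \<beta> m T \<kappa> \<xi> G H = ipT T G H +
     (LINT s | lebesgue_on {0..T}.
        P m \<alpha> (\<xi> s 0) / \<kappa> * G s 0 * H s 0 + P m \<beta> (\<xi> s 1) / \<kappa> * G s 1 * H s 1)"

text \<open>The values at \<open>u = 0\<close> and \<open>u = 1\<close> carry mass in the norm but are Lebesgue-null in the
  rectangle, so their measurability has to be required separately.\<close>

definition L2_bdry ::
  "real \<Rightarrow> real \<Rightarrow> nat \<Rightarrow> real \<Rightarrow> real \<Rightarrow> (real \<Rightarrow> real \<Rightarrow> real) \<Rightarrow> (real \<Rightarrow> real \<Rightarrow> real) set" where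
  "L2_bdry \<alpha> \<beta> m T \<kappa> \<xi> = {H.
     (\<lambda>(s, u). H s u) \<in> borel_measurable (lebesgue_on ({0..T} \<times> {0..1})) \<and>
     (\<lambda>s. H s 0) \<in> borel_measurable (lebesgue_on {0..T}) \<and>
     (\<lambda>s. H s 1) \<in> borel_measurable (lebesgue_on {0..T}) \<and>
     integrable (lebesgue_on ({0..T} \<times> {0..1})) (\<lambda>(s, u). (H s u)\<^sup>2) \<and>
     integrable (lebesgue_on {0..T}) (\<lambda>s. P m \<alpha> (\<xi> s 0) / \<kappa> * (H s 0)\<^sup>2) \<and>
     integrable (lebesgue_on {0..T}) (\<lambda>s. P m \<beta> (\<xi> s 1) / \<kappa> * (H s 1)\<^sup>2)}"

definition energy_lin :: "real \<Rightarrow> real \<Rightarrow> nat \<Rightarrow> real \<Rightarrow> (real \<Rightarrow> real \<Rightarrow> real) \<Rightarrow>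
    (real \<Rightarrow> real \<Rightarrow> real) \<Rightarrow> real" where
  "energy_lin \<alpha> \<beta> m T \<xi> H = ipT T (\<lambda>s u. \<xi> s u ^ m) (du H) +
     (LINT s | lebesgue_on {0..T}. \<alpha> ^ m * H s 0 - \<beta> ^ m * H s 1)"

definition energy :: "real \<Rightarrow> real \<Rightarrow> nat \<Rightarrow> real \<Rightarrow> real \<Rightarrow> real \<Rightarrow>
    (real \<Rightarrow> real \<Rightarrow> real) \<Rightarrow> ereal" where
  "energy \<alpha> \<beta> m T \<kappa> c \<xi> =
     (SUP H \<in> Cnp 0 1 T. ereal (energy_lin \<alpha> \<beta> m T \<xi> H - c * ip_bdry \<alpha> \<beta> m T \<kappa> \<xi> H H))"

text \<open>\<open>D\<close> represents \<open>\<partial>\<^sub>u \<xi>\<^sup>m\<close>, including its values at \<open>u = 0\<close> and \<open>u = 1\<close>; it is unique only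
  up to almost everywhere equality.\<close>

definition is_energy_deriv :: "real \<Rightarrow> real \<Rightarrow> nat \<Rightarrow> real \<Rightarrow> real \<Rightarrow>
    (real \<Rightarrow> real \<Rightarrow> real) \<Rightarrow> (real \<Rightarrow> real \<Rightarrow> real) \<Rightarrow> bool" where
  "is_energy_deriv \<alpha> \<beta> m T \<kappa> \<xi> D \<longleftrightarrow> D \<in> L2_bdry \<alpha> \<beta> m T \<kappa> \<xi> \<and>
     (\<forall>H\<in>Cnp 0 1 T. energy_lin \<alpha> \<beta> m T \<xi> H = - ip_bdry \<alpha> \<beta> m T \<kappa> \<xi> D H)"

end

theory Submission
  imports Defs "HOL-Computational_Algebra.Polynomial"
begin

text \<open>
  The equation enters the theorem through one a priori bound only; everything else is the structure
  of the Sobolev space. Write \<open>F s\<close> for the continuous representative of \<open>(\<rho> s)\<^sup>m\<close>, \<open>D s\<close> for its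
  weak derivative and \<open>r s = root m (F s)\<close>, a version of \<open>\<rho> s\<close> that has boundary values.

  Integration by parts in \<open>\<langle>F s, \<partial>\<^sub>u H s\<rangle>\<close>, together with \<open>P m \<gamma> x * (\<gamma> - x) = \<gamma> ^ m - x ^ m\<close>, turns
  the linear part of the energy into \<open>- \<langle>\<langle>D', H\<rangle>\<rangle>\<close> in the weighted inner product, where \<open>D'\<close> is \<open>D\<close> in
  the interior, \<open>\<kappa> * (r s 0 - \<alpha>)\<close> at \<open>0\<close> and \<open>\<kappa> * (\<beta> - r s 1)\<close> at \<open>1\<close> (\<open>energy_deriv_exists\<close>). Every
  other representing element has the same boundary values at almost every time, because the test functions
  \<open>q s * (1 - u) ^ n\<close> and \<open>q s * u ^ n\<close> keep their boundary values while their norms in the interior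
  tend to zero (\<open>energy_deriv_unique\<close>). Completing squares bounds the energy, for \<open>c = 1 + \<kappa>\<close>, by the
  integral of \<open>D\<^sup>2\<close> plus \<open>2 * m * T\<close> (\<open>energy_le\<close>), and the norm in \<open>L\<^sup>2(0, T; H\<^sup>1)\<close> is controlled by the
  same integral, since \<open>F\<close> has values in \<open>[0, 1]\<close> (\<open>L2H1_norm_le\<close>).

  What remains is that the integral of \<open>D\<^sup>2\<close> over the rectangle is at most \<open>2 + T\<close>, whatever \<open>\<kappa>\<close> is
  (\<open>energy_bound\<close>). Formally the equation is tested with \<open>F - \<psi>\<close>, where \<open>\<psi>\<close> is the affine function
  with boundary values \<open>\<alpha> ^ m\<close> and \<open>\<beta> ^ m\<close>: the boundary terms such as
  \<open>\<kappa> * (r s 0 ^ m - \<alpha> ^ m) * (\<alpha> - r s 0)\<close> are nonpositive, \<open>\<langle>D s, \<partial>\<^sub>u \<psi>\<rangle>\<close> is at most \<open>1\<close>, and the time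
  derivative integrates to the increment of a functional \<open>E\<close> with values in \<open>[-1, 1]\<close>. As no regularity of
  \<open>F\<close> in time is known, it need not be an admissible test function. The equation is therefore integrated
  from \<open>t - h\<close> to \<open>t\<close> and tested with the function \<open>F t - \<psi>\<close>, which is constant in time
  (\<open>weak_H1\<close>); the convexity of \<open>x ^ (m + 1) / (m + 1)\<close> bounds the increment of \<open>E\<close>
  (\<open>energy_increment\<close>). Averaging over \<open>t\<close> and letting \<open>h\<close> tend to zero gives the bound, because
  translations in time are continuous in mean square (\<open>translation_continuous\<close>).

  Two preparations make this precise. The elements of \<open>H1\<close> are the functions with a representative
  \<open>c + \<integral>\<^sub>0\<^sup>u w\<close>, \<open>w\<close> square-integrable (\<open>du_Bois_Reymond\<close>, \<open>weak_deriv_imp_rep\<close>). And as \<open>H1\<close> is separable, a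
  measurable map from time into \<open>H1\<close> has values at \<open>0\<close> and derivatives that are Borel functions of
  time and of time and space (\<open>measurable_representation\<close>).
\<close>

section \<open>Square-integrable functions\<close>

definition sq_int :: "'a measure \<Rightarrow> ('a \<Rightarrow> real) \<Rightarrow> bool" where
  "sq_int M f \<longleftrightarrow> f \<in> borel_measurable M \<and> integrable M (\<lambda>x. (f x)\<^sup>2)"

definition l2norm :: "'a measure \<Rightarrow> ('a \<Rightarrow> real) \<Rightarrow> real" where
  "l2norm M f = sqrt (\<integral>x. (f x)\<^sup>2 \<partial>M)"

lemma sq_int_measurable [measurable_dest]: "sq_int M f \<Longrightarrow> f \<in> borel_measurable M"
  by (simp add: sq_int_def)

lemma sq_int_mult:
  assumes "sq_int M f" "sq_int M g"
  shows "integrable M (\<lambda>x. f x * g x)"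
proof (rule Bochner_Integration.integrable_bound)
  show "integrable M (\<lambda>x. (f x)\<^sup>2 + (g x)\<^sup>2)"
    using assms by (simp add: sq_int_def)
  show "(\<lambda>x. f x * g x) \<in> borel_measurable M"
    using assms by (auto simp: sq_int_def)
  have "\<bar>a * b\<bar> \<le> a\<^sup>2 + b\<^sup>2" for a b :: real
  proof -
    have "2 * \<bar>a * b\<bar> \<le> a\<^sup>2 + b\<^sup>2"
      using sum_squares_bound[of "\<bar>a\<bar>" "\<bar>b\<bar>"] by (simp add: abs_mult)
    then show ?thesis by linarith
  qed
  then show "AE x in M. norm (f x * g x) \<le> norm ((f x)\<^sup>2 + (g x)\<^sup>2)"
    by simp
qed

lemma sq_int_minus: "sq_int M f \<Longrightarrow> sq_int M (\<lambda>x. - f x)"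
  by (simp add: sq_int_def)

lemma sq_int_add:
  assumes "sq_int M f" "sq_int M g"
  shows "sq_int M (\<lambda>x. f x + g x)"
  using assms sq_int_mult[OF assms]
  by (auto simp: sq_int_def power2_sum mult.assoc intro!: Bochner_Integration.integrable_add)

lemma sq_int_diff:
  assumes "sq_int M f" "sq_int M g"
  shows "sq_int M (\<lambda>x. f x - g x)"
  using sq_int_add[OF assms(1) sq_int_minus[OF assms(2)]] by simp

lemma l2norm_nonneg [simp]: "0 \<le> l2norm M f"
  by (simp add: l2norm_def)

lemma l2norm_sq: "(l2norm M f)\<^sup>2 = (\<integral>x. (f x)\<^sup>2 \<partial>M)"
  by (simp add: l2norm_def)

lemma l2norm_minus_commute: "l2norm M (\<lambda>x. f x - g x) = l2norm M (\<lambda>x. g x - f x)"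
  by (simp add: l2norm_def power2_commute)

lemma integral_sum_sq:
  assumes "sq_int M f" "sq_int M g"
  shows "(\<integral>x. (f x + t * g x)\<^sup>2 \<partial>M) =
    (l2norm M f)\<^sup>2 + 2 * t * (\<integral>x. f x * g x \<partial>M) + t\<^sup>2 * (l2norm M g)\<^sup>2"
proof -
  have "(\<integral>x. (f x + t * g x)\<^sup>2 \<partial>M) = (\<integral>x. ((f x)\<^sup>2 + 2 * t * (f x * g x)) + t\<^sup>2 * (g x)\<^sup>2 \<partial>M)"
    by (rule Bochner_Integration.integral_cong) (auto simp: power2_sum algebra_simps power_mult_distrib)
  also have "\<dots> = (\<integral>x. (f x)\<^sup>2 + 2 * t * (f x * g x) \<partial>M) + (\<integral>x. t\<^sup>2 * (g x)\<^sup>2 \<partial>M)"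
    using assms sq_int_mult[OF assms]
    by (intro Bochner_Integration.integral_add Bochner_Integration.integrable_add) (auto simp: sq_int_def)
  also have "(\<integral>x. (f x)\<^sup>2 + 2 * t * (f x * g x) \<partial>M) = (\<integral>x. (f x)\<^sup>2 \<partial>M) + (\<integral>x. 2 * t * (f x * g x) \<partial>M)"
    using assms sq_int_mult[OF assms]
    by (intro Bochner_Integration.integral_add) (auto simp: sq_int_def)
  finally show ?thesis by (simp add: l2norm_sq)
qed

lemma Cauchy_Schwarz_integral:
  assumes "sq_int M f" "sq_int M g"
  shows "\<bar>\<integral>x. f x * g x \<partial>M\<bar> \<le> l2norm M f * l2norm M g"
proof -
  define A B C where "A = (l2norm M f)\<^sup>2" and "B = (l2norm M g)\<^sup>2" and "C = (\<integral>x. f x * g x \<partial>M)"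
  have nn: "0 \<le> A" "0 \<le> B" by (simp_all add: A_def B_def)
  have quad: "0 \<le> A + 2 * t * C + t\<^sup>2 * B" for t
    using integral_sum_sq[OF assms, of t] Bochner_Integration.integral_nonneg[of M "\<lambda>x. (f x + t * g x)\<^sup>2"]
    by (simp add: A_def B_def C_def)
  have "C\<^sup>2 \<le> A * B"
  proof (cases "B = 0")
    case True
    have "C = 0"
    proof (rule ccontr)
      assume "C \<noteq> 0"
      then show False using quad[of "- (A + 1) / (2 * C)"] True by (simp add: field_simps)
    qed
    then show ?thesis using nn by simp
  next
    case False
    with nn have "0 < B" by simp
    have "0 \<le> A - C\<^sup>2 / B"
      using quad[of "- C / B"] \<open>0 < B\<close> by (simp add: power2_eq_square field_simps)
    with \<open>0 < B\<close> show ?thesis by (simp add: field_simps)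
  qed
  then have "\<bar>C\<bar>\<^sup>2 \<le> (l2norm M f * l2norm M g)\<^sup>2"
    by (simp add: A_def B_def power_mult_distrib)
  then show ?thesis
    unfolding C_def by (rule power2_le_imp_le) simp
qed

lemma l2norm_triangle:
  assumes "sq_int M f" "sq_int M g"
  shows "l2norm M (\<lambda>x. f x + g x) \<le> l2norm M f + l2norm M g"
proof (rule power2_le_imp_le)
  have "(l2norm M (\<lambda>x. f x + g x))\<^sup>2 = (l2norm M f)\<^sup>2 + 2 * (\<integral>x. f x * g x \<partial>M) + (l2norm M g)\<^sup>2"
    using integral_sum_sq[OF assms, of 1] by (simp add: l2norm_sq)
  also have "\<dots> \<le> (l2norm M f + l2norm M g)\<^sup>2"
    using Cauchy_Schwarz_integral[OF assms] by (simp add: power2_sum)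
  finally show "(l2norm M (\<lambda>x. f x + g x))\<^sup>2 \<le> (l2norm M f + l2norm M g)\<^sup>2" .
qed simp

lemma l2norm_cong_AE:
  assumes "f \<in> borel_measurable M" "g \<in> borel_measurable M" "AE x in M. f x = g x"
  shows "l2norm M f = l2norm M g"
  unfolding l2norm_def using assms by (intro arg_cong[where f=sqrt] integral_cong_AE) auto

lemma l2norm_const [simp]: "l2norm M (\<lambda>x. c) = sqrt (measure M (space M)) * \<bar>c\<bar>"
  by (simp add: l2norm_def real_sqrt_mult)

lemma (in finite_measure) sq_int_bounded:
  assumes "f \<in> borel_measurable M" "AE x in M. \<bar>f x\<bar> \<le> B"
  shows "sq_int M f"
proof -
  have "integrable M (\<lambda>x. (f x)\<^sup>2)"
  proof (rule integrable_const_bound[where B = "B\<^sup>2"])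
    show "AE x in M. norm ((f x)\<^sup>2) \<le> B\<^sup>2"
      using assms(2) 
    proof eventually_elim
      case (elim x)
      then have "\<bar>f x\<bar>\<^sup>2 \<le> B\<^sup>2" by (intro power_mono) auto
      then show ?case by simp
    qed
  qed (use assms in auto)
  then show ?thesis using assms by (simp add: sq_int_def)
qed

lemma (in finite_measure) sq_int_integrable:
  assumes "sq_int M f" shows "integrable M f"
  using sq_int_mult[OF assms sq_int_bounded[of "\<lambda>_. 1" 1]] by simp

lemma (in finite_measure) l1_le_l2norm:
  assumes "sq_int M f" shows "(\<integral>x. \<bar>f x\<bar> \<partial>M) \<le> sqrt (measure M (space M)) * l2norm M f"
proof -
  have "sq_int M (\<lambda>x. \<bar>f x\<bar>)" using assms by (auto simp: sq_int_def)
  from Cauchy_Schwarz_integral[OF this sq_int_bounded[of "\<lambda>_. 1" 1]]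
  show ?thesis by (simp add: l2norm_def mult.commute)
qed

lemma sq_int_cong_AE:
  assumes "sq_int M f" "g \<in> borel_measurable M" "AE x in M. f x = g x"
  shows "sq_int M g"
proof -
  have "integrable M (\<lambda>x. (f x)\<^sup>2) = integrable M (\<lambda>x. (g x)\<^sup>2)"
    using assms by (intro integrable_cong_AE) auto
  with assms show ?thesis by (simp add: sq_int_def)
qed

definition clip :: "real \<Rightarrow> real \<Rightarrow> real" where "clip N x = max (- N) (min N x)"

lemma clip_tendsto: "(\<lambda>n. clip (real n) x) \<longlonglongrightarrow> x"
proof (rule tendsto_eventually)
  obtain n where "\<bar>x\<bar> \<le> real n" using real_arch_simple by blast
  then show "\<forall>\<^sub>F n in sequentially. clip (real n) x = x"
    by (intro eventually_sequentiallyI[of n]) (auto simp: clip_def max_def min_def)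
qed

lemma continuous_on_clip [continuous_intros]: "continuous_on A f \<Longrightarrow> continuous_on A (\<lambda>x. clip N (f x))"
  unfolding clip_def by (intro continuous_intros)

lemma borel_measurable_clip [measurable]: "clip N \<in> borel_measurable borel"
  unfolding clip_def by measurable

lemma abs_clip_le: "0 \<le> N \<Longrightarrow> \<bar>clip N x\<bar> \<le> N"
  by (auto simp: clip_def)

lemma l2norm_tendsto_0:
  assumes "\<And>n. f n \<in> borel_measurable M" "g \<in> borel_measurable M" "integrable M w"
    and "AE x in M. (\<lambda>n. f n x) \<longlonglongrightarrow> g x"
    and "\<And>n. AE x in M. (f n x - g x)\<^sup>2 \<le> w x"
  shows "(\<lambda>n. l2norm M (\<lambda>x. f n x - g x)) \<longlonglongrightarrow> 0"
proof -
  have "(\<lambda>n. \<integral>x. (f n x - g x)\<^sup>2 \<partial>M) \<longlonglongrightarrow> (\<integral>x. 0 \<partial>M)"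
  proof (rule integral_dominated_convergence[where w = w])
    show "AE x in M. (\<lambda>n. (f n x - g x)\<^sup>2) \<longlonglongrightarrow> 0"
      using assms(4)
    proof eventually_elim
      case (elim x)
      then have "(\<lambda>n. (f n x - g x)\<^sup>2) \<longlonglongrightarrow> (g x - g x)\<^sup>2" by (intro tendsto_intros)
      then show ?case by simp
    qed
  qed (use assms in auto)
  then show ?thesis unfolding l2norm_def using tendsto_real_sqrt by fastforce
qed

text \<open>A Lebesgue measurable function is almost everywhere a limit of continuous ones. Clipping them at
  the bound of the limit does not disturb the convergence and makes dominated convergence applicable.\<close>

lemma bounded_AE_limit_continuous:
  fixes f :: "'a::euclidean_space \<Rightarrow> real"
  assumes S: "S \<in> sets lebesgue"
    and f: "f \<in> borel_measurable (lebesgue_on S)" "\<And>x. \<bar>f x\<bar> \<le> N"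
  shows "\<exists>g. (\<forall>n. continuous_on UNIV (g n) \<and> (\<forall>x. \<bar>g n x\<bar> \<le> N)) \<and>
    (AE x in lebesgue_on S. (\<lambda>n. g n x) \<longlonglongrightarrow> f x)"
proof -
  have N0: "0 \<le> N" using f(2)[of undefined] by linarith
  from f(1) S(1) have "f measurable_on S" by (simp add: measurable_on_iff_borel_measurable)
  then obtain Z h where Z: "negligible Z" and h: "\<And>n. continuous_on UNIV (h n)"
    and lim: "\<And>x. x \<notin> Z \<Longrightarrow> (\<lambda>n. h n x) \<longlonglongrightarrow> (if x \<in> S then f x else 0)"
    unfolding measurable_on_def by auto
  let ?g = "\<lambda>n x. clip N (h n x)"
  have "continuous_on UNIV (?g n)" for n by (intro continuous_intros h)
  moreover have "AE x in lebesgue_on S. (\<lambda>n. ?g n x) \<longlonglongrightarrow> f x"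
  proof -
    have "AE x in lebesgue. x \<notin> Z"
      using Z by (simp add: AE_not_in negligible_iff_null_sets)
    then have "AE x in lebesgue_on S. x \<in> S \<and> x \<notin> Z"
      using S(1) by (auto simp: AE_restrict_space_iff)
    then show ?thesis
    proof eventually_elim
      case (elim x)
      then have "(\<lambda>n. h n x) \<longlonglongrightarrow> f x" using lim[of x] by simp
      then have "(\<lambda>n. ?g n x) \<longlonglongrightarrow> clip N (f x)"
        unfolding clip_def by (intro tendsto_intros)
      moreover have "clip N (f x) = f x" using f(2)[of x] by (auto simp: clip_def)
      ultimately show ?case by simp
    qed
  qed
  ultimately show ?thesis using abs_clip_le[OF N0] by (intro exI[of _ ?g]) auto
qed

lemma bounded_L2_approx_continuous:
  fixes f :: "'a::euclidean_space \<Rightarrow> real"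
  assumes S: "S \<in> sets lebesgue" "finite_measure (lebesgue_on S)"
    and f: "f \<in> borel_measurable (lebesgue_on S)" "\<And>x. \<bar>f x\<bar> \<le> N" and "0 < e"
  shows "\<exists>g. continuous_on UNIV g \<and> (\<forall>x. \<bar>g x\<bar> \<le> N) \<and> l2norm (lebesgue_on S) (\<lambda>x. g x - f x) < e"
proof -
  interpret finite_measure "lebesgue_on S" by fact
  obtain g where cg: "\<And>n. continuous_on UNIV (g n)" and bg: "\<And>n x. \<bar>g n x\<bar> \<le> N"
    and lim: "AE x in lebesgue_on S. (\<lambda>n. g n x) \<longlonglongrightarrow> f x"
    using bounded_AE_limit_continuous[OF S(1) f] by blast
  have "(\<lambda>n. l2norm (lebesgue_on S) (\<lambda>x. g n x - f x)) \<longlonglongrightarrow> 0"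
  proof (rule l2norm_tendsto_0[where w = "\<lambda>_. (2 * N)\<^sup>2"])
    show "g n \<in> borel_measurable (lebesgue_on S)" for n
      using borel_measurable_continuous_onI[OF cg] by (intro measurable_restrict_space1 measurable_completion) simp
    have "\<bar>g n x - f x\<bar> \<le> \<bar>2 * N\<bar>" for n x
      using f(2)[of x] bg[of n x] by linarith
    then show "AE x in lebesgue_on S. (g n x - f x)\<^sup>2 \<le> (2 * N)\<^sup>2" for n
      by (intro AE_I2) (metis abs_le_square_iff)
  qed (use f lim in auto)
  then obtain n where "l2norm (lebesgue_on S) (\<lambda>x. g n x - f x) < e"
    using \<open>0 < e\<close> using order_tendstoD(2) eventually_happens'[OF sequentially_bot] by blast
  then show ?thesis using cg bg by blast
qed

text \<open>The clipped functions converge in mean square, so the bounded case suffices.\<close>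

lemma L2_approx_continuous:
  fixes f :: "'a::euclidean_space \<Rightarrow> real"
  assumes S: "S \<in> sets lebesgue" "finite_measure (lebesgue_on S)"
    and f: "sq_int (lebesgue_on S) f" and "0 < e"
  shows "\<exists>g. continuous_on UNIV g \<and> (\<exists>B. \<forall>x. \<bar>g x\<bar> \<le> B) \<and> l2norm (lebesgue_on S) (\<lambda>x. g x - f x) < e"
proof -
  interpret finite_measure "lebesgue_on S" by fact
  note [measurable] = sq_int_measurable[OF f]
  have "(\<lambda>n. l2norm (lebesgue_on S) (\<lambda>x. clip (real n) (f x) - f x)) \<longlonglongrightarrow> 0"
  proof (rule l2norm_tendsto_0[where w = "\<lambda>x. (f x)\<^sup>2"])
    have "\<bar>clip (real n) y - y\<bar> \<le> \<bar>y\<bar>" for n y by (auto simp: clip_def)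
    then show "AE x in lebesgue_on S. (clip (real n) (f x) - f x)\<^sup>2 \<le> (f x)\<^sup>2" for n
      by (simp add: abs_le_square_iff)
  qed (use f in \<open>auto simp: sq_int_def clip_tendsto\<close>)
  then obtain n where n: "l2norm (lebesgue_on S) (\<lambda>x. clip (real n) (f x) - f x) < e / 2"
    using \<open>0 < e\<close> using order_tendstoD(2)[of _ 0 sequentially "e / 2"] eventually_happens'[OF sequentially_bot] half_gt_zero by blast
  have meas: "(\<lambda>x. clip (real n) (f x)) \<in> borel_measurable (lebesgue_on S)" by measurable
  obtain g where g: "continuous_on UNIV g" "\<forall>x. \<bar>g x\<bar> \<le> real n"
    "l2norm (lebesgue_on S) (\<lambda>x. g x - clip (real n) (f x)) < e / 2"
    using bounded_L2_approx_continuous[OF S meas, of "real n" "e / 2"] abs_clip_le[of "real n"] \<open>0 < e\<close> by auto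
  have gm: "g \<in> borel_measurable (lebesgue_on S)"
    using borel_measurable_continuous_onI[OF g(1)] by (intro measurable_restrict_space1 measurable_completion) simp
  have sg: "sq_int (lebesgue_on S) g" using gm g(2) by (intro sq_int_bounded[where B = "real n"]) auto
  have sc: "sq_int (lebesgue_on S) (\<lambda>x. clip (real n) (f x))"
    using meas by (intro sq_int_bounded[where B = "real n"]) (auto simp: abs_clip_le)
  have "l2norm (lebesgue_on S) (\<lambda>x. g x - f x) \<le> l2norm (lebesgue_on S) (\<lambda>x. g x - clip (real n) (f x))
      + l2norm (lebesgue_on S) (\<lambda>x. clip (real n) (f x) - f x)"
    using l2norm_triangle[OF sq_int_diff[OF sg sc] sq_int_diff[OF sc f]] by simp
  then show ?thesis using n g by (intro exI[of _ g]) auto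
qed

section \<open>Smooth functions and test functions\<close>

definition smooth :: "(real \<Rightarrow> real) \<Rightarrow> bool" where
  "smooth f \<longleftrightarrow> (\<forall>n. (deriv ^^ n) f differentiable_on UNIV)"

text \<open>Smoothness of finite order: closure under products and compositions is proved by induction on the
  order, which smoothness itself does not offer.\<close>

primrec diffk :: "nat \<Rightarrow> (real \<Rightarrow> real) \<Rightarrow> bool" where
  "diffk 0 f \<longleftrightarrow> f differentiable_on UNIV"
| "diffk (Suc n) f \<longleftrightarrow> f differentiable_on UNIV \<and> diffk n (deriv f)"

lemma diffk_SucD: "diffk (Suc n) f \<Longrightarrow> diffk n f"
  by (induction n arbitrary: f) auto

lemma diffk_iff: "diffk n f \<longleftrightarrow> (\<forall>k<Suc n. (deriv ^^ k) f differentiable_on UNIV)"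
proof (induction n arbitrary: f)
  case (Suc n)
  show ?case
    by (subst All_less_Suc2) (simp add: Suc.IH funpow_swap1)
qed simp

lemma smooth_iff_diffk: "smooth f \<longleftrightarrow> (\<forall>n. diffk n f)"
  unfolding smooth_def diffk_iff by auto

lemma smooth_coinduct:
  assumes "Q f" "\<And>g. Q g \<Longrightarrow> g differentiable_on UNIV \<and> Q (deriv g)"
  shows "smooth f"
proof -
  have "diffk n g" if "Q g" for n g
    using that by (induction n arbitrary: g) (auto dest: assms(2))
  then show ?thesis using assms(1) by (simp add: smooth_iff_diffk)
qed

lemma smooth_step: "smooth f \<longleftrightarrow> f differentiable_on UNIV \<and> smooth (deriv f)"
proof
  assume "smooth f"
  then have "diffk (Suc n) f" for n by (simp add: smooth_iff_diffk)
  then show "f differentiable_on UNIV \<and> smooth (deriv f)" by (simp add: smooth_iff_diffk)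
next
  assume "f differentiable_on UNIV \<and> smooth (deriv f)"
  then have "diffk n f" for n by (cases n) (auto simp: smooth_iff_diffk)
  then show "smooth f" by (simp add: smooth_iff_diffk)
qed

lemma differentiable_on_UNIV_iff: "(f :: real \<Rightarrow> real) differentiable_on UNIV \<longleftrightarrow> (\<forall>x. (f has_real_derivative deriv f x) (at x))"
  unfolding differentiable_on_def
  by (auto simp: DERIV_deriv_iff_real_differentiable real_differentiable_def)

lemma deriv_fun_eqI:
  assumes "\<And>x. ((f::real\<Rightarrow>real) has_real_derivative g x) (at x)"
  shows "deriv f = g" "f differentiable_on UNIV"
  using assms by (auto intro!: DERIV_imp_deriv simp: differentiable_on_def real_differentiable_def)

lemma smoothD: "smooth f \<Longrightarrow> (f has_real_derivative deriv f x) (at x)"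
  using smooth_step differentiable_on_UNIV_iff by blast

lemma smooth_deriv: "smooth f \<Longrightarrow> smooth (deriv f)"
  using smooth_step by blast

lemma smooth_continuous: "smooth f \<Longrightarrow> continuous_on A f"
  by (rule continuous_at_imp_continuous_on) (use smoothD DERIV_isCont in blast)

lemma diffk_add: "diffk n f \<Longrightarrow> diffk n g \<Longrightarrow> diffk n (\<lambda>x. f x + g x)"
proof (induction n arbitrary: f g)
  case (Suc n)
  have *: "((\<lambda>x. f x + g x) has_real_derivative deriv f x + deriv g x) (at x)" for x
    using Suc.prems by (intro DERIV_add) (auto simp: differentiable_on_UNIV_iff)
  show ?case using Suc deriv_fun_eqI[OF *] by simp
qed (auto intro: differentiable_on_add)

lemma diffk_mult: "diffk n f \<Longrightarrow> diffk n g \<Longrightarrow> diffk n (\<lambda>x. f x * g x)"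
proof (induction n arbitrary: f g)
  case (Suc n)
  have *: "((\<lambda>x. f x * g x) has_real_derivative deriv f x * g x + deriv g x * f x) (at x)" for x
    using Suc.prems by (intro DERIV_mult) (auto simp: differentiable_on_UNIV_iff)
  have "diffk n (\<lambda>x. deriv f x * g x + deriv g x * f x)"
    using Suc.prems diffk_SucD[OF Suc.prems(1)] diffk_SucD[OF Suc.prems(2)]
    by (intro diffk_add Suc.IH) auto
  then show ?case using deriv_fun_eqI[OF *] by simp
qed (auto intro: differentiable_on_mult)

lemma smooth_add: "smooth f \<Longrightarrow> smooth g \<Longrightarrow> smooth (\<lambda>x. f x + g x)"
  by (simp add: smooth_iff_diffk diffk_add)

lemma smooth_mult: "smooth f \<Longrightarrow> smooth g \<Longrightarrow> smooth (\<lambda>x. f x * g x)"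
  by (simp add: smooth_iff_diffk diffk_mult)

lemma smooth_const: "smooth (\<lambda>x. c)"
  by (rule smooth_coinduct[where Q = "\<lambda>f. \<exists>c. f = (\<lambda>x. c)"]) auto

lemma smooth_id: "smooth (\<lambda>x. x)"
  using deriv_fun_eqI[of "\<lambda>x. x" "\<lambda>x. 1"] smooth_const[of 1] by (subst smooth_step) simp

lemma smooth_diff: "smooth f \<Longrightarrow> smooth g \<Longrightarrow> smooth (\<lambda>x. f x - g x)"
  using smooth_add[OF _ smooth_mult[OF smooth_const[of "-1"]], of f g] by simp

lemma smooth_sum: "(\<And>i. i \<in> A \<Longrightarrow> smooth (f i)) \<Longrightarrow> smooth (\<lambda>x. \<Sum>i\<in>A. f i x)"
  by (induction A rule: infinite_finite_induct) (auto intro: smooth_const smooth_add)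

lemma smooth_power: "smooth f \<Longrightarrow> smooth (\<lambda>x. f x ^ n)"
  by (induction n) (auto intro: smooth_const smooth_mult)

lemma smooth_exp: assumes "smooth h" shows "smooth (\<lambda>x. exp (h x))"
proof -
  have *: "((\<lambda>x. exp (h x)) has_real_derivative deriv h x * exp (h x)) (at x)" for x
    using smoothD[OF assms] by (auto intro!: derivative_eq_intros)
  have "diffk n (\<lambda>x. exp (h x))" for n
  proof (induction n)
    case (Suc n)
    then show ?case using deriv_fun_eqI[OF *] diffk_mult smooth_deriv[OF assms] by (simp add: smooth_iff_diffk)
  qed (use deriv_fun_eqI[OF *] in auto)
  then show ?thesis by (simp add: smooth_iff_diffk)
qed

lemma smooth_affine: assumes "smooth f" shows "smooth (\<lambda>x. f (c * x + d))"
proof -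
  have "diffk n (\<lambda>x. f (c * x + d))" if "smooth f" for n f
    using that
  proof (induction n arbitrary: f)
    case (Suc n)
    have *: "((\<lambda>x. f (c * x + d)) has_real_derivative deriv f (c * x + d) * c) (at x)" for x
      by (rule DERIV_chain2[OF smoothD[OF Suc.prems]]) (auto intro!: derivative_eq_intros)
    show ?case
      using deriv_fun_eqI[OF *] Suc.IH[OF smooth_deriv[OF Suc.prems]] diffk_mult[of n _ "\<lambda>_. c"] smooth_const[of c]
      by (simp add: smooth_iff_diffk)
  next
    case (0 f)
    have *: "((\<lambda>x. f (c * x + d)) has_real_derivative deriv f (c * x + d) * c) (at x)" for x
      by (rule DERIV_chain2[OF smoothD[OF 0]]) (auto intro!: derivative_eq_intros)
    show ?case using deriv_fun_eqI[OF *] by simp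
  qed
  then show ?thesis using assms by (simp add: smooth_iff_diffk)
qed

text \<open>For \<open>p = 1\<close> this is the standard smooth function that is flat at the origin; the polynomial
  factors close the family under differentiation, which proves smoothness by coinduction.\<close>

definition flat :: "real poly \<Rightarrow> real \<Rightarrow> real" where
  "flat p x = (if 0 < x then poly p (1 / x) * exp (- 1 / x) else 0)"

lemma poly_exp_tendsto_0: "((\<lambda>y. poly p y * exp (- y)) \<longlongrightarrow> 0) at_top" for p :: "real poly"
proof -
  have "((\<lambda>y. \<Sum>i\<le>degree p. coeff p i * (y ^ i / exp y)) \<longlongrightarrow> (\<Sum>i\<le>degree p. coeff p i * 0)) at_top"
    by (intro tendsto_sum tendsto_mult tendsto_const tendsto_power_div_exp_0)
  then show ?thesis by (simp add: poly_altdef sum_distrib_right exp_minus divide_inverse mult.assoc)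
qed

lemma flat_deriv: "(flat p has_real_derivative flat ([:0, 0, 1:] * (p - pderiv p)) x) (at x)"
proof -
  consider "0 < x" | "x < 0" | "x = 0" by linarith
  then show ?thesis
  proof cases
    case 1
    have d: "((\<lambda>x. poly p (1 / x) * exp (- 1 / x)) has_real_derivative
        poly (pderiv p) (1 / x) * (- 1 / x\<^sup>2) * exp (- 1 / x) + (1 / x\<^sup>2 * exp (- 1 / x)) * poly p (1 / x)) (at x)"
    proof (rule DERIV_mult)
      have i: "((\<lambda>x. 1 / x) has_real_derivative (- 1 / x\<^sup>2)) (at x)"
        using 1 by (auto intro!: derivative_eq_intros simp: power2_eq_square)
      show "((\<lambda>x. poly p (1 / x)) has_real_derivative poly (pderiv p) (1 / x) * (- 1 / x\<^sup>2)) (at x)"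
        by (rule DERIV_chain2[OF poly_DERIV i])
      show "((\<lambda>x. exp (- 1 / x)) has_real_derivative 1 / x\<^sup>2 * exp (- 1 / x)) (at x)"
        using 1 by (auto intro!: derivative_eq_intros simp: power2_eq_square)
    qed
    have e: "poly (pderiv p) (1 / x) * (- 1 / x\<^sup>2) * exp (- 1 / x) + (1 / x\<^sup>2 * exp (- 1 / x)) * poly p (1 / x)
       = flat ([:0, 0, 1:] * (p - pderiv p)) x"
      using 1 by (simp add: flat_def power2_eq_square field_simps)
    show ?thesis
      unfolding e[symmetric]
      by (rule has_field_derivative_transform_within_open[OF d, of "{0<..}"]) (use 1 in \<open>auto simp: flat_def\<close>)
  next
    case 2
    have "((\<lambda>x. 0) has_real_derivative flat ([:0, 0, 1:] * (p - pderiv p)) x) (at x)"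
      using 2 by (simp add: flat_def)
    then show ?thesis
      by (rule has_field_derivative_transform_within_open[of _ _ _ "{..<0}"]) (use 2 in \<open>auto simp: flat_def\<close>)
  next
    case 3
    have "((\<lambda>h. (flat p (0 + h) - flat p 0) / h) \<longlongrightarrow> 0) (at 0)"
    proof (rule filterlim_split_at)
      have "((\<lambda>h. 0) \<longlongrightarrow> (0::real)) (at_left 0)" by simp
      then show "((\<lambda>h. (flat p (0 + h) - flat p 0) / h) \<longlongrightarrow> 0) (at_left 0)"
        by (rule Lim_transform_eventually) (auto simp: eventually_at_left_field flat_def intro!: exI[of _ "-1"])
      have "((\<lambda>h. poly ([:0, 1:] * p) (inverse h) * exp (- inverse h)) \<longlongrightarrow> 0) (at_right 0)"
        by (rule filterlim_compose[OF poly_exp_tendsto_0 filterlim_inverse_at_top_right])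
      then show "((\<lambda>h. (flat p (0 + h) - flat p 0) / h) \<longlongrightarrow> 0) (at_right 0)"
        by (rule Lim_transform_eventually)
          (auto simp: eventually_at_right_field flat_def field_simps intro!: exI[of _ "1"])
    qed
    then show ?thesis using 3 by (simp add: DERIV_def flat_def)
  qed
qed

lemma smooth_flat: "smooth (flat p)"
proof (rule smooth_coinduct[where Q = "\<lambda>f. \<exists>p. f = flat p"])
  fix g assume "\<exists>p. g = flat p"
  then obtain p where g: "g = flat p" by blast
  show "g differentiable_on UNIV \<and> (\<exists>p. deriv g = flat p)"
    unfolding g using deriv_fun_eqI[OF flat_deriv] by blast
qed auto

lemma flat_one: "flat 1 x = (if 0 < x then exp (- 1 / x) else 0)"
  by (simp add: flat_def)

definition bump :: "real \<Rightarrow> real \<Rightarrow> real \<Rightarrow> real" where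
  "bump a b x = flat 1 (x - a) * flat 1 (b - x)"

text \<open>As \<open>bump a b\<close> is positive exactly on \<open>(a, b)\<close>, these smooth functions increase to the indicator of
  \<open>(a, b)\<close>.\<close>

definition cutoff :: "real \<Rightarrow> real \<Rightarrow> nat \<Rightarrow> real \<Rightarrow> real" where
  "cutoff a b n x = 1 - exp (- (real n * bump a b x))"

lemma bump_nonneg: "0 \<le> bump a b x"
  by (simp add: bump_def flat_one)

lemma bump_pos_iff: "0 < bump a b x \<longleftrightarrow> x \<in> {a<..<b}"
  by (auto simp: bump_def flat_one)

lemma smooth_bump: "smooth (bump a b)"
  using smooth_mult[OF smooth_affine[OF smooth_flat, of 1 1 "-a"] smooth_affine[OF smooth_flat, of 1 "-1" b]]
  unfolding bump_def[abs_def] by (simp add: algebra_simps)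

lemma smooth_cutoff: "smooth (cutoff a b n)"
  using smooth_diff[OF smooth_const[of 1] smooth_exp[OF smooth_mult[OF smooth_const[of "- real n"] smooth_bump]]]
  unfolding cutoff_def[abs_def] by simp

lemma cutoff_bounds: "0 \<le> cutoff a b n x" "cutoff a b n x \<le> 1"
  using bump_nonneg[of a b x] by (auto simp: cutoff_def)

lemma cutoff_outside: "x \<notin> {a<..<b} \<Longrightarrow> cutoff a b n x = 0"
  using bump_pos_iff[of a b x] bump_nonneg[of a b x] by (auto simp: cutoff_def)

lemma cutoff_tendsto: "(\<lambda>n. cutoff a b n x) \<longlonglongrightarrow> indicator {a<..<b} x"
proof (cases "x \<in> {a<..<b}")
  case True
  then have "0 < bump a b x" by (simp only: bump_pos_iff)
  then have "filterlim (\<lambda>n. real n * bump a b x) at_top sequentially"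
    by (intro filterlim_at_top_mult_tendsto_pos[OF tendsto_const] filterlim_real_sequentially)
  then have "(\<lambda>n. exp (- (real n * bump a b x))) \<longlonglongrightarrow> 0"
    by (intro filterlim_compose[OF exp_at_bot] filterlim_uminus_at_bot_at_top[THEN filterlim_compose])
  then have "(\<lambda>n. 1 - exp (- (real n * bump a b x))) \<longlonglongrightarrow> 1 - 0" by (intro tendsto_intros)
  with True show ?thesis by (simp add: cutoff_def)
qed (simp add: cutoff_outside)

lemma test_functions_iff: "\<eta> \<in> test_functions \<longleftrightarrow> smooth \<eta> \<and> closure {u. \<eta> u \<noteq> 0} \<subseteq> {0<..<1}"
  by (simp add: test_functions_def smooth_def)

lemma test_functionI:
  assumes "smooth \<eta>" "0 < a" "b < 1" "\<And>x. x \<notin> {a..b} \<Longrightarrow> \<eta> x = 0"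
  shows "\<eta> \<in> test_functions"
proof -
  have "closure {u. \<eta> u \<noteq> 0} \<subseteq> {a..b}"
    using assms(4) by (intro closure_minimal) (blast, simp)
  also have "\<dots> \<subseteq> {0<..<1}" using assms by auto
  finally show ?thesis using assms by (simp add: test_functions_iff)
qed

lemma test_functionE:
  assumes "\<eta> \<in> test_functions"
  obtains a b where "0 < a" "a < b" "b < 1" "smooth \<eta>" "\<And>x. x \<notin> {a..b} \<Longrightarrow> \<eta> x = 0"
proof -
  let ?K = "insert (1/2) (closure {u. \<eta> u \<noteq> 0})"
  have sub: "?K \<subseteq> {0<..<1}" using assms by (simp add: test_functions_iff)
  have "bounded ?K" using sub bounded_subset[OF bounded_box[of "0::real" 1], of ?K] by simp
  moreover have "closed ?K" by simp
  ultimately have K: "compact ?K" by (simp add: compact_eq_bounded_closed)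
  obtain a where a: "a \<in> ?K" "\<And>x. x \<in> ?K \<Longrightarrow> a \<le> x"
    using compact_attains_inf[OF K] by blast
  obtain b where b: "b \<in> ?K" "\<And>x. x \<in> ?K \<Longrightarrow> x \<le> b"
    using compact_attains_sup[OF K] by blast
  have ab: "0 < a" "b < 1" "a \<le> b" using a b sub by auto
  show ?thesis
  proof (rule that[of a "(b + 1) / 2"])
    fix x assume "x \<notin> {a..(b+1)/2}"
    then have "x \<notin> ?K" using a(2)[of x] b(2)[of x] ab by auto
    then show "\<eta> x = 0" using closure_subset[of "{u. \<eta> u \<noteq> 0}"] by auto
  qed (use ab assms in \<open>auto simp: test_functions_iff\<close>)
qed

text \<open>Rational coefficients in the Bernstein basis: the family is countable, smooth and dense.\<close>

section \<open>Polynomials that approximate square-integrable functions\<close>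

definition rpoly :: "rat list \<Rightarrow> real \<Rightarrow> real" where
  "rpoly l u = (\<Sum>k<length l. of_rat (l ! k) * Bernstein (length l - 1) k u)"

lemma smooth_rpoly: "smooth (rpoly l)"
  unfolding rpoly_def[abs_def] Bernstein_def
  by (intro smooth_sum smooth_mult smooth_power smooth_const smooth_id smooth_diff)

text \<open>The Bernstein basis is nonnegative and sums to one, so that rounding the coefficients changes the
  polynomial by at most the largest rounding error.\<close>

lemma rpoly_dense:
  assumes "continuous_on {0..1} g" "0 < e"
  shows "\<exists>l. \<forall>x\<in>{0..1}. \<bar>rpoly l x - g x\<bar> < e"
proof -
  obtain n where n: "\<And>x. x \<in> {0..1} \<Longrightarrow> \<bar>g x - (\<Sum>k\<le>n. g (k / n) * Bernstein n k x)\<bar> < e / 2"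
    using Bernstein_Weierstrass[OF assms(1), of "e / 2"] assms(2) by auto
  have "\<exists>q. \<bar>of_rat q - g (real k / real n)\<bar> < e / 2" for k
    using of_rat_dense[of "g (real k / real n)" "g (real k / real n) + e / 2"] assms(2)
    by (smt (verit) half_gt_zero)
  then obtain q where q: "\<And>k. \<bar>of_rat (q k) - g (real k / real n)\<bar> < e / 2" by metis
  have r: "rpoly (map q [0..<Suc n]) x = (\<Sum>k\<le>n. of_rat (q k) * Bernstein n k x)" for x
    unfolding rpoly_def by (simp add: lessThan_Suc_atMost del: upt_Suc)
  show ?thesis
  proof (intro exI ballI)
    fix x :: real assume x: "x \<in> {0..1}"
    have "\<bar>rpoly (map q [0..<Suc n]) x - (\<Sum>k\<le>n. g (k / n) * Bernstein n k x)\<bar>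
       = \<bar>\<Sum>k\<le>n. (of_rat (q k) - g (k / n)) * Bernstein n k x\<bar>"
      unfolding r by (simp add: sum_subtractf left_diff_distrib)
    also have "\<dots> \<le> (\<Sum>k\<le>n. \<bar>(of_rat (q k) - g (k / n)) * Bernstein n k x\<bar>)" by (rule sum_abs)
    also have "\<dots> \<le> (\<Sum>k\<le>n. e / 2 * Bernstein n k x)"
    proof (rule sum_mono)
      fix k
      have "0 \<le> Bernstein n k x" using x by (intro Bernstein_nonneg) auto
      with q[of k] show "\<bar>(of_rat (q k) - g (k / n)) * Bernstein n k x\<bar> \<le> e / 2 * Bernstein n k x"
        by (simp only: abs_mult abs_of_nonneg) (rule mult_right_mono, auto)
    qed
    also have "\<dots> = e / 2" by (simp only: sum_distrib_left[symmetric] sum_Bernstein mult_1_right)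
    finally show "\<bar>rpoly (map q [0..<Suc n]) x - g x\<bar> < e" using n[OF x] by linarith
  qed
qed

abbreviation (input) I1 :: "real measure" where "I1 \<equiv> lebesgue_on {0..1}"

lemma finite_measure_lebesgue_on: 
  "finite_measure (lebesgue_on {a..b::real})"
  by (intro finite_measure_lebesgue_on) auto

interpretation Icc: finite_measure "lebesgue_on {a..b::real}" for a b
  by (rule finite_measure_lebesgue_on)

lemma measure_I1 [simp]: "measure I1 {0..1} = 1" "measure I1 (space I1) = 1"
  by (simp_all add: measure_restrict_space)

lemma continuous_measurable_lebesgue_on [intro]:
  fixes f :: "real \<Rightarrow> real"
  shows "continuous_on UNIV f \<Longrightarrow> f \<in> borel_measurable (lebesgue_on S)"
  using borel_measurable_continuous_onI by (intro measurable_restrict_space1 measurable_completion) simp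

lemma continuous_on_Icc_measurable [intro]:
  fixes f :: "real \<Rightarrow> real"
  assumes "continuous_on {a..b} f"
  shows "f \<in> borel_measurable (lebesgue_on {a..b})"
  by (rule continuous_imp_measurable_on_sets_lebesgue[OF assms]) simp

lemma continuous_sq_int:
  fixes f :: "real \<Rightarrow> real"
  assumes "continuous_on {a..b} f" shows "sq_int (lebesgue_on {a..b}) f"
proof -
  have "compact (f ` {a..b})" using assms by (intro compact_continuous_image) auto
  then have "bounded (f ` {a..b})" by (rule compact_imp_bounded)
  then obtain B where "\<And>x. x \<in> {a..b} \<Longrightarrow> \<bar>f x\<bar> \<le> B"
    unfolding bounded_iff by force
  then show ?thesis
    using assms by (intro Icc.sq_int_bounded[where B = B] AE_I2) (auto simp: space_restrict_space)
qed

lemma rpoly_sq_int: "sq_int I1 (rpoly l)"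
  by (intro continuous_sq_int smooth_continuous smooth_rpoly)

lemma rpoly_dense_L2:
  assumes "sq_int I1 f" "0 < e"
  shows "\<exists>l. l2norm I1 (\<lambda>x. rpoly l x - f x) < e"
proof -
  obtain g where g: "continuous_on UNIV g" "l2norm I1 (\<lambda>x. g x - f x) < e / 2"
    using L2_approx_continuous[OF _ finite_measure_lebesgue_on assms(1), of "e / 2"] assms(2) by auto
  have gc: "continuous_on {0..1} g" using g(1) continuous_on_subset by blast
  obtain l where l: "\<And>x. x \<in> {0..1} \<Longrightarrow> \<bar>rpoly l x - g x\<bar> < e / 2"
    using rpoly_dense[OF gc, of "e / 2"] assms(2) by (meson half_gt_zero)
  have sg: "sq_int I1 g" by (rule continuous_sq_int[OF gc])
  have "(l2norm I1 (\<lambda>x. rpoly l x - g x))\<^sup>2 \<le> (\<integral>x. (e/2)\<^sup>2 \<partial>I1)"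
    unfolding l2norm_sq
  proof (rule integral_mono)
    show "integrable I1 (\<lambda>x. (rpoly l x - g x)\<^sup>2)"
      using sq_int_diff[OF rpoly_sq_int sg] by (simp add: sq_int_def)
    show "(rpoly l x - g x)\<^sup>2 \<le> (e / 2)\<^sup>2" if "x \<in> space I1" for x
      using l[of x] that assms(2) by (intro power2_le_iff_abs_le[THEN iffD2]) (auto simp: space_restrict_space)
  qed simp
  then have "l2norm I1 (\<lambda>x. rpoly l x - g x) \<le> e / 2"
    using assms(2) by (intro power2_le_imp_le[of "l2norm I1 (\<lambda>x. rpoly l x - g x)"]) simp_all
  moreover have "l2norm I1 (\<lambda>x. rpoly l x - f x) \<le> l2norm I1 (\<lambda>x. rpoly l x - g x) + l2norm I1 (\<lambda>x. g x - f x)"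
    using l2norm_triangle[OF sq_int_diff[OF rpoly_sq_int sg] sq_int_diff[OF sg assms(1)]] by simp
  ultimately show ?thesis using g(2) by (intro exI[of _ l]) linarith
qed

lemma smooth_antiderivative:
  assumes "smooth q"
  shows "\<exists>Q. smooth Q \<and> deriv Q = q \<and> Q 0 = c"
proof -
  have "isCont q x" for x using smoothD[OF assms] DERIV_isCont by blast
  then obtain F where "\<And>x. (F has_vector_derivative q x) (at x)"
    using einterval_antiderivative[of "-\<infinity>" "\<infinity>" q] by auto
  then have "((\<lambda>x. F x - F 0 + c) has_real_derivative q x) (at x)" for x
    by (auto intro!: derivative_eq_intros simp: has_real_derivative_iff_has_vector_derivative)
  note d = deriv_fun_eqI[OF this]
  have "smooth (\<lambda>x. F x - F 0 + c)"
    using d assms by (subst smooth_step) simp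
  then show ?thesis
    using d by (intro exI[of _ "\<lambda>x. F x - F 0 + c"]) simp
qed

section \<open>The inner product on the unit interval\<close>

lemma L2_iff: "f \<in> L2 \<longleftrightarrow> sq_int I1 f"
  by (simp add: L2_def sq_int_def)

lemma ip_self: "ip f f = (l2norm I1 f)\<^sup>2"
  by (simp only: l2norm_sq ip_def power2_eq_square[of "f _"])

lemma ip_CS: "sq_int I1 f \<Longrightarrow> sq_int I1 g \<Longrightarrow> \<bar>ip f g\<bar> \<le> l2norm I1 f * l2norm I1 g"
  unfolding ip_def by (rule Cauchy_Schwarz_integral)

lemma ip_diff_right: "sq_int I1 f \<Longrightarrow> sq_int I1 g \<Longrightarrow> sq_int I1 h \<Longrightarrow> ip f (\<lambda>u. g u - h u) = ip f g - ip f h"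
  unfolding ip_def right_diff_distrib by (intro Bochner_Integration.integral_diff sq_int_mult)

lemma ip_commute: "ip f g = ip g f"
  by (simp add: ip_def mult.commute)

lemma ip_diff_left: "sq_int I1 f \<Longrightarrow> sq_int I1 g \<Longrightarrow> sq_int I1 h \<Longrightarrow> ip (\<lambda>u. g u - h u) f = ip g f - ip h f"
  using ip_diff_right by (simp add: ip_commute)

lemma ip_cong_AE:
  assumes "f \<in> borel_measurable I1" "f' \<in> borel_measurable I1" "AE u in I1. f u = f' u"
    "g \<in> borel_measurable I1" "g' \<in> borel_measurable I1" "AE u in I1. g u = g' u"
  shows "ip f g = ip f' g'"
  unfolding ip_def
proof (rule integral_cong_AE)
  show "AE u in I1. f u * g u = f' u * g' u" using assms(3,6) by eventually_elim simp
qed (use assms in auto)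

lemma AE_lebesgue_on_Icc: "(AE u in lebesgue_on {a..b::real}. Q u) \<longleftrightarrow> (AE u in lebesgue. u \<in> {a..b} \<longrightarrow> Q u)"
  by (subst AE_restrict_space_iff) auto

lemma measurable_if_lebesgue:
  fixes f :: "'a::euclidean_space \<Rightarrow> real"
  assumes "S \<in> sets lebesgue"
  shows "(\<lambda>x. if x \<in> S then f x else 0) \<in> borel_measurable lebesgue \<longleftrightarrow> f \<in> borel_measurable (lebesgue_on S)"
proof -
  have "(\<lambda>x. indicator S x *\<^sub>R f x) = (\<lambda>x. if x \<in> S then f x else 0)" by auto
  then show ?thesis using assms by (subst borel_measurable_restrict_space_iff) auto
qed

lemma measurable_cong_AE_set:
  fixes f g :: "'a::euclidean_space \<Rightarrow> real"
  assumes S: "S \<in> sets lebesgue" and f: "f \<in> borel_measurable (lebesgue_on S)"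
    and eq: "AE x in lebesgue_on S. f x = g x"
  shows "g \<in> borel_measurable (lebesgue_on S)"
proof -
  have "(\<lambda>x. if x \<in> S then f x else 0) \<in> borel_measurable lebesgue"
    using f by (subst measurable_if_lebesgue[OF S])
  moreover have "AE x in lebesgue. x \<in> S \<longrightarrow> f x = g x"
    using eq S by (subst (asm) AE_restrict_space_iff) auto
  then have "AE x in lebesgue. (if x \<in> S then f x else 0) = (if x \<in> S then g x else 0)"
    by eventually_elim auto
  ultimately have "(\<lambda>x. if x \<in> S then g x else 0) \<in> borel_measurable lebesgue"
    by (rule borel_measurable_AE)
  then show ?thesis by (subst (asm) measurable_if_lebesgue[OF S])
qed

lemma measurable_cong_AE_lebesgue_on:
  fixes f g :: "real \<Rightarrow> real"
  assumes "f \<in> borel_measurable (lebesgue_on {a..b})" "AE x in lebesgue_on {a..b}. f x = g x"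
  shows "g \<in> borel_measurable (lebesgue_on {a..b})"
  using measurable_cong_AE_set[OF _ assms] by simp

lemma AE_open_unit: "(AE u in lebesgue_on {0<..<1::real}. Q u) \<longleftrightarrow> (AE u in I1. Q u)"
proof -
  have "AE u in lebesgue. u \<notin> {0, 1::real}"
    by (intro AE_not_in) (auto simp flip: negligible_iff_null_sets)
  then have "(AE u in lebesgue. u \<in> {0<..<1} \<longrightarrow> Q u) \<longleftrightarrow> (AE u in lebesgue. u \<in> {0..1} \<longrightarrow> Q u)"
    by (auto elim!: eventually_elim2)
  then show ?thesis by (simp add: AE_restrict_space_iff)
qed

lemma integral_open_unit:
  fixes f :: "real \<Rightarrow> real"
  assumes "f \<in> borel_measurable I1"
  shows "(LINT u | lebesgue_on {0<..<1}. f u) = (LINT u | I1. f u)"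
proof -
  have m: "(\<lambda>x. if x \<in> {0..1} then f x else 0) \<in> borel_measurable lebesgue"
    using assms by (subst measurable_if_lebesgue) auto
  have a: "AE u in lebesgue. (if u \<in> {0..1} then f u else 0) = (if u \<in> {0<..<1} then f u else 0)"
    by (rule AE_mp[OF AE_not_in[of "{0, 1}"]]) (auto simp flip: negligible_iff_null_sets)
  have "(LINT u|lebesgue. (if u \<in> {0<..<1} then f u else 0)) = (LINT u|lebesgue. (if u \<in> {0..1} then f u else 0))"
    using a borel_measurable_AE[OF m a] m by (intro integral_cong_AE) auto
  then show ?thesis
    using Lebesgue_Measure.integral_restrict_UNIV[of "{0<..<1}" f] Lebesgue_Measure.integral_restrict_UNIV[of "{0..1}" f] by simp
qed

section \<open>Primitives\<close>

text \<open>The function with value \<open>c\<close> at \<open>0\<close> and derivative \<open>w\<close>. Through \<open>ip\<close> the Cauchy-Schwarz inequality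
  controls it, and joint measurability in further parameters reduces to that of \<open>ip\<close>.\<close>

definition prim :: "real \<Rightarrow> (real \<Rightarrow> real) \<Rightarrow> real \<Rightarrow> real" where
  "prim c w u = c + ip (indicator {0..u}) w"

lemma ip_indicator:
  assumes "u \<le> 1"
  shows "ip (indicator {0..u}) w = (LINT v | lebesgue_on {0..u}. w v)"
proof -
  have "ip (indicator {0..u}) w = (LINT v | I1. (if v \<in> {0..u} then w v else 0))"
    unfolding ip_def by (intro Bochner_Integration.integral_cong) auto
  also have "\<dots> = (LINT v | lebesgue_on {0..u}. w v)"
    using assms by (intro integral_restrict) auto
  finally show ?thesis .
qed

lemma integral_FTC_lebesgue_on:
  fixes f f' :: "real \<Rightarrow> real"
  assumes "a \<le> b" "\<And>x. x \<in> {a..b} \<Longrightarrow> (f has_vector_derivative f' x) (at x within {a..b})"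
    and "continuous_on {a..b} f'"
  shows "(LINT x | lebesgue_on {a..b}. f' x) = f b - f a"
proof -
  have "integrable (lebesgue_on {a..b}) f'"
    using continuous_sq_int[OF assms(3)] by (rule Icc.sq_int_integrable)
  then have "(LINT x | lebesgue_on {a..b}. f' x) = integral {a..b} f'"
    by (rule lebesgue_integral_eq_integral) simp
  also have "\<dots> = f b - f a"
    using fundamental_theorem_of_calculus[OF assms(1,2)] by blast
  finally show ?thesis .
qed

lemma prim_smooth:
  assumes "smooth q" "smooth Q" "deriv Q = q" "Q 0 = c" "u \<in> {0..1}"
  shows "prim c q u = Q u"
proof -
  have "(LINT v | lebesgue_on {0..u}. q v) = Q u - Q 0"
  proof (rule integral_FTC_lebesgue_on)
    show "(Q has_vector_derivative q x) (at x within {0..u})" for x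
      using smoothD[OF assms(2)] assms(3)
      by (auto simp: has_real_derivative_iff_has_vector_derivative intro: has_vector_derivative_at_within)
  qed (use assms smooth_continuous in auto)
  then show ?thesis using assms by (simp add: prim_def ip_indicator)
qed

lemma sq_int_indicator: "A \<in> sets lebesgue \<Longrightarrow> sq_int I1 (indicator A)"
  by (intro Icc.sq_int_bounded[where B = 1]) (auto simp: indicator_def intro!: measurable_restrict_space1)

lemma l2norm_indicator_Ioc:
  assumes "0 \<le> u" "u \<le> v" "v \<le> 1"
  shows "l2norm I1 (indicator {u<..v}) = sqrt (v - u)"
proof -
  have "(LINT x | I1. (indicat_real {u<..v} x)\<^sup>2) = (LINT x | I1. indicat_real {u<..v} x)"
    by (intro Bochner_Integration.integral_cong) (auto simp: indicator_def)
  also have "\<dots> = measure I1 ({u<..v} \<inter> space I1)" by (rule Bochner_Integration.integral_indicator)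
  also have "\<dots> = v - u"
    using assms by (subst measure_restrict_space) (auto simp: Int_absorb2 subset_eq)
  finally show ?thesis by (simp add: l2norm_def)
qed

lemma prim_diff:
  assumes "sq_int I1 w" "0 \<le> u" "u \<le> v" "v \<le> 1"
  shows "\<bar>prim c w v - prim c w u\<bar> \<le> sqrt (v - u) * l2norm I1 w"
proof -
  have "prim c w v - prim c w u = ip (\<lambda>x. indicator {0..v} x - indicator {0..u} x) w"
    unfolding prim_def using assms by (subst ip_diff_left) (auto intro: sq_int_indicator)
  also have "\<dots> = ip (indicator {u<..v}) w"
    using assms unfolding ip_def by (intro Bochner_Integration.integral_cong) (auto simp: indicator_def)
  finally show ?thesis
    using ip_CS[OF sq_int_indicator assms(1), of "{u<..v}"] l2norm_indicator_Ioc assms by simp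
qed

lemma prim_bound:
  assumes "sq_int I1 w" "u \<in> {0..1}"
  shows "\<bar>prim 0 w u\<bar> \<le> l2norm I1 w"
proof -
  have "\<bar>ip (indicator {0..u}) w\<bar> \<le> l2norm I1 (indicator {0..u}) * l2norm I1 w"
    by (intro ip_CS sq_int_indicator assms) simp
  also have "l2norm I1 (indicator {0..u}) \<le> 1"
  proof -
    have "(l2norm I1 (indicator {0..u}))\<^sup>2 \<le> (LINT x | I1. 1)"
      unfolding l2norm_sq using sq_int_indicator[of "{0..u}"]
      by (intro integral_mono) (auto simp: sq_int_def indicator_def)
    then show ?thesis using power2_le_imp_le[of "l2norm I1 (indicator {0..u})" 1] by simp
  qed
  then have "l2norm I1 (indicator {0..u}) * l2norm I1 w \<le> 1 * l2norm I1 w"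
    by (intro mult_right_mono) auto
  finally show ?thesis by (simp add: prim_def)
qed

lemma prim_continuous:
  assumes "sq_int I1 w"
  shows "continuous_on {0..1} (prim c w)"
  unfolding continuous_on_iff
proof (intro ballI allI impI)
  fix x e :: real assume x: "x \<in> {0..1}" and e: "0 < e"
  define K where "K = l2norm I1 w + 1"
  have K: "0 < K" using l2norm_nonneg[of I1 w] unfolding K_def by linarith
  have *: "\<bar>prim c w y - prim c w x\<bar> \<le> sqrt \<bar>y - x\<bar> * K" if "y \<in> {0..1}" for y
  proof -
    have "\<bar>prim c w y - prim c w x\<bar> \<le> sqrt \<bar>y - x\<bar> * l2norm I1 w"
      using prim_diff[OF assms, of x y c] prim_diff[OF assms, of y x c] that x by (cases "x \<le> y") auto
    also have "\<dots> \<le> sqrt \<bar>y - x\<bar> * K" unfolding K_def by (intro mult_left_mono) auto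
    finally show ?thesis .
  qed
  show "\<exists>d>0. \<forall>x'\<in>{0..1}. dist x' x < d \<longrightarrow> dist (prim c w x') (prim c w x) < e"
  proof (intro exI[of _ "(e / K)\<^sup>2"] conjI ballI impI)
    fix y assume y: "y \<in> {0..1}" "dist y x < (e / K)\<^sup>2"
    then have "sqrt \<bar>y - x\<bar> < e / K"
      using K e by (auto simp: dist_real_def intro!: real_less_lsqrt)
    then have "sqrt \<bar>y - x\<bar> * K < e" using K by (simp add: field_simps)
    then show "dist (prim c w y) (prim c w x) < e" using *[OF y(1)] by (simp add: dist_real_def)
  qed (use K e in auto)
qed

lemma prim_sq_int: "sq_int I1 w \<Longrightarrow> sq_int I1 (prim c w)"
  by (rule continuous_sq_int) (rule prim_continuous)

lemma prim_diff_w: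
  assumes "sq_int I1 w" "sq_int I1 v"
  shows "prim c w u - prim d v u = prim (c - d) (\<lambda>x. w x - v x) u"
  using assms by (simp add: prim_def ip_diff_right sq_int_indicator)

lemma l2norm_prim:
  assumes "sq_int I1 w"
  shows "l2norm I1 (prim 0 w) \<le> l2norm I1 w"
proof -
  have "(l2norm I1 (prim 0 w))\<^sup>2 \<le> (LINT x | I1. (l2norm I1 w)\<^sup>2)"
    unfolding l2norm_sq[of I1 "prim 0 w"] using prim_sq_int[OF assms, of 0]
    by (intro integral_mono)
      (auto simp: sq_int_def space_restrict_space abs_le_square_iff[symmetric] intro!: prim_bound assms)
  then have "(l2norm I1 (prim 0 w))\<^sup>2 \<le> (l2norm I1 w)\<^sup>2" by simp
  then show ?thesis by (rule power2_le_imp_le) simp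
qed

lemma prim_by_parts_smooth:
  assumes q: "smooth q"
    and H: "\<And>u. u \<in> {0..1} \<Longrightarrow> (H has_vector_derivative H' u) (at u within {0..1})"
    and H': "continuous_on {0..1} H'"
  shows "ip (prim c q) H' = prim c q 1 * H 1 - c * H 0 - ip q H"
proof -
  obtain Q where Q: "smooth Q" "deriv Q = q" "Q 0 = c" using smooth_antiderivative[OF q] by blast
  have cH: "continuous_on {0..1} H" using H by (rule continuous_on_vector_derivative)
  have cq: "continuous_on {0..1} q" "continuous_on {0..1} Q" using q Q smooth_continuous by auto
  have "(LINT u | I1. Q u * H' u + q u * H u) = Q 1 * H 1 - Q 0 * H 0"
  proof (rule integral_FTC_lebesgue_on)
    fix x :: real assume x: "x \<in> {0..1}"
    have "(Q has_vector_derivative q x) (at x within {0..1})"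
      using smoothD[OF Q(1)] Q(2)
      by (auto simp: has_real_derivative_iff_has_vector_derivative intro: has_vector_derivative_at_within)
    from has_vector_derivative_mult[OF this H[OF x]]
    show "((\<lambda>x. Q x * H x) has_vector_derivative Q x * H' x + q x * H x) (at x within {0..1})" .
  qed (use cq H' cH in \<open>auto intro!: continuous_intros\<close>)
  also have "(LINT u | I1. Q u * H' u + q u * H u) = ip Q H' + ip q H"
    unfolding ip_def
    by (intro Bochner_Integration.integral_add sq_int_mult continuous_sq_int cq H' cH)
  also have "ip Q H' = ip (prim c q) H'"
    unfolding ip_def using prim_smooth[OF q Q]
    by (intro Bochner_Integration.integral_cong) (auto simp: space_restrict_space)
  finally show ?thesis using prim_smooth[OF q Q, of 1] Q(3) by simp
qed

text \<open>Both sides are continuous in \<open>w\<close> for the \<open>L\<^sup>2\<close> norm, and for polynomials \<open>w\<close> the classical rule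
  applies.\<close>

lemma prim_by_parts:
  assumes w: "sq_int I1 w"
    and H: "\<And>u. u \<in> {0..1} \<Longrightarrow> (H has_vector_derivative H' u) (at u within {0..1})"
    and H': "continuous_on {0..1} H'"
  shows "ip (prim c w) H' = prim c w 1 * H 1 - c * H 0 - ip w H"
proof -
  have cH: "continuous_on {0..1} H" using H by (rule continuous_on_vector_derivative)
  have sH: "sq_int I1 H" "sq_int I1 H'" using cH H' by (auto intro: continuous_sq_int)
  define K where "K = l2norm I1 H' + \<bar>H 1\<bar> + l2norm I1 H + 1"
  have K: "0 < K" using l2norm_nonneg[of I1 H'] l2norm_nonneg[of I1 H] unfolding K_def by linarith
  define \<Delta> where "\<Delta> = ip (prim c w) H' - (prim c w 1 * H 1 - c * H 0 - ip w H)"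
  have "\<bar>\<Delta>\<bar> \<le> 0 + e" if e: "0 < e" for e
  proof -
    obtain l where l: "l2norm I1 (\<lambda>x. rpoly l x - w x) < e / K"
      using rpoly_dense_L2[OF w, of "e / K"] e K by auto
    let ?v = "\<lambda>x. w x - rpoly l x"
    have v: "sq_int I1 ?v" by (rule sq_int_diff[OF w rpoly_sq_int])
    have "\<Delta> = (ip (prim c w) H' - ip (prim c (rpoly l)) H') - (prim c w 1 - prim c (rpoly l) 1) * H 1 + (ip w H - ip (rpoly l) H)"
      using prim_by_parts_smooth[OF smooth_rpoly[of l] H H', where c = c] unfolding \<Delta>_def by (simp add: algebra_simps)
    also have "\<dots> = ip (prim 0 ?v) H' - prim 0 ?v 1 * H 1 + ip ?v H"
      using prim_diff_w[OF w rpoly_sq_int[of l], where c = c and d = c]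
      by (simp add: ip_diff_left[symmetric] prim_sq_int w rpoly_sq_int sH)
    finally have "\<bar>\<Delta>\<bar> \<le> \<bar>ip (prim 0 ?v) H'\<bar> + \<bar>prim 0 ?v 1\<bar> * \<bar>H 1\<bar> + \<bar>ip ?v H\<bar>"
      by (simp only: abs_mult[symmetric])
    also have "\<dots> \<le> l2norm I1 ?v * l2norm I1 H' + l2norm I1 ?v * \<bar>H 1\<bar> + l2norm I1 ?v * l2norm I1 H"
      using order_trans[OF ip_CS[OF prim_sq_int[OF v] sH(2), of 0] mult_right_mono[OF l2norm_prim[OF v], of "l2norm I1 H'"]]
        ip_CS[OF v sH(1)] mult_right_mono[OF prim_bound[OF v, of 1], of "\<bar>H 1\<bar>"]
      by simp
    also have "\<dots> \<le> l2norm I1 ?v * K" unfolding K_def by (simp add: algebra_simps)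
    also have "\<dots> \<le> e" using l K by (simp add: l2norm_minus_commute field_simps)
    finally show ?thesis by simp
  qed
  then have "\<bar>\<Delta>\<bar> \<le> 0" by (rule field_le_epsilon)
  then show ?thesis unfolding \<Delta>_def by simp
qed

section \<open>The fundamental lemma of the calculus of variations\<close>

text \<open>The sign of \<open>f\<close> is a bounded limit of continuous functions; testing with these shows that \<open>\<bar>f\<bar>\<close>
  has integral zero.\<close>

lemma AE_zero_if_orthogonal_continuous:
  fixes f :: "real \<Rightarrow> real"
  assumes f: "integrable (lebesgue_on {a..b}) f"
    and orth: "\<And>g B. continuous_on UNIV g \<Longrightarrow> (\<And>x. \<bar>g x\<bar> \<le> B) \<Longrightarrow> (LINT x | lebesgue_on {a..b}. f x * g x) = 0"
  shows "AE x in lebesgue_on {a..b}. f x = 0"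
proof -
  have fm: "f \<in> borel_measurable (lebesgue_on {a..b})" using f by auto
  have "(\<lambda>x. sgn (f x)) \<in> borel_measurable (lebesgue_on {a..b})"
    using fm by measurable
  from bounded_AE_limit_continuous[OF _ this, of 1]
  obtain g where g: "\<And>n. continuous_on UNIV (g n)" "\<And>n x. \<bar>g n x\<bar> \<le> (1::real)"
    and lim: "AE x in lebesgue_on {a..b}. (\<lambda>n. g n x) \<longlonglongrightarrow> sgn (f x)"
    by (auto simp: abs_sgn_eq)
  have "(\<lambda>n. LINT x | lebesgue_on {a..b}. f x * g n x) \<longlonglongrightarrow> (LINT x | lebesgue_on {a..b}. f x * sgn (f x))"
  proof (rule integral_dominated_convergence[where w = "\<lambda>x. \<bar>f x\<bar>"])
    show "AE x in lebesgue_on {a..b}. (\<lambda>n. f x * g n x) \<longlonglongrightarrow> f x * sgn (f x)"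
      using lim by eventually_elim (intro tendsto_intros)
    show "AE x in lebesgue_on {a..b}. norm (f x * g n x) \<le> \<bar>f x\<bar>" for n
      using g(2) by (auto simp: abs_mult intro!: mult_left_le)
    show "(\<lambda>x. f x * g n x) \<in> borel_measurable (lebesgue_on {a..b})" for n
      by (rule borel_measurable_times[OF fm continuous_measurable_lebesgue_on[OF g(1)]])
    show "(\<lambda>x. f x * sgn (f x)) \<in> borel_measurable (lebesgue_on {a..b})"
      using fm by measurable
  qed (use f in auto)
  then have "(LINT x | lebesgue_on {a..b}. \<bar>f x\<bar>) = 0"
    using orth[OF g] by (simp add: LIMSEQ_const_iff abs_sgn[symmetric])
  then show ?thesis
    using f by (subst (asm) integral_nonneg_eq_0_iff_AE) auto
qed

text \<open>Local summability gives measurability on each compact subinterval, and these exhaust the open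
  interval.\<close>

lemma locally_summable_measurable:
  assumes "locally_summable f" shows "f \<in> borel_measurable I1"
proof -
  have m: "(\<lambda>x. if x \<in> {1 / (real n + 2)..1 - 1 / (real n + 2)} then f x else 0) \<in> borel_measurable lebesgue" for n
  proof -
    have "f \<in> borel_measurable (lebesgue_on {1 / (real n + 2)..1 - 1 / (real n + 2)})"
      using assms unfolding locally_summable_def by (intro borel_measurable_integrable) auto
    then show ?thesis by (subst measurable_if_lebesgue) auto
  qed
  have "(\<lambda>n. if x \<in> {1 / (real n + 2)..1 - 1 / (real n + 2)} then f x else 0)
      \<longlonglongrightarrow> (if x \<in> {0<..<1} then f x else 0)" for x
  proof (rule tendsto_eventually, cases "x \<in> {0<..<1}")
    case True
    then obtain n where n: "1 / min x (1 - x) \<le> real n" using real_arch_simple by blast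
    have "x \<in> {1 / (real k + 2)..1 - 1 / (real k + 2)}" if "n \<le> k" for k
    proof -
      have p: "0 < min x (1 - x)" using True by auto
      have "1 / min x (1 - x) \<le> real k + 2" using n that by linarith
      then have "1 / (real k + 2) \<le> 1 / (1 / min x (1 - x))" using p by (intro divide_left_mono) auto
      then have "1 / (real k + 2) \<le> min x (1 - x)" by simp
      then show ?thesis unfolding min.bounded_iff atLeastAtMost_iff by linarith
    qed
    then show "\<forall>\<^sub>F n in sequentially. (if x \<in> {1 / (real n + 2)..1 - 1 / (real n + 2)} then f x else 0) = (if x \<in> {0<..<1} then f x else 0)"
      using True by (intro eventually_sequentiallyI[of n]) auto
  next
    case False
    have "x \<notin> {1 / (real k + 2)..1 - 1 / (real k + 2)}" for k
    proof
      assume "x \<in> {1 / (real k + 2)..1 - 1 / (real k + 2)}"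
      moreover have "0 < 1 / (real k + 2)" by simp
      ultimately have "x \<in> {0<..<1}" unfolding atLeastAtMost_iff greaterThanLessThan_iff by linarith
      with False show False by simp
    qed
    then show "\<forall>\<^sub>F n in sequentially. (if x \<in> {1 / (real n + 2)..1 - 1 / (real n + 2)} then f x else 0) = (if x \<in> {0<..<1} then f x else 0)"
      using False by (intro always_eventually) metis
  qed
  then have "(\<lambda>x. if x \<in> {0<..<1} then f x else 0) \<in> borel_measurable lebesgue"
    by (intro borel_measurable_LIMSEQ_real[OF _ m])
  moreover have "AE x in lebesgue. (if x \<in> {0<..<1} then f x else 0) = (if x \<in> {0..1} then f x else 0)"
    by (rule AE_mp[OF AE_not_in[of "{0, 1}"]]) (auto simp flip: negligible_iff_null_sets)
  ultimately have "(\<lambda>x. if x \<in> {0..1} then f x else 0) \<in> borel_measurable lebesgue"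
    by (rule borel_measurable_AE)
  then show ?thesis by (subst (asm) measurable_if_lebesgue) auto
qed

text \<open>A smooth function times a cutoff is a test function. As the cutoffs tend to the indicator of
  \<open>(a, b)\<close>, \<open>f\<close> is orthogonal on \<open>[a, b]\<close> to every polynomial, hence to every continuous function.\<close>

lemma fundamental_lemma:
  assumes f: "locally_summable f"
    and orth: "\<And>\<eta>. \<eta> \<in> test_functions \<Longrightarrow> (LINT u | lebesgue_on {0<..<1}. f u * \<eta> u) = 0"
  shows "AE u in I1. f u = 0"
proof -
  have fm: "f \<in> borel_measurable I1" by (rule locally_summable_measurable[OF f])
  have ab: "AE u in lebesgue_on {a..b}. f u = 0" if ab: "0 < a" "b < 1" for a b
  proof (rule AE_zero_if_orthogonal_continuous)
    show int: "integrable (lebesgue_on {a..b}) f" using f that by (simp add: locally_summable_def)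
    have sm: "(LINT u | lebesgue_on {a..b}. f u * q u) = 0" if q: "smooth q" for q
    proof -
      have qc: "continuous_on S q" for S using q by (rule smooth_continuous)
      have "bounded (q ` {a..b})" by (intro compact_imp_bounded compact_continuous_image qc) simp
      then obtain B where B: "\<And>x. x \<in> {a..b} \<Longrightarrow> \<bar>q x\<bar> \<le> B" unfolding bounded_iff by force
      have z: "(LINT u | lebesgue_on {a..b}. f u * (cutoff a b n u * q u)) = 0" for n
      proof -
        have t: "(\<lambda>u. cutoff a b n u * q u) \<in> test_functions"
          using ab by (intro test_functionI[of _ a b] smooth_mult smooth_cutoff q) (auto simp: cutoff_outside)
        have "(LINT u | lebesgue_on {a..b}. f u * (cutoff a b n u * q u))
            = (LINT u | lebesgue_on {0<..<1}. (if u \<in> {a..b} then f u * (cutoff a b n u * q u) else 0))"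
          using ab by (intro integral_restrict[symmetric]) auto
        also have "\<dots> = (LINT u | lebesgue_on {0<..<1}. f u * (cutoff a b n u * q u))"
          by (intro Bochner_Integration.integral_cong) (auto simp: cutoff_outside)
        finally show ?thesis using orth[OF t] by simp
      qed
      have "(\<lambda>n. LINT u | lebesgue_on {a..b}. f u * (cutoff a b n u * q u)) \<longlonglongrightarrow>
          (LINT u | lebesgue_on {a..b}. f u * (indicator {a<..<b} u * q u))"
      proof (rule integral_dominated_convergence[where w = "\<lambda>u. \<bar>f u\<bar> * \<bar>B\<bar>"])
        show "AE x in lebesgue_on {a..b}. (\<lambda>n. f x * (cutoff a b n x * q x)) \<longlonglongrightarrow> f x * (indicator {a<..<b} x * q x)"
          by (intro AE_I2 tendsto_intros cutoff_tendsto)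
        have "\<bar>cutoff a b n x * q x\<bar> \<le> \<bar>B\<bar>" if "x \<in> {a..b}" for n x
          using B[OF that] cutoff_bounds[of a b n x] mult_mono[of "cutoff a b n x" 1 "\<bar>q x\<bar>" "\<bar>B\<bar>"]
          by (auto simp: abs_mult)
        then show "AE x in lebesgue_on {a..b}. norm (f x * (cutoff a b n x * q x)) \<le> \<bar>f x\<bar> * \<bar>B\<bar>" for n
          by (intro AE_I2) (auto simp: abs_mult space_restrict_space intro!: mult_left_mono)
        show "(\<lambda>x. f x * (cutoff a b n x * q x)) \<in> borel_measurable (lebesgue_on {a..b})" for n
          by (rule borel_measurable_times[OF borel_measurable_integrable[OF int] continuous_measurable_lebesgue_on])
            (rule smooth_continuous[OF smooth_mult[OF smooth_cutoff q]])
        show "(\<lambda>x. f x * (indicator {a<..<b} x * q x)) \<in> borel_measurable (lebesgue_on {a..b})"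
          by (rule borel_measurable_times[OF borel_measurable_integrable[OF int] borel_measurable_times[OF measurable_restrict_space1 continuous_measurable_lebesgue_on]])
            (use qc in \<open>auto intro!: borel_measurable_indicator\<close>)
      qed (use int in auto)
      then have "(LINT u | lebesgue_on {a..b}. f u * (indicator {a<..<b} u * q u)) = 0"
        by (simp add: z LIMSEQ_const_iff)
      moreover have "(LINT u | lebesgue_on {a..b}. f u * (indicator {a<..<b} u * q u)) = (LINT u | lebesgue_on {a..b}. f u * q u)"
      proof (rule integral_cong_AE)
        have "AE u in lebesgue. u \<notin> {a, b}"
          by (intro AE_not_in) (auto simp flip: negligible_iff_null_sets)
        then show "AE u in lebesgue_on {a..b}. f u * (indicator {a<..<b} u * q u) = f u * q u"
          unfolding AE_lebesgue_on_Icc by eventually_elim (auto simp: indicator_def)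
        show "(\<lambda>x. f x * q x) \<in> borel_measurable (lebesgue_on {a..b})"
          by (rule borel_measurable_times[OF borel_measurable_integrable[OF int] continuous_measurable_lebesgue_on[OF qc]])
        show "(\<lambda>x. f x * (indicator {a<..<b} x * q x)) \<in> borel_measurable (lebesgue_on {a..b})"
          by (rule borel_measurable_times[OF borel_measurable_integrable[OF int] borel_measurable_times[OF measurable_restrict_space1 continuous_measurable_lebesgue_on]])
            (use qc in \<open>auto intro!: borel_measurable_indicator\<close>)
      qed
      ultimately show ?thesis by simp
    qed
    fix g :: "real \<Rightarrow> real" and B :: real assume g: "continuous_on UNIV g" "\<And>x. \<bar>g x\<bar> \<le> B"
    define K where "K = (LINT u | lebesgue_on {a..b}. \<bar>f u\<bar>) + 1"
    have K: "0 < K" unfolding K_def by (intro add_nonneg_pos Bochner_Integration.integral_nonneg) auto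
    have intg: "integrable (lebesgue_on {a..b}) (\<lambda>u. f u * g u)"
    proof (rule Bochner_Integration.integrable_bound[of _ "\<lambda>u. B * f u"])
      show "integrable (lebesgue_on {a..b}) (\<lambda>u. B * f u)" using int by simp
      show "(\<lambda>u. f u * g u) \<in> borel_measurable (lebesgue_on {a..b})"
        by (rule borel_measurable_times[OF borel_measurable_integrable[OF int] continuous_measurable_lebesgue_on[OF g(1)]])
      have "\<bar>g u\<bar> \<le> \<bar>B\<bar>" for u using g(2)[of u] by linarith
      then show "AE u in lebesgue_on {a..b}. norm (f u * g u) \<le> norm (B * f u)"
        by (intro AE_I2) (simp add: abs_mult mult.commute[of "\<bar>f _\<bar>"] mult_right_mono)
    qed
    have "\<bar>LINT u | lebesgue_on {a..b}. f u * g u\<bar> \<le> 0 + e" if e: "0 < e" for e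
    proof -
      obtain l where l: "\<And>x. x \<in> {0..1} \<Longrightarrow> \<bar>rpoly l x - g x\<bar> < e / K"
        using rpoly_dense[OF continuous_on_subset[OF g(1) subset_UNIV] divide_pos_pos[OF e K]] by blast
      have bd: "\<bar>f u * g u - f u * rpoly l u\<bar> \<le> \<bar>f u\<bar> * (e / K)" if "u \<in> {a..b}" for u
      proof -
        have "\<bar>f u * g u - f u * rpoly l u\<bar> = \<bar>f u\<bar> * \<bar>rpoly l u - g u\<bar>"
          by (simp add: right_diff_distrib[symmetric] abs_mult abs_minus_commute)
        also have "\<dots> \<le> \<bar>f u\<bar> * (e / K)"
          using l[of u] that ab by (intro mult_left_mono) auto
        finally show ?thesis .
      qed
      have dm: "(\<lambda>u. f u * g u - f u * rpoly l u) \<in> borel_measurable (lebesgue_on {a..b})"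
        by (rule borel_measurable_diff;
            rule borel_measurable_times[OF borel_measurable_integrable[OF int] continuous_measurable_lebesgue_on])
          (rule g(1), rule smooth_continuous[OF smooth_rpoly])
      have di: "integrable (lebesgue_on {a..b}) (\<lambda>u. f u * g u - f u * rpoly l u)"
      proof (rule Bochner_Integration.integrable_bound[OF _ dm])
        show "integrable (lebesgue_on {a..b}) (\<lambda>u. \<bar>f u\<bar> * (e / K))" using int by simp
        show "AE u in lebesgue_on {a..b}. norm (f u * g u - f u * rpoly l u) \<le> norm (\<bar>f u\<bar> * (e / K))"
        proof (rule AE_I2)
          fix u assume "u \<in> space (lebesgue_on {a..b})"
          then have "u \<in> {a..b}" by simp
          then show "norm (f u * g u - f u * rpoly l u) \<le> norm (\<bar>f u\<bar> * (e / K))"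
            unfolding real_norm_def by (rule order_trans[OF bd abs_ge_self])
        qed
      qed
      have "integrable (lebesgue_on {a..b}) (\<lambda>u. f u * rpoly l u)"
        using Bochner_Integration.integrable_diff[OF intg di] by simp
      then have "(LINT u | lebesgue_on {a..b}. f u * g u) = (LINT u | lebesgue_on {a..b}. f u * g u - f u * rpoly l u)"
        using intg sm[OF smooth_rpoly] by simp
      also have "\<bar>\<dots>\<bar> \<le> (LINT u | lebesgue_on {a..b}. \<bar>f u * g u - f u * rpoly l u\<bar>)"
        by (rule integral_abs_bound)
      also have "\<dots> \<le> (LINT u | lebesgue_on {a..b}. \<bar>f u\<bar> * (e / K))"
        using di int bd by (intro integral_mono) (auto simp: space_restrict_space)
      also have "\<dots> = (LINT u | lebesgue_on {a..b}. \<bar>f u\<bar>) * (e / K)" by simp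
      also have "\<dots> \<le> K * (e / K)" using K e by (intro mult_right_mono) (auto simp: K_def)
      finally show ?thesis using K by simp
    qed
    then have "\<bar>LINT u | lebesgue_on {a..b}. f u * g u\<bar> \<le> 0" by (rule field_le_epsilon)
    then show "(LINT u | lebesgue_on {a..b}. f u * g u) = 0" by simp
  qed
  have "AE u in lebesgue. \<forall>n. u \<in> {1 / (real n + 2)..1 - 1 / (real n + 2)} \<longrightarrow> f u = 0"
    unfolding AE_all_countable
  proof
    fix n
    have "AE u in lebesgue_on {1 / (real n + 2)..1 - 1 / (real n + 2)}. f u = 0" by (rule ab) auto
    then show "AE u in lebesgue. u \<in> {1 / (real n + 2)..1 - 1 / (real n + 2)} \<longrightarrow> f u = 0"
      by (simp only: AE_lebesgue_on_Icc)
  qed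
  then have "AE u in lebesgue. u \<in> {0<..<1} \<longrightarrow> f u = 0"
  proof eventually_elim
    case (elim x)
    show ?case
    proof
      assume x: "x \<in> {0<..<1}"
      then obtain n where n: "1 / min x (1 - x) \<le> real n" using real_arch_simple by blast
      have p: "0 < min x (1 - x)" using x by auto
      have "1 / min x (1 - x) \<le> real n + 2" using n by linarith
      then have "1 / (real n + 2) \<le> 1 / (1 / min x (1 - x))" using p by (intro divide_left_mono) auto
      then have "1 / (real n + 2) \<le> min x (1 - x)" by simp
      then have "x \<in> {1 / (real n + 2)..1 - 1 / (real n + 2)}"
        unfolding min.bounded_iff atLeastAtMost_iff by linarith
      with elim show "f x = 0" by blast
    qed
  qed
  then have "AE u in lebesgue_on {0<..<1}. f u = 0" by (simp add: AE_restrict_space_iff)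
  then show ?thesis by (simp add: AE_open_unit)
qed

lemma sq_int_locally_summable:
  assumes "sq_int I1 f" shows "locally_summable f"
  unfolding locally_summable_def
proof (intro allI impI)
  fix a b :: real assume ab: "0 < a \<and> b < 1"
  have "integrable I1 f" by (rule Icc.sq_int_integrable[OF assms])
  then show "integrable (lebesgue_on {a..b}) f"
    by (rule integrable_subinterval) (use ab in auto)
qed

lemma test_function_sq_int: "\<eta> \<in> test_functions \<Longrightarrow> sq_int I1 \<eta>"
  by (auto simp: test_functions_iff intro: continuous_sq_int smooth_continuous)

lemma locally_summable_diff:
  "locally_summable f \<Longrightarrow> locally_summable g \<Longrightarrow> locally_summable (\<lambda>u. f u - g u)"
  unfolding locally_summable_def by auto

lemma locally_summable_const: "locally_summable (\<lambda>u. c)"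
  unfolding locally_summable_def by auto

lemma locally_summable_test:
  assumes f: "locally_summable f" and \<eta>: "\<eta> \<in> test_functions"
  shows "integrable (lebesgue_on {0<..<1}) (\<lambda>u. f u * \<eta> u)"
proof -
  obtain a b where ab: "0 < a" "a < b" "b < 1" and sm: "smooth \<eta>" and out: "\<And>x. x \<notin> {a..b} \<Longrightarrow> \<eta> x = 0"
    using test_functionE[OF \<eta>] by blast
  have int: "integrable (lebesgue_on {a..b}) f" using f ab by (simp add: locally_summable_def)
  have "compact (\<eta> ` {a..b})" by (intro compact_continuous_image smooth_continuous sm) simp
  then have "bounded (\<eta> ` {a..b})" by (rule compact_imp_bounded)
  then obtain B where B: "\<And>x. x \<in> {a..b} \<Longrightarrow> \<bar>\<eta> x\<bar> \<le> B" unfolding bounded_iff by force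
  have "integrable (lebesgue_on {a..b}) (\<lambda>u. f u * \<eta> u)"
  proof (rule Bochner_Integration.integrable_bound[of _ "\<lambda>u. B * f u"])
    show "integrable (lebesgue_on {a..b}) (\<lambda>u. B * f u)" using int by simp
    show "(\<lambda>u. f u * \<eta> u) \<in> borel_measurable (lebesgue_on {a..b})"
      by (rule borel_measurable_times[OF borel_measurable_integrable[OF int] continuous_measurable_lebesgue_on[OF smooth_continuous[OF sm]]])
    show "AE u in lebesgue_on {a..b}. norm (f u * \<eta> u) \<le> norm (B * f u)"
    proof (rule AE_I2)
      fix u assume "u \<in> space (lebesgue_on {a..b})"
      then have "\<bar>\<eta> u\<bar> \<le> \<bar>B\<bar>" using B[of u] by simp
      then show "norm (f u * \<eta> u) \<le> norm (B * f u)"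
        by (simp add: abs_mult mult.commute[of "\<bar>f _\<bar>"] mult_right_mono)
    qed
  qed
  then have "integrable lebesgue (\<lambda>u. if u \<in> {a..b} then f u * \<eta> u else 0)"
    by (subst Lebesgue_Measure.integrable_restrict_UNIV) auto
  moreover have "(\<lambda>u. if u \<in> {a..b} then f u * \<eta> u else 0) = (\<lambda>u. if u \<in> {0<..<1} then f u * \<eta> u else 0)"
    using ab out by force
  ultimately have "integrable lebesgue (\<lambda>u. if u \<in> {0<..<1} then f u * \<eta> u else 0)" by simp
  then show ?thesis by (subst (asm) Lebesgue_Measure.integrable_restrict_UNIV) auto
qed

lemma integral_test_ip:
  assumes f: "locally_summable f" and \<eta>: "\<eta> \<in> borel_measurable I1"
  shows "(LINT u | lebesgue_on {0<..<1}. f u * \<eta> u) = ip f \<eta>"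
  unfolding ip_def using locally_summable_measurable[OF f] \<eta> by (intro integral_open_unit) auto

lemma test_function_deriv:
  assumes "\<eta> \<in> test_functions" shows "deriv \<eta> \<in> test_functions"
proof -
  obtain a b where ab: "0 < a" "a < b" "b < 1" and sm: "smooth \<eta>" and out: "\<And>x. x \<notin> {a..b} \<Longrightarrow> \<eta> x = 0"
    using test_functionE[OF assms] by blast
  show ?thesis
  proof (rule test_functionI[OF smooth_deriv[OF sm] ab(1,3)])
    fix x assume x: "x \<notin> {a..b}"
    have "open (- {a..b})" by auto
    have "((\<lambda>_. 0) has_real_derivative 0) (at x)" by simp
    then have "(\<eta> has_real_derivative 0) (at x)"
      by (rule has_field_derivative_transform_within_open[OF _ \<open>open (- {a..b})\<close>]) (use x out in auto)
    then show "deriv \<eta> x = 0" by (rule DERIV_imp_deriv)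
  qed
qed

text \<open>Fix a test function \<open>\<theta>0\<close> with nonzero integral. Every test function minus a suitable multiple of
  \<open>\<theta>0\<close> has integral zero, so that it is the derivative of a test function and is orthogonal to \<open>f\<close>.
  Thus \<open>f\<close> acts on test functions as a constant does.\<close>

lemma du_Bois_Reymond:
  assumes f: "locally_summable f"
    and orth: "\<And>\<eta>. \<eta> \<in> test_functions \<Longrightarrow> (LINT u | lebesgue_on {0<..<1}. f u * deriv \<eta> u) = 0"
  shows "\<exists>c. AE u in I1. f u = c"
proof -
  define \<theta>0 where "\<theta>0 = cutoff (1/3) (2/3) 1"
  have t0: "\<theta>0 \<in> test_functions"
    unfolding \<theta>0_def by (intro test_functionI[of _ "1/3" "2/3"] smooth_cutoff) (auto simp: cutoff_outside)
  have s0: "smooth \<theta>0" by (simp add: \<theta>0_def smooth_cutoff)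
  have int0: "integrable I1 \<theta>0" by (rule Icc.sq_int_integrable[OF test_function_sq_int[OF t0]])
  define c0 where "c0 = (LINT u | I1. \<theta>0 u)"
  have "c0 \<noteq> 0"
  proof
    assume "c0 = 0"
    then have "AE u in I1. \<theta>0 u = 0"
      unfolding c0_def using int0 by (subst (asm) integral_nonneg_eq_0_iff_AE) (auto simp: \<theta>0_def cutoff_bounds)
    moreover have "\<theta>0 u \<noteq> 0" if "u \<in> {1/3<..<2/3}" for u
    proof -
      have "0 < bump (1/3) (2/3) u" using that by (simp only: bump_pos_iff)
      then show ?thesis by (simp add: \<theta>0_def cutoff_def)
    qed
    ultimately have "AE u in lebesgue. u \<notin> {1/3<..<2/3::real}"
      unfolding AE_lebesgue_on_Icc by (elim eventually_mono) force
    then have "negligible {1/3<..<2/3::real}"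
      by (subst (asm) AE_iff_null_sets[symmetric]) (auto simp: negligible_iff_null_sets)
    then show False using open_not_negligible[of "{1/3<..<2/3::real}"] by simp
  qed
  define c where "c = ip f \<theta>0 / c0"
  have main: "ip f \<theta> = c * (LINT u | I1. \<theta> u)" if \<theta>: "\<theta> \<in> test_functions" for \<theta>
  proof -
    \<comment> \<open>Chosen so that \<open>k\<close> has integral zero.\<close>
    define d where "d = (LINT u | I1. \<theta> u) / c0"
    define k where "k u = \<theta> u - d * \<theta>0 u" for u
    obtain a b where ab: "0 < a" "a < b" "b < 1" and sm: "smooth \<theta>" and out: "\<And>x. x \<notin> {a..b} \<Longrightarrow> \<theta> x = 0"
      using test_functionE[OF \<theta>] by blast
    have sk: "smooth k" unfolding k_def[abs_def] by (intro smooth_diff smooth_mult smooth_const sm s0)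
    define a' b' where "a' = min a (1/3)" and "b' = max b (2/3)"
    have ab': "0 < a'" "a' < b'" "b' < 1" using ab by (auto simp: a'_def b'_def)
    have kout: "k x = 0" if "x \<notin> {a'..b'}" for x
    proof -
      have "x \<notin> {a..b}" "x \<notin> {1/3<..<2/3}" using that by (auto simp: a'_def b'_def)
      then show ?thesis using out by (simp add: k_def \<theta>0_def cutoff_outside)
    qed
    have int: "integrable I1 \<theta>" by (rule Icc.sq_int_integrable[OF test_function_sq_int[OF \<theta>]])
    have "(LINT u | I1. k u) = (LINT u | I1. \<theta> u) - d * c0"
      unfolding k_def c0_def using int int0 by simp
    then have k0: "(LINT u | I1. k u) = 0" using \<open>c0 \<noteq> 0\<close> by (simp add: d_def)
    obtain K where K: "smooth K" "deriv K = k" "K 0 = 0" using smooth_antiderivative[OF sk] by blast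
    have K1: "K 1 = 0"
    proof -
      have "(LINT u | I1. k u) = K 1 - K 0"
        by (rule integral_FTC_lebesgue_on)
          (use K smoothD[OF K(1)] smooth_continuous[OF sk] in
            \<open>auto simp: has_real_derivative_iff_has_vector_derivative intro: has_vector_derivative_at_within\<close>)
      then show ?thesis using k0 K(3) by simp
    qed
    have tK: "K \<in> test_functions"
    proof (rule test_functionI[OF K(1) ab'(1,3)])
      fix x assume "x \<notin> {a'..b'}"
      then consider "x < a'" | "b' < x" by fastforce
      then show "K x = 0"
      proof cases
        case 1
        have "K x = K 0"
        proof (rule has_field_derivative_zero_constant[of "{..<a'}" K, THEN exE])
          show "(K has_real_derivative 0) (at y within {..<a'})" if "y \<in> {..<a'}" for y
            using smoothD[OF K(1), of y] kout[of y] that K(2) by (auto intro: has_field_derivative_at_within)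
        qed (use 1 ab' in auto)
        then show ?thesis using K(3) by simp
      next
        case 2
        have "K x = K 1"
        proof (rule has_field_derivative_zero_constant[of "{b'<..}" K, THEN exE])
          show "(K has_real_derivative 0) (at y within {b'<..})" if "y \<in> {b'<..}" for y
            using smoothD[OF K(1), of y] kout[of y] that K(2) by (auto intro: has_field_derivative_at_within)
        qed (use 2 ab' in auto)
        then show ?thesis using K1 by simp
      qed
    qed
    have "(LINT u | lebesgue_on {0<..<1}. f u * k u) = 0" using orth[OF tK] K(2) by simp
    then have "(LINT u | lebesgue_on {0<..<1}. f u * \<theta> u - d * (f u * \<theta>0 u)) = 0"
      by (simp add: k_def algebra_simps)
    then have "(LINT u | lebesgue_on {0<..<1}. f u * \<theta> u) - d * (LINT u | lebesgue_on {0<..<1}. f u * \<theta>0 u) = 0"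
      using locally_summable_test[OF f \<theta>] locally_summable_test[OF f t0] by simp
    then have "ip f \<theta> = d * ip f \<theta>0"
      using integral_test_ip[OF f] test_function_sq_int[OF \<theta>] test_function_sq_int[OF t0] by (simp add: sq_int_def)
    then show ?thesis by (simp add: d_def c_def)
  qed
  have "AE u in I1. f u - c = 0"
  proof (rule fundamental_lemma)
    show "locally_summable (\<lambda>u. f u - c)"
      by (intro locally_summable_diff f locally_summable_const)
    fix \<eta> assume \<eta>: "\<eta> \<in> test_functions"
    have "(LINT u | lebesgue_on {0<..<1}. (f u - c) * \<eta> u) = (LINT u | lebesgue_on {0<..<1}. f u * \<eta> u) - (LINT u | lebesgue_on {0<..<1}. c * \<eta> u)"
      unfolding left_diff_distrib
      by (intro Bochner_Integration.integral_diff locally_summable_test f \<eta> locally_summable_const)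
    also have "\<dots> = ip f \<eta> - ip (\<lambda>_. c) \<eta>"
      using integral_test_ip[OF f, of \<eta>] integral_test_ip[OF locally_summable_const, of \<eta> c] test_function_sq_int[OF \<eta>]
      by (simp add: sq_int_def)
    also have "\<dots> = 0" using main[OF \<eta>] by (simp add: ip_def)
    finally show "(LINT u | lebesgue_on {0<..<1}. (f u - c) * \<eta> u) = 0" .
  qed
  then have "AE u in I1. f u = c" by eventually_elim simp
  then show ?thesis ..
qed

section \<open>The structure of the space H1\<close>

text \<open>\<open>prim c w\<close> is the continuous representative of \<open>\<phi>\<close>; the constant \<open>c\<close> is its value at \<open>0\<close>.\<close>

definition H1_rep :: "(real \<Rightarrow> real) \<Rightarrow> real \<Rightarrow> (real \<Rightarrow> real) \<Rightarrow> bool" where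
  "H1_rep \<phi> c w \<longleftrightarrow> sq_int I1 w \<and> (AE u in I1. \<phi> u = prim c w u)"

lemma H1_rep_sq_int: assumes "H1_rep \<phi> c w" shows "sq_int I1 \<phi>"
proof -
  have s: "sq_int I1 (prim c w)" and e: "AE u in I1. prim c w u = \<phi> u"
    using assms prim_sq_int by (auto simp: H1_rep_def elim: eventually_mono)
  have "\<phi> \<in> borel_measurable I1"
    by (rule measurable_cong_AE_lebesgue_on[OF sq_int_measurable[OF s] e])
  then show ?thesis by (rule sq_int_cong_AE[OF s _ e])
qed

lemma smooth_vector_derivative:
  "smooth f \<Longrightarrow> (f has_vector_derivative deriv f u) (at u within S)"
  using smoothD by (auto simp: has_real_derivative_iff_has_vector_derivative[symmetric] intro: has_field_derivative_at_within)

lemma H1_rep_weak_deriv: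
  assumes r: "H1_rep \<phi> c w" shows "is_weak_deriv \<phi> w"
  unfolding is_weak_deriv_def
proof (intro conjI ballI)
  have w: "sq_int I1 w" using r by (simp add: H1_rep_def)
  have \<phi>: "sq_int I1 \<phi>" by (rule H1_rep_sq_int[OF r])
  show ls: "locally_summable \<phi>" "locally_summable w" by (intro sq_int_locally_summable \<phi> w)+
  fix \<eta> assume \<eta>: "\<eta> \<in> test_functions"
  obtain a b where ab: "0 < a" "a < b" "b < 1" and sm: "smooth \<eta>" and out: "\<And>x. x \<notin> {a..b} \<Longrightarrow> \<eta> x = 0"
    using test_functionE[OF \<eta>] by blast
  have m: "\<eta> \<in> borel_measurable I1" "deriv \<eta> \<in> borel_measurable I1"
    using test_function_sq_int[OF \<eta>] test_function_sq_int[OF test_function_deriv[OF \<eta>]] by (simp_all add: sq_int_def)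
  have "ip \<phi> (deriv \<eta>) = ip (prim c w) (deriv \<eta>)"
    using r \<phi> m prim_sq_int[OF w] by (intro ip_cong_AE) (auto simp: H1_rep_def sq_int_def)
  also have "\<dots> = prim c w 1 * \<eta> 1 - c * \<eta> 0 - ip w \<eta>"
    using sm by (intro prim_by_parts[OF w] smooth_vector_derivative smooth_continuous smooth_deriv)
  also have "\<dots> = - ip w \<eta>" using out[of 0] out[of 1] ab by simp
  finally show "(LINT u | lebesgue_on {0<..<1}. \<phi> u * deriv \<eta> u) = - (LINT u | lebesgue_on {0<..<1}. w u * \<eta> u)"
    using ls m by (simp add: integral_test_ip)
qed

lemma weak_deriv_unique:
  assumes "is_weak_deriv \<phi> v" "is_weak_deriv \<phi> w"
  shows "AE u in I1. v u = w u"
proof -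
  have ls: "locally_summable v" "locally_summable w" using assms by (auto simp: is_weak_deriv_def)
  have "AE u in I1. v u - w u = 0"
  proof (rule fundamental_lemma)
    fix \<eta> assume \<eta>: "\<eta> \<in> test_functions"
    have "(LINT u | lebesgue_on {0<..<1}. (v u - w u) * \<eta> u) = (LINT u | lebesgue_on {0<..<1}. v u * \<eta> u) - (LINT u | lebesgue_on {0<..<1}. w u * \<eta> u)"
      unfolding left_diff_distrib by (intro Bochner_Integration.integral_diff locally_summable_test \<eta> ls)
    then show "(LINT u | lebesgue_on {0<..<1}. (v u - w u) * \<eta> u) = 0"
      using assms \<eta> unfolding is_weak_deriv_def by fastforce
  qed (intro locally_summable_diff ls)
  then show ?thesis by eventually_elim simp
qed

text \<open>\<open>\<phi>\<close> and the primitive of \<open>w\<close> have the same weak derivative, so they differ by a constant.\<close>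

lemma weak_deriv_imp_rep:
  assumes d: "is_weak_deriv \<phi> w" and w: "sq_int I1 w"
  shows "\<exists>c. H1_rep \<phi> c w"
proof -
  have ls: "locally_summable \<phi>" using d by (simp add: is_weak_deriv_def)
  have lp: "locally_summable (prim 0 w)" by (intro sq_int_locally_summable prim_sq_int w)
  have dp: "is_weak_deriv (prim 0 w) w"
    by (rule H1_rep_weak_deriv[of _ 0]) (use w in \<open>simp add: H1_rep_def\<close>)
  have "\<exists>c. AE u in I1. \<phi> u - prim 0 w u = c"
  proof (rule du_Bois_Reymond)
    fix \<eta> assume \<eta>: "\<eta> \<in> test_functions"
    note \<eta>' = test_function_deriv[OF \<eta>]
    have "(LINT u | lebesgue_on {0<..<1}. (\<phi> u - prim 0 w u) * deriv \<eta> u)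
       = (LINT u | lebesgue_on {0<..<1}. \<phi> u * deriv \<eta> u) - (LINT u | lebesgue_on {0<..<1}. prim 0 w u * deriv \<eta> u)"
      unfolding left_diff_distrib by (intro Bochner_Integration.integral_diff locally_summable_test \<eta>' ls lp)
    then show "(LINT u | lebesgue_on {0<..<1}. (\<phi> u - prim 0 w u) * deriv \<eta> u) = 0"
      using d dp \<eta> unfolding is_weak_deriv_def by fastforce
  qed (intro locally_summable_diff ls lp)
  then obtain c where "AE u in I1. \<phi> u - prim 0 w u = c" ..
  then have "AE u in I1. \<phi> u = prim c w u" by eventually_elim (simp add: prim_def)
  with w show ?thesis by (auto simp: H1_rep_def)
qed

lemma H1_rep_H1: "H1_rep \<phi> c w \<Longrightarrow> \<phi> \<in> H1"
  using H1_rep_weak_deriv[of \<phi> c w] by (auto simp: H1_def H1_rep_def L2_iff is_weak_deriv_def)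

lemma weak_deriv_H1:
  assumes "\<phi> \<in> H1"
  shows "sq_int I1 (weak_deriv \<phi>)" "is_weak_deriv \<phi> (weak_deriv \<phi>)"
proof -
  have "\<exists>\<psi>. \<psi> \<in> L2 \<and> is_weak_deriv \<phi> \<psi>" using assms by (auto simp: H1_def)
  from someI_ex[OF this] show "sq_int I1 (weak_deriv \<phi>)" "is_weak_deriv \<phi> (weak_deriv \<phi>)"
    by (simp_all add: weak_deriv_def L2_iff)
qed

lemma H1_imp_rep: "\<phi> \<in> H1 \<Longrightarrow> \<exists>c. H1_rep \<phi> c (weak_deriv \<phi>)"
  using weak_deriv_H1 weak_deriv_imp_rep by blast

lemma H1_rep_weak_deriv_AE:
  assumes "H1_rep \<phi> c w" shows "AE u in I1. weak_deriv \<phi> u = w u"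
  using weak_deriv_unique weak_deriv_H1(2)[OF H1_rep_H1[OF assms]] H1_rep_weak_deriv[OF assms] by blast

lemma H1_norm_rep:
  assumes r: "H1_rep \<phi> c w"
  shows "(H1_norm \<phi>)\<^sup>2 = (l2norm I1 \<phi>)\<^sup>2 + (l2norm I1 w)\<^sup>2"
proof -
  have "l2norm I1 (weak_deriv \<phi>) = l2norm I1 w"
    using H1_rep_weak_deriv_AE[OF r] weak_deriv_H1(1)[OF H1_rep_H1[OF r]] r
    by (intro l2norm_cong_AE) (auto simp: H1_rep_def sq_int_def)
  then show ?thesis unfolding H1_norm_def ip_self by simp
qed

lemma H1_norm_rep': "H1_rep \<phi> c w \<Longrightarrow> H1_norm \<phi> = sqrt ((l2norm I1 \<phi>)\<^sup>2 + (l2norm I1 w)\<^sup>2)"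
  using H1_norm_rep[of \<phi> c w] by (intro real_sqrt_unique[symmetric]) (simp_all add: H1_norm_def ip_self)

lemma H1_rep_diff:
  assumes "H1_rep \<phi> c w" "H1_rep \<psi> d v"
  shows "H1_rep (\<lambda>u. \<phi> u - \<psi> u) (c - d) (\<lambda>u. w u - v u)"
proof -
  have s: "sq_int I1 w" "sq_int I1 v" using assms by (auto simp: H1_rep_def)
  have "AE u in I1. \<phi> u - \<psi> u = prim (c - d) (\<lambda>x. w x - v x) u"
    using assms[unfolded H1_rep_def, THEN conjunct2]
    by eventually_elim (simp add: prim_diff_w[OF s, symmetric])
  then show ?thesis using s by (simp add: H1_rep_def sq_int_diff)
qed

text \<open>The value at \<open>0\<close> is the constant function \<open>\<phi> - prim 0 w\<close>, whose norm is its modulus. Hence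
  evaluation at \<open>0\<close> is continuous on \<open>H1\<close>.\<close>

lemma H1_rep_value_0:
  assumes "H1_rep \<phi> c w"
  shows "\<bar>c\<bar> \<le> l2norm I1 \<phi> + l2norm I1 w"
proof -
  have s: "sq_int I1 w" "sq_int I1 \<phi>" using assms H1_rep_sq_int by (auto simp: H1_rep_def)
  have "\<bar>c\<bar> = l2norm I1 (\<lambda>u. c)" by simp
  also have "\<dots> = l2norm I1 (\<lambda>u. \<phi> u + - prim 0 w u)"
  proof (rule l2norm_cong_AE)
    show "AE u in I1. c = \<phi> u + - prim 0 w u"
      using assms[unfolded H1_rep_def, THEN conjunct2] by eventually_elim (simp add: prim_def)
    show "(\<lambda>u. \<phi> u + - prim 0 w u) \<in> borel_measurable I1"
      using sq_int_diff[OF s(2) prim_sq_int[OF s(1)]] by (simp add: sq_int_def)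
  qed simp
  also have "\<dots> \<le> l2norm I1 \<phi> + l2norm I1 (\<lambda>u. - prim 0 w u)"
    by (intro l2norm_triangle s sq_int_minus prim_sq_int)
  also have "l2norm I1 (\<lambda>u. - prim 0 w u) = l2norm I1 (prim 0 w)" by (simp add: l2norm_def)
  finally show ?thesis using l2norm_prim[OF s(1)] by linarith
qed

lemma continuous_eq_AE_open_unit:
  fixes f g :: "real \<Rightarrow> real"
  assumes "continuous_on {0<..<1} f" "continuous_on {0<..<1} g" "AE u in I1. f u = g u" "u \<in> {0<..<1}"
  shows "f u = g u"
proof (rule ccontr)
  assume "f u \<noteq> g u"
  have "open ({0<..<1} \<inter> (\<lambda>x. f x - g x) -` (- {0}))"
    by (intro continuous_open_preimage continuous_on_diff assms) auto
  moreover have "u \<in> {0<..<1} \<inter> (\<lambda>x. f x - g x) -` (- {0})" using \<open>f u \<noteq> g u\<close> assms(4) by auto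
  ultimately obtain e where e: "0 < e" "ball u e \<subseteq> {0<..<1} \<inter> (\<lambda>x. f x - g x) -` (- {0})"
    using openE by blast
  have sub: "f x \<noteq> g x \<and> x \<in> {0..1}" if "x \<in> ball u e" for x using that e(2) by fastforce
  have "AE x in lebesgue. x \<notin> ball u e"
    using assms(3) unfolding AE_lebesgue_on_Icc by eventually_elim (use sub in blast)
  then have "negligible (ball u e)"
    by (subst (asm) AE_iff_null_sets[symmetric]) (auto simp: negligible_iff_null_sets)
  then show False using e(1) open_not_negligible[of "ball u e"] by simp
qed

text \<open>Two continuous functions that agree almost everywhere agree everywhere, so all representatives
  admitted in \<open>H1_value\<close> have the limit of \<open>prim c w\<close>.\<close>

lemma H1_rep_value:
  assumes r: "H1_rep \<phi> c w" and a: "a \<in> {0, 1}"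
  shows "H1_value \<phi> a = prim c w a"
  unfolding H1_value_def
proof (rule the_equality)
  have w: "sq_int I1 w" using r by (simp add: H1_rep_def)
  have cont: "continuous_on {0..1} (prim c w)" by (rule prim_continuous[OF w])
  have lim: "(prim c w \<longlongrightarrow> prim c w a) (at a within {0<..<1})"
  proof (rule tendsto_within_subset)
    have "a \<in> {0..1}" using a by auto
    with cont show "(prim c w \<longlongrightarrow> prim c w a) (at a within {0..1})" unfolding continuous_on_def by blast
  qed auto
  have cont': "continuous_on {0<..<1} (prim c w)" by (rule continuous_on_subset[OF cont]) auto
  have ae: "AE u in lebesgue_on {0<..<1}. prim c w u = \<phi> u"
    unfolding AE_open_unit using r by (auto simp: H1_rep_def elim: eventually_mono)
  show "\<exists>\<psi>. continuous_on {0<..<1} \<psi> \<and> (AE u in lebesgue_on {0<..<1}. \<psi> u = \<phi> u) \<and> (\<psi> \<longlongrightarrow> prim c w a) (at a within {0<..<1})"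
    using cont' ae lim by blast
  fix l assume "\<exists>\<psi>. continuous_on {0<..<1} \<psi> \<and> (AE u in lebesgue_on {0<..<1}. \<psi> u = \<phi> u) \<and> (\<psi> \<longlongrightarrow> l) (at a within {0<..<1})"
  then obtain \<psi> where \<psi>: "continuous_on {0<..<1} \<psi>" "AE u in lebesgue_on {0<..<1}. \<psi> u = \<phi> u" "(\<psi> \<longlongrightarrow> l) (at a within {0<..<1})"
    by blast
  have "AE u in lebesgue_on {0<..<1}. \<psi> u = prim c w u"
    using \<psi>(2) ae by eventually_elim simp
  then have eq: "\<psi> u = prim c w u" if "u \<in> {0<..<1}" for u
    unfolding AE_open_unit by (rule continuous_eq_AE_open_unit[OF \<psi>(1) cont' _ that])
  have "(prim c w \<longlongrightarrow> l) (at a within {0<..<1})"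
    by (rule Lim_transform_within[OF \<psi>(3), of 1]) (use eq in auto)
  moreover have "at a within {0<..<1} \<noteq> bot"
    using a by (auto simp: trivial_limit_within islimpt_greaterThanLessThan1 islimpt_greaterThanLessThan2)
  ultimately show "l = prim c w a" using lim tendsto_unique by blast
qed

section \<open>Borel functions and Lebesgue measure on intervals\<close>

lemma borel_lebesgue_on [measurable_dest]: 
  fixes f :: "'a::euclidean_space \<Rightarrow> real"
  assumes "f \<in> borel_measurable borel" shows "f \<in> borel_measurable (lebesgue_on S)"
  using assms by (intro measurable_restrict_space1 measurable_completion) simp

lemma integral_lebesgue_on_borel:
  fixes f :: "'a::euclidean_space \<Rightarrow> real"
  assumes "f \<in> borel_measurable borel" "S \<in> sets borel"
  shows "(LINT x | lebesgue_on S. f x) = (LINT x | lborel. indicator S x * f x)"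
  using assms by (subst Bochner_Integration.integral_restrict_space) (auto simp: integral_completion)

lemma integrable_lebesgue_on_borel:
  fixes f :: "'a::euclidean_space \<Rightarrow> real"
  assumes "f \<in> borel_measurable borel" "S \<in> sets borel"
  shows "integrable (lebesgue_on S) f \<longleftrightarrow> integrable lborel (\<lambda>x. indicator S x * f x)"
  using assms by (subst Bochner_Integration.integrable_restrict_space) (auto simp: integrable_completion)

lemma AE_lebesgue_on_lborel:
  fixes S :: "'a::euclidean_space set"
  assumes "S \<in> sets borel"
  shows "(AE x in lebesgue_on S. Q x) \<longleftrightarrow> (AE x in lborel. x \<in> S \<longrightarrow> Q x)"
  using assms by (subst AE_restrict_space_iff) (auto simp: AE_completion_iff)

lemma borel_measurable_integral_I1:
  fixes f :: "'a \<Rightarrow> real \<Rightarrow> real"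
  assumes "(\<lambda>(s, u). f s u) \<in> borel_measurable (N \<Otimes>\<^sub>M (borel :: real measure))"
  shows "(\<lambda>s. LINT u | I1. f s u) \<in> borel_measurable N"
proof -
  have [measurable]: "(\<lambda>(s, u). f s u) \<in> borel_measurable (N \<Otimes>\<^sub>M (lborel :: real measure))"
    using assms by (simp cong: measurable_cong_sets add: sets_pair_measure_cong[OF refl sets_lborel])
  have "(\<lambda>s. LINT u | lborel. indicator {0..1::real} u * f s u) \<in> borel_measurable N"
    by (rule lborel.borel_measurable_lebesgue_integral) measurable
  moreover have "(LINT u | lborel. indicator {0..1::real} u * f s u) = (LINT u | I1. f s u)" if "s \<in> space N" for s
    using measurable_Pair2[OF assms that] by (subst integral_lebesgue_on_borel) auto
  ultimately show ?thesis by (subst measurable_cong[of N _ "\<lambda>s. LINT u | lborel. indicator {0..1::real} u * f s u"]) auto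
qed

lemma borel_measurable_ip:
  assumes [measurable]: "(\<lambda>(s, u). f s u) \<in> borel_measurable (N \<Otimes>\<^sub>M (borel :: real measure))"
    "(\<lambda>(s, u). g s u) \<in> borel_measurable (N \<Otimes>\<^sub>M (borel :: real measure))"
  shows "(\<lambda>s. ip (f s) (g s)) \<in> borel_measurable N"
  unfolding ip_def by (rule borel_measurable_integral_I1) measurable

lemma borel_measurable_l2norm:
  assumes [measurable]: "(\<lambda>(s, u). f s u) \<in> borel_measurable (N \<Otimes>\<^sub>M (borel :: real measure))"
  shows "(\<lambda>s. l2norm I1 (f s)) \<in> borel_measurable N"
proof -
  have [measurable]: "(\<lambda>s. LINT u | I1. (f s u)\<^sup>2) \<in> borel_measurable N"
    by (rule borel_measurable_integral_I1) measurable
  show ?thesis unfolding l2norm_def by measurable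
qed

lemma borel_measurable_prim:
  assumes [measurable]: "c \<in> borel_measurable N" "(\<lambda>(s, u). w s u) \<in> borel_measurable (N \<Otimes>\<^sub>M (borel :: real measure))"
  shows "(\<lambda>(s, u). prim (c s) (w s) u) \<in> borel_measurable (N \<Otimes>\<^sub>M (borel :: real measure))"
proof -
  have "(\<lambda>x. ip (indicator {0..snd x}) (w (fst x))) \<in> borel_measurable (N \<Otimes>\<^sub>M (borel :: real measure))"
  proof (rule borel_measurable_ip)
    show "(\<lambda>(x, u). w (fst x) u) \<in> borel_measurable ((N \<Otimes>\<^sub>M (borel :: real measure)) \<Otimes>\<^sub>M (borel :: real measure))"
      using measurable_compose[of "\<lambda>(x, u). (fst x, u)" "(N \<Otimes>\<^sub>M (borel :: real measure)) \<Otimes>\<^sub>M (borel :: real measure)" "N \<Otimes>\<^sub>M borel", OF _ assms(2)]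
      by (simp add: case_prod_unfold)
    have "(\<lambda>(x, u). indicat_real {0..snd x} u) = (\<lambda>p. if 0 \<le> snd p \<and> snd p \<le> snd (fst p) then 1 else (0::real))"
      by (auto simp: indicator_def)
    also have "\<dots> \<in> borel_measurable ((N \<Otimes>\<^sub>M (borel :: real measure)) \<Otimes>\<^sub>M (borel :: real measure))"
      by measurable
    finally show "(\<lambda>(x, u). indicat_real {0..snd x} u) \<in> borel_measurable ((N \<Otimes>\<^sub>M (borel :: real measure)) \<Otimes>\<^sub>M (borel :: real measure))" .
  qed
  then have "(\<lambda>x. c (fst x) + ip (indicator {0..snd x}) (w (fst x))) \<in> borel_measurable (N \<Otimes>\<^sub>M (borel :: real measure))"
    by (intro borel_measurable_add) measurable
  then show ?thesis by (simp add: prim_def case_prod_unfold)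
qed

text \<open>The sum of \<open>\<bar>f n - g\<bar>\<close> is integrable, hence finite almost everywhere. The rate is what makes the
  full sequence converge: below, one sequence must serve for all times at once, and a subsequence
  would depend on the time.\<close>

lemma (in finite_measure) l2norm_fast_AE_tendsto:
  assumes f: "\<And>n. sq_int M (f n)" and g: "sq_int M g"
    and le: "\<And>n. l2norm M (\<lambda>x. f n x - g x) \<le> (1/2) ^ n"
  shows "AE x in M. (\<lambda>n. f n x) \<longlonglongrightarrow> g x"
proof -
  have s: "sq_int M (\<lambda>x. f n x - g x)" for n by (rule sq_int_diff[OF f g])
  have [measurable]: "f n \<in> borel_measurable M" "g \<in> borel_measurable M" for n
    using f g by (auto simp: sq_int_def)
  define C where "C = sqrt (measure M (space M))"
  have C: "0 \<le> C" by (simp add: C_def)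
  have "(\<integral>\<^sup>+ x. (\<Sum>n. ennreal \<bar>f n x - g x\<bar>) \<partial>M) = (\<Sum>n. \<integral>\<^sup>+ x. ennreal \<bar>f n x - g x\<bar> \<partial>M)"
    by (rule nn_integral_suminf) measurable
  also have "\<dots> \<le> (\<Sum>n. ennreal (C * (1/2) ^ n))"
  proof (rule suminf_le)
    fix n
    have "(\<integral>\<^sup>+ x. ennreal \<bar>f n x - g x\<bar> \<partial>M) = ennreal (\<integral>x. \<bar>f n x - g x\<bar> \<partial>M)"
      using sq_int_integrable[OF s] by (intro nn_integral_eq_integral) auto
    also have "\<dots> \<le> ennreal (C * (1/2) ^ n)"
      using l1_le_l2norm[OF s, of n] mult_left_mono[OF le C, of n] by (intro ennreal_leI) (simp add: C_def)
    finally show "(\<integral>\<^sup>+ x. ennreal \<bar>f n x - g x\<bar> \<partial>M) \<le> ennreal (C * (1/2) ^ n)" .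
  qed auto
  also have "\<dots> < \<infinity>"
    using C by (subst suminf_ennreal2) (auto intro!: summable_mult summable_geometric)
  finally have "AE x in M. (\<Sum>n. ennreal \<bar>f n x - g x\<bar>) \<noteq> \<infinity>"
    by (intro nn_integral_PInf_AE) auto
  then show ?thesis
  proof eventually_elim
    case (elim x)
    then have "summable (\<lambda>n. \<bar>f n x - g x\<bar>)" by (intro summable_suminf_not_top) auto
    then have "(\<lambda>n. \<bar>f n x - g x\<bar>) \<longlonglongrightarrow> 0" by (rule summable_LIMSEQ_zero)
    then have "(\<lambda>n. f n x - g x) \<longlonglongrightarrow> 0" by (simp add: tendsto_rabs_zero_iff)
    then show ?case by (simp add: LIM_zero_iff)
  qed
qed

section \<open>Separability of H1\<close>

lemma H1_norm_le:
  assumes "H1_rep \<phi> c w" shows "H1_norm \<phi> \<le> l2norm I1 \<phi> + l2norm I1 w"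
  unfolding H1_norm_rep'[OF assms] by (rule sqrt_sum_squares_le_sum) auto

lemma H1_norm_ge:
  assumes "H1_rep \<phi> c w" shows "l2norm I1 \<phi> \<le> H1_norm \<phi>" "l2norm I1 w \<le> H1_norm \<phi>"
  unfolding H1_norm_rep'[OF assms] by (auto intro!: real_le_rsqrt)

lemma H1_norm_triangle:
  assumes "\<phi> \<in> H1" "\<psi> \<in> H1" "\<theta> \<in> H1"
  shows "H1_norm (\<lambda>u. \<phi> u - \<theta> u) \<le> H1_norm (\<lambda>u. \<phi> u - \<psi> u) + H1_norm (\<lambda>u. \<psi> u - \<theta> u)"
proof -
  obtain c w d v e z where r: "H1_rep \<phi> c w" "H1_rep \<psi> d v" "H1_rep \<theta> e z"
    using assms H1_imp_rep by meson
  note p = H1_rep_diff[OF r(1,2)] and q = H1_rep_diff[OF r(2,3)] and t = H1_rep_diff[OF r(1,3)]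
  have s: "sq_int I1 w" "sq_int I1 v" "sq_int I1 z" using r by (auto simp: H1_rep_def)
  have 1: "l2norm I1 (\<lambda>u. \<phi> u - \<theta> u) \<le> l2norm I1 (\<lambda>u. \<phi> u - \<psi> u) + l2norm I1 (\<lambda>u. \<psi> u - \<theta> u)"
    using l2norm_triangle[OF H1_rep_sq_int[OF p] H1_rep_sq_int[OF q]] by simp
  have 2: "l2norm I1 (\<lambda>u. w u - z u) \<le> l2norm I1 (\<lambda>u. w u - v u) + l2norm I1 (\<lambda>u. v u - z u)"
    using l2norm_triangle[OF sq_int_diff[OF s(1,2)] sq_int_diff[OF s(2,3)]] by simp
  have "H1_norm (\<lambda>u. \<phi> u - \<theta> u) \<le> sqrt ((l2norm I1 (\<lambda>u. \<phi> u - \<psi> u) + l2norm I1 (\<lambda>u. \<psi> u - \<theta> u))\<^sup>2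
      + (l2norm I1 (\<lambda>u. w u - v u) + l2norm I1 (\<lambda>u. v u - z u))\<^sup>2)"
    unfolding H1_norm_rep'[OF t] by (intro real_sqrt_le_mono add_mono power_mono 1 2) auto
  also have "\<dots> \<le> H1_norm (\<lambda>u. \<phi> u - \<psi> u) + H1_norm (\<lambda>u. \<psi> u - \<theta> u)"
    unfolding H1_norm_rep'[OF p] H1_norm_rep'[OF q] by (rule real_sqrt_sum_squares_triangle_ineq)
  finally show ?thesis .
qed

definition H1_ball :: "(real \<Rightarrow> real) \<Rightarrow> real \<Rightarrow> (real \<Rightarrow> real) set" where
  "H1_ball \<phi> r = {\<psi> \<in> H1. H1_norm (\<lambda>u. \<psi> u - \<phi> u) < r}"

lemma space_H1_borel: "space H1_borel = H1"
  unfolding H1_borel_def by (rule space_measure_of) auto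

lemma H1_ball_sets:
  assumes "\<phi> \<in> H1" shows "H1_ball \<phi> r \<in> sets H1_borel"
proof -
  have "\<exists>e>0. \<forall>\<theta>\<in>H1. H1_norm (\<lambda>u. \<theta> u - \<psi> u) < e \<longrightarrow> \<theta> \<in> H1_ball \<phi> r" if "\<psi> \<in> H1_ball \<phi> r" for \<psi>
  proof (intro exI[of _ "r - H1_norm (\<lambda>u. \<psi> u - \<phi> u)"] conjI ballI impI)
    show "0 < r - H1_norm (\<lambda>u. \<psi> u - \<phi> u)" using that by (simp add: H1_ball_def)
    fix \<theta> assume "\<theta> \<in> H1" "H1_norm (\<lambda>u. \<theta> u - \<psi> u) < r - H1_norm (\<lambda>u. \<psi> u - \<phi> u)"
    then show "\<theta> \<in> H1_ball \<phi> r"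
      using H1_norm_triangle[of \<theta> \<psi> \<phi>] that assms by (auto simp: H1_ball_def)
  qed
  then have "H1_ball \<phi> r \<in> {U. U \<subseteq> H1 \<and> (\<forall>\<phi>\<in>U. \<exists>r>0. \<forall>\<psi>\<in>H1. H1_norm (\<lambda>u. \<psi> u - \<phi> u) < r \<longrightarrow> \<psi> \<in> U)}"
    by (auto simp: H1_ball_def)
  then show ?thesis unfolding H1_borel_def by (auto simp: sets_measure_of_conv)
qed

text \<open>Enumerates the values at \<open>0\<close> and the derivatives of a countable dense subset of \<open>H1\<close>.\<close>

definition dense_code :: "nat \<Rightarrow> rat \<times> rat list" where "dense_code = from_nat"

abbreviation dense_val :: "nat \<Rightarrow> real" where "dense_val i \<equiv> of_rat (fst (dense_code i))"
abbreviation dense_deriv :: "nat \<Rightarrow> real \<Rightarrow> real" where "dense_deriv i \<equiv> rpoly (snd (dense_code i))"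
abbreviation dense_fun :: "nat \<Rightarrow> real \<Rightarrow> real" where "dense_fun i \<equiv> prim (dense_val i) (dense_deriv i)"

lemma dense_fun_rep: "H1_rep (dense_fun i) (dense_val i) (dense_deriv i)"
  by (simp add: H1_rep_def rpoly_sq_int)

lemma H1_separable:
  assumes "\<psi> \<in> H1" "0 < e" shows "\<exists>i. \<psi> \<in> H1_ball (dense_fun i) e"
proof -
  obtain c w where r: "H1_rep \<psi> c w" using H1_imp_rep[OF assms(1)] by blast
  then have w: "sq_int I1 w" by (simp add: H1_rep_def)
  have "0 < e / 3" using assms(2) by simp
  from rpoly_dense_L2[OF w this] obtain l where l: "l2norm I1 (\<lambda>x. rpoly l x - w x) < e / 3" by blast
  have "c < c + e / 3" using assms(2) by simp
  from of_rat_dense[OF this] obtain q where q: "c < real_of_rat q" "real_of_rat q < c + e / 3" by blast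
  define i where "i = to_nat (q, l)"
  have i: "dense_code i = (q, l)" by (simp add: dense_code_def i_def)
  note d = H1_rep_diff[OF r dense_fun_rep[of i], unfolded i fst_conv snd_conv]
  let ?w = "\<lambda>u. w u - rpoly l u"
  have w': "sq_int I1 ?w" by (rule sq_int_diff[OF w rpoly_sq_int])
  have "l2norm I1 (\<lambda>u. \<psi> u - prim (real_of_rat q) (rpoly l) u) = l2norm I1 (\<lambda>u. (c - real_of_rat q) + prim 0 ?w u)"
  proof (rule l2norm_cong_AE)
    show "AE u in I1. \<psi> u - prim (real_of_rat q) (rpoly l) u = (c - real_of_rat q) + prim 0 ?w u"
      using d[unfolded H1_rep_def, THEN conjunct2] by eventually_elim (simp add: prim_def)
    show "(\<lambda>u. \<psi> u - prim (real_of_rat q) (rpoly l) u) \<in> borel_measurable I1"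
      using H1_rep_sq_int[OF d] by (simp add: sq_int_def)
    show "(\<lambda>u. (c - real_of_rat q) + prim 0 ?w u) \<in> borel_measurable I1"
      using prim_sq_int[OF w', of 0] by (intro borel_measurable_add borel_measurable_const) (simp add: sq_int_def)
  qed
  also have "\<dots> \<le> l2norm I1 (\<lambda>u. c - real_of_rat q) + l2norm I1 (prim 0 ?w)"
    by (intro l2norm_triangle prim_sq_int w' continuous_sq_int continuous_on_const)
  also have "\<dots> \<le> \<bar>c - real_of_rat q\<bar> + l2norm I1 ?w" using l2norm_prim[OF w'] by simp
  finally have "H1_norm (\<lambda>u. \<psi> u - prim (real_of_rat q) (rpoly l) u) \<le> \<bar>c - real_of_rat q\<bar> + l2norm I1 ?w + l2norm I1 ?w"
    using H1_norm_le[OF d] by linarith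
  also have "\<dots> < e" using l q by (simp add: l2norm_minus_commute[of I1 w])
  finally have "\<psi> \<in> H1_ball (dense_fun i) e" using assms(1) by (simp add: H1_ball_def i)
  then show ?thesis ..
qed

lemma H1_ball_dense_funD:
  assumes b: "\<psi> \<in> H1_ball (dense_fun i) e" and r: "H1_rep \<psi> c w"
  shows "l2norm I1 (\<lambda>u. dense_deriv i u - w u) \<le> e" "\<bar>dense_val i - c\<bar> \<le> 2 * e"
proof -
  note d = H1_rep_diff[OF r dense_fun_rep[of i]]
  have "H1_norm (\<lambda>u. \<psi> u - dense_fun i u) < e" using b by (simp add: H1_ball_def)
  then show "l2norm I1 (\<lambda>u. dense_deriv i u - w u) \<le> e" "\<bar>dense_val i - c\<bar> \<le> 2 * e"
    using H1_norm_ge[OF d] H1_rep_value_0[OF d] by (simp_all add: l2norm_minus_commute[of I1 w])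
qed

text \<open>For each \<open>n\<close> the first element of the countable dense family at distance less than \<open>2\<^sup>-\<^sup>n\<close> from \<open>\<zeta> s\<close>
  depends measurably on \<open>s\<close>, because the balls are open in \<open>H1\<close>. The values at \<open>0\<close> and the
  derivatives of these elements are jointly measurable and converge to those of \<open>\<zeta> s\<close> for almost every \<open>s\<close>. The set \<open>G\<close> removes a null set of times, so that all functions can be chosen Borel.\<close>

lemma measurable_representation:
  assumes \<zeta>: "\<zeta> \<in> L2H1 T"
  obtains a D G where
    "a \<in> borel_measurable borel" "(\<lambda>(s, u). D s u) \<in> borel_measurable (borel \<Otimes>\<^sub>M borel)"
    "G \<in> sets borel" "G \<subseteq> {0..T}" "AE s in lborel. s \<in> {0..T} \<longrightarrow> s \<in> G"
    "\<And>s. s \<in> G \<Longrightarrow> H1_rep (\<zeta> s) (a s) (D s)"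
    "\<And>s. s \<notin> G \<Longrightarrow> a s = 0" "\<And>s u. s \<notin> G \<Longrightarrow> D s u = 0"
    "integrable lborel (\<lambda>s. (l2norm I1 (D s))\<^sup>2)"
proof -
  let ?I = "lebesgue_on {0..T}"
  obtain \<eta> where \<eta>: "\<eta> \<in> measurable ?I H1_borel" and eq: "AE t in ?I. \<zeta> t = \<eta> t"
    and int: "integrable ?I (\<lambda>t. (H1_norm (\<eta> t))\<^sup>2)"
    using \<zeta> unfolding L2H1_def by blast
  have \<eta>H1: "\<eta> s \<in> H1" if "s \<in> {0..T}" for s
    using measurable_space[OF \<eta>, of s] that by (simp add: space_H1_borel)
  define B where "B i n = H1_ball (dense_fun i) ((1/2) ^ n)" for i n :: nat
  have B: "B i n \<in> sets H1_borel" for i n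
    unfolding B_def by (rule H1_ball_sets[OF H1_rep_H1[OF dense_fun_rep]])
  \<comment> \<open>A least index, and not a chosen one, is measurable in \<open>s\<close>.\<close>
  define J where "J n s = (LEAST i. \<eta> s \<in> B i n)" for n s
  have J: "\<eta> s \<in> B (J n s) n" if "s \<in> {0..T}" for s n
  proof -
    have "\<exists>i. \<eta> s \<in> B i n" unfolding B_def by (rule H1_separable[OF \<eta>H1[OF that]]) simp
    then show ?thesis unfolding J_def by (rule LeastI_ex)
  qed
  have "(\<lambda>s. J n s) \<in> measurable ?I (count_space UNIV)" for n
    unfolding J_def by (rule measurable_Least) (use \<eta> B in measurable)
  then have Jm: "(\<lambda>s. real (J n s)) \<in> borel_measurable ?I" for n
    by (rule measurable_compose) simp
  have "\<exists>g\<in>borel_measurable lborel. AE s in lborel. (if s \<in> {0..T} then real (J n s) else 0) = g s" for n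
    by (rule completion_ex_borel_measurable_real) (use Jm[of n] in \<open>subst measurable_if_lebesgue, auto\<close>)
  then have "\<forall>n. \<exists>g. g \<in> borel_measurable lborel \<and> (AE s in lborel. (if s \<in> {0..T} then real (J n s) else 0) = g s)"
    by blast
  from choice[OF this] obtain g where g: "\<And>n. g n \<in> borel_measurable lborel"
    "\<And>n. AE s in lborel. (if s \<in> {0..T} then real (J n s) else 0) = g n s" by blast
  \<comment> \<open>\<open>J\<close> is only Lebesgue measurable; \<open>K\<close> is Borel and agrees with it almost everywhere.\<close>
  define K where "K n s = nat \<lfloor>g n s\<rfloor>" for n s
  have [measurable]: "K n \<in> measurable borel (count_space UNIV)" for n
    using g(1)[of n] unfolding K_def by measurable
  have "AE s in lborel. s \<in> {0..T} \<longrightarrow> \<zeta> s = \<eta> s \<and> (\<forall>n. K n s = J n s)"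
  proof -
    have "AE s in lborel. \<forall>n. (if s \<in> {0..T} then real (J n s) else 0) = g n s"
      unfolding AE_all_countable using g(2) by blast
    moreover have "AE s in lborel. s \<in> {0..T} \<longrightarrow> \<zeta> s = \<eta> s"
      using eq by (simp only: AE_lebesgue_on_lborel[OF borel_closed[OF closed_atLeastAtMost]])
    ultimately show ?thesis
    proof eventually_elim
      case (elim s)
      show ?case
      proof (intro impI conjI allI)
        assume s: "s \<in> {0..T}"
        then show "\<zeta> s = \<eta> s" using elim by blast
        fix n show "K n s = J n s" using elim(1)[rule_format, of n] s by (simp add: K_def flip: elim)
      qed
    qed
  qed
  from this[unfolded eventually_ae_filter] obtain N where N: "N \<in> null_sets lborel" 
    "{s \<in> space lborel. \<not> (s \<in> {0..T} \<longrightarrow> \<zeta> s = \<eta> s \<and> (\<forall>n. K n s = J n s))} \<subseteq> N"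
    by blast
  define G where "G = {0..T} - N"
  have Gs [measurable]: "G \<in> sets borel" using N(1) by (auto simp: G_def null_sets_def)
  have G: "s \<in> {0..T}" "\<zeta> s = \<eta> s" "\<And>n. K n s = J n s" if "s \<in> G" for s
    using that N(2) by (auto simp: G_def)
  have GAE: "AE s in lborel. s \<in> {0..T} \<longrightarrow> s \<in> G"
    using AE_not_in[OF N(1)] by eventually_elim (simp add: G_def)
  define a where "a s = (if s \<in> G then lim (\<lambda>n. dense_val (K n s)) else 0)" for s
  define D where "D s u = (if s \<in> G then lim (\<lambda>n. dense_deriv (K n s) u) else 0)" for s u
  have am: "a \<in> borel_measurable borel"
    unfolding a_def by measurable
  have [measurable]: "rpoly l \<in> borel_measurable borel" for l
    by (intro borel_measurable_continuous_onI smooth_continuous smooth_rpoly)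
  have Dm: "(\<lambda>(s, u). D s u) \<in> borel_measurable (borel \<Otimes>\<^sub>M borel)"
  proof -
    have "(\<lambda>p. dense_deriv (K n (fst p)) (snd p)) \<in> borel_measurable (borel \<Otimes>\<^sub>M borel)" for n
      by (rule measurable_compose_countable[of "\<lambda>i p. dense_deriv i (snd p)"]) measurable
    then have "(\<lambda>p. lim (\<lambda>n. dense_deriv (K n (fst p)) (snd p))) \<in> borel_measurable (borel \<Otimes>\<^sub>M borel)"
      by (rule borel_measurable_lim_metric)
    then have "(\<lambda>p. if fst p \<in> G then lim (\<lambda>n. dense_deriv (K n (fst p)) (snd p)) else 0) \<in> borel_measurable (borel \<Otimes>\<^sub>M borel)"
      by measurable
    then show ?thesis by (simp add: D_def case_prod_unfold)
  qed
  have rep: "H1_rep (\<zeta> s) (a s) (D s)" if s: "s \<in> G" for s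
  proof -
    obtain c w where r: "H1_rep (\<eta> s) c w" using H1_imp_rep[OF \<eta>H1[OF G(1)[OF s]]] by blast
    then have w: "sq_int I1 w" by (simp add: H1_rep_def)
    have b: "\<eta> s \<in> H1_ball (dense_fun (K n s)) ((1/2) ^ n)" for n
      using J[OF G(1)[OF s], of n] G(3)[OF s, of n] by (simp add: B_def)
    note d = H1_ball_dense_funD[OF b r]
    have "(\<lambda>n. dense_val (K n s)) \<longlonglongrightarrow> c"
    proof (rule LIM_zero_cancel, rule tendsto_rabs_zero_cancel, rule tendsto_sandwich[OF _ _ tendsto_const])
      show "(\<lambda>n. 2 * (1/2) ^ n) \<longlonglongrightarrow> (0::real)" by (intro tendsto_mult_right_zero LIMSEQ_power_zero) simp
    qed (use d(2) in auto)
    then have c: "a s = c" using s by (simp add: a_def limI)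
    have "AE u in I1. (\<lambda>n. dense_deriv (K n s) u) \<longlonglongrightarrow> w u"
      by (rule Icc.l2norm_fast_AE_tendsto[OF rpoly_sq_int w d(1)])
    then have e: "AE u in I1. w u = D s u"
      by eventually_elim (use s in \<open>simp add: D_def limI\<close>)
    have Ds: "sq_int I1 (D s)"
      by (rule sq_int_cong_AE[OF w _ e]) (rule measurable_cong_AE_lebesgue_on[OF sq_int_measurable[OF w] e])
    have "prim c w u = prim c (D s) u" for u
      unfolding prim_def using e w Ds by (auto intro!: ip_cong_AE borel_measurable_indicator measurable_restrict_space1 simp: sq_int_def)
    then show ?thesis using r Ds c G(2)[OF s] by (simp add: H1_rep_def)
  qed
  have D0: "D s u = 0" if "s \<notin> G" for s u using that by (simp add: D_def)
  have nm: "(\<lambda>s. (l2norm I1 (D s))\<^sup>2) \<in> borel_measurable borel"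
    using borel_measurable_l2norm[OF Dm] by measurable
  have "integrable ?I (\<lambda>s. (l2norm I1 (D s))\<^sup>2)"
  proof (rule Bochner_Integration.integrable_bound[OF int])
    show "(\<lambda>s. (l2norm I1 (D s))\<^sup>2) \<in> borel_measurable ?I" by (rule borel_lebesgue_on[OF nm])
    show "AE s in ?I. norm ((l2norm I1 (D s))\<^sup>2) \<le> norm ((H1_norm (\<eta> s))\<^sup>2)"
      unfolding AE_lebesgue_on_lborel[OF borel_closed[OF closed_atLeastAtMost]] using GAE
    proof eventually_elim
      case (elim s)
      show ?case
      proof
        assume "s \<in> {0..T}"
        then have s: "s \<in> G" using elim by simp
        have "(H1_norm (\<eta> s))\<^sup>2 = (l2norm I1 (\<zeta> s))\<^sup>2 + (l2norm I1 (D s))\<^sup>2"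
          using H1_norm_rep[OF rep[OF s]] G(2)[OF s] by simp
        then show "norm ((l2norm I1 (D s))\<^sup>2) \<le> norm ((H1_norm (\<eta> s))\<^sup>2)" by simp
      qed
    qed
  qed
  then have "integrable lborel (\<lambda>s. indicator {0..T} s * (l2norm I1 (D s))\<^sup>2)"
    using nm by (subst (asm) integrable_lebesgue_on_borel) auto
  moreover have "(\<lambda>s. indicator {0..T} s * (l2norm I1 (D s))\<^sup>2) = (\<lambda>s. (l2norm I1 (D s))\<^sup>2)"
  proof
    fix s show "indicator {0..T} s * (l2norm I1 (D s))\<^sup>2 = (l2norm I1 (D s))\<^sup>2"
      using G(1)[of s] D0[of s] by (cases "s \<in> G") (auto simp: l2norm_def)
  qed
  ultimately have Di: "integrable lborel (\<lambda>s. (l2norm I1 (D s))\<^sup>2)" by simp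
  show ?thesis
    by (rule that[of a D G]) (use am Dm Gs GAE rep D0 Di G(1) in \<open>auto simp: a_def\<close>)
qed

section \<open>Iterated integrals over the space-time rectangle\<close>

lemma rect_indicator:
  "(LINT u | lborel. indicator ({a..b} \<times> {0..1::real}) (s, u) * h (s, u)) = indicator {a..b::real} s * (LINT u | I1. h (s, u))"
  if "(\<lambda>u. h (s, u)) \<in> borel_measurable borel" for h :: "real \<times> real \<Rightarrow> real"
proof -
  have "(LINT u | lborel. indicator ({a..b} \<times> {0..1::real}) (s, u) * h (s, u)) = (LINT u | lborel. indicator {a..b} s * (indicator {0..1} u * h (s, u)))"
    by (intro Bochner_Integration.integral_cong) (auto simp: indicator_def)
  also have "\<dots> = indicator {a..b} s * (LINT u | lborel. indicator {0..1} u * h (s, u))" by simp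
  finally show ?thesis using that by (simp add: integral_lebesgue_on_borel)
qed

text \<open>Fubini's theorem, for Borel functions but with the completed measures of the definitions.\<close>

lemma
  fixes h :: "real \<times> real \<Rightarrow> real"
  assumes h: "h \<in> borel_measurable borel" and int: "integrable (lebesgue_on ({a..b} \<times> {0..1})) h"
  shows integrable_rect_iterated: "integrable (lebesgue_on {a..b}) (\<lambda>s. LINT u | I1. h (s, u))"
    and integral_rect_iterated: "(LINT p | lebesgue_on ({a..b} \<times> {0..1}). h p) = (LINT s | lebesgue_on {a..b}. LINT u | I1. h (s, u))"
    and AE_integrable_rect: "AE s in lebesgue_on {a..b}. integrable I1 (\<lambda>u. h (s, u))"
proof -
  let ?R = "{a..b} \<times> {0..1::real}"
  have R: "?R \<in> sets borel" by (intro borel_closed closed_Times) auto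
  have hs: "(\<lambda>u. h (s, u)) \<in> borel_measurable borel" for s
    using h by (simp add: borel_prod[symmetric]) measurable
  have m: "(\<lambda>s. LINT u | I1. h (s, u)) \<in> borel_measurable borel"
    using h by (intro borel_measurable_integral_I1) (simp add: borel_prod case_prod_unfold)
  have i: "integrable (lborel \<Otimes>\<^sub>M lborel) (\<lambda>p. indicator ?R p * h p)"
    using int unfolding integrable_lebesgue_on_borel[OF h R] lborel_prod .
  have "integrable lborel (\<lambda>s. LINT u | lborel. indicator ?R (s, u) * h (s, u))"
    by (rule lborel_pair.integrable_fst'[OF i])
  then show "integrable (lebesgue_on {a..b}) (\<lambda>s. LINT u | I1. h (s, u))"
    using m by (simp add: rect_indicator hs integrable_lebesgue_on_borel)
  have "(LINT p | lebesgue_on ?R. h p) = (LINT p | (lborel \<Otimes>\<^sub>M lborel). indicator ?R p * h p)"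
    by (simp add: integral_lebesgue_on_borel[OF h R] lborel_prod)
  also have "\<dots> = (LINT s | lborel. LINT u | lborel. indicator ?R (s, u) * h (s, u))"
    by (rule lborel_pair.integral_fst'[OF i, symmetric])
  also have "\<dots> = (LINT s | lebesgue_on {a..b}. LINT u | I1. h (s, u))"
    using m by (simp add: rect_indicator hs integral_lebesgue_on_borel)
  finally show "(LINT p | lebesgue_on ?R. h p) = (LINT s | lebesgue_on {a..b}. LINT u | I1. h (s, u))" .
  have "AE s in lborel. integrable lborel (\<lambda>u. indicator ?R (s, u) * h (s, u))"
    by (rule lborel_pair.AE_integrable_fst'[OF i])
  then show "AE s in lebesgue_on {a..b}. integrable I1 (\<lambda>u. h (s, u))"
    unfolding AE_lebesgue_on_lborel[OF borel_closed[OF closed_atLeastAtMost]]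
  proof eventually_elim
    case (elim s)
    show ?case
    proof
      assume "s \<in> {a..b}"
      then have "(\<lambda>u. indicator ?R (s, u) * h (s, u)) = (\<lambda>u. indicator {0..1} u * h (s, u))"
        by (auto simp: indicator_def)
      with elim show "integrable I1 (\<lambda>u. h (s, u))"
        by (subst integrable_lebesgue_on_borel[OF hs]) auto
    qed
  qed
qed

lemma integrable_rectI:
  fixes h :: "real \<times> real \<Rightarrow> real"
  assumes h: "h \<in> borel_measurable borel" and nonneg: "\<And>p. 0 \<le> h p"
    and s: "\<And>s. s \<in> {a..b} \<Longrightarrow> integrable I1 (\<lambda>u. h (s, u))"
    and int: "integrable (lebesgue_on {a..b}) (\<lambda>s. LINT u | I1. h (s, u))"
  shows "integrable (lebesgue_on ({a..b} \<times> {0..1})) h"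
proof -
  let ?R = "{a..b} \<times> {0..1::real}"
  have R: "?R \<in> sets borel" by (intro borel_closed closed_Times) auto
  have hs: "(\<lambda>u. h (s, u)) \<in> borel_measurable borel" for s
    using h by (simp add: borel_prod[symmetric]) measurable
  have m: "(\<lambda>s. LINT u | I1. h (s, u)) \<in> borel_measurable borel"
    using h by (intro borel_measurable_integral_I1) (simp add: borel_prod case_prod_unfold)
  have "integrable (lborel \<Otimes>\<^sub>M lborel) (\<lambda>p. indicator ?R p * h p)"
  proof (rule lborel_pair.Fubini_integrable)
    show "(\<lambda>p. indicator ?R p * h p) \<in> borel_measurable (lborel \<Otimes>\<^sub>M lborel)"
      using h R by (simp add: lborel_prod)
    have "(\<lambda>u. norm (indicator ?R (s, u) * h (s, u))) = (\<lambda>u. indicator ?R (s, u) * h (s, u))" for s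
      using nonneg by (simp add: abs_mult)
    then show "integrable lborel (\<lambda>s. LINT u | lborel. norm (indicator ?R (s, u) * h (s, u)))"
      using int m by (simp only: rect_indicator[OF hs] integrable_lebesgue_on_borel[OF m borel_closed[OF closed_atLeastAtMost]])
    have "integrable lborel (\<lambda>u. indicator ?R (s, u) * h (s, u))" for s
    proof (cases "s \<in> {a..b}")
      case True
      then have "(\<lambda>u. indicator ?R (s, u) * h (s, u)) = (\<lambda>u. indicator {0..1} u * h (s, u))"
        by (auto simp: indicator_def)
      then show ?thesis using s[OF True] integrable_lebesgue_on_borel[OF hs[of s], of "{0..1}"] by simp
    next
      case False
      then have "(\<lambda>u. indicator ?R (s, u) * h (s, u)) = (\<lambda>u. 0)"
        by (auto simp: indicator_def)
      then show ?thesis by simp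
    qed
    then show "AE s in lborel. integrable lborel (\<lambda>u. indicator ?R (s, u) * h (s, u))" by simp
  qed
  then show ?thesis unfolding integrable_lebesgue_on_borel[OF h R] lborel_prod .
qed

section \<open>Continuity of translations in time\<close>

lemma sq_int_Borel_rect:
  fixes D :: "real \<Rightarrow> real \<Rightarrow> real"
  assumes D: "(\<lambda>(s, u). D s u) \<in> borel_measurable (borel \<Otimes>\<^sub>M borel)"
    and s: "\<And>s. sq_int I1 (D s)"
    and int: "integrable (lebesgue_on {a..b}) (\<lambda>s. (l2norm I1 (D s))\<^sup>2)"
  shows "sq_int (lebesgue_on ({a..b} \<times> {0..1})) (\<lambda>(s, u). D s u)"
proof -
  have D': "(\<lambda>(s, u). D s u) \<in> borel_measurable borel" using D by (simp add: borel_prod)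
  then have m2: "(\<lambda>p. (case p of (s, u) \<Rightarrow> D s u)\<^sup>2) \<in> borel_measurable borel" by measurable
  have "integrable (lebesgue_on ({a..b} \<times> {0..1})) (\<lambda>p. (case p of (s, u) \<Rightarrow> D s u)\<^sup>2)"
  proof (rule integrable_rectI[OF m2])
    show "integrable I1 (\<lambda>u. (case (s, u) of (s, u) \<Rightarrow> D s u)\<^sup>2)" for s
      using assms(2)[of s] by (simp add: sq_int_def)
    show "integrable (lebesgue_on {a..b}) (\<lambda>s. LINT u|I1. (case (s, u) of (s, u) \<Rightarrow> D s u)\<^sup>2)"
      using int by (simp add: l2norm_sq)
  qed simp
  then show ?thesis using borel_lebesgue_on[OF D'] by (simp add: sq_int_def)
qed

lemma finite_measure_rect: "finite_measure (lebesgue_on ({a..b::real} \<times> {c..d::real}))"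
proof (rule Lebesgue_Measure.finite_measure_lebesgue_on)
  have "{a..b} \<times> {c..d} = cbox (a, c) (b, d)" by (simp add: cbox_Pair_eq)
  then show "{a..b} \<times> {c..d} \<in> lmeasurable" by (simp only: lmeasurable_cbox)
qed

text \<open>Approximate \<open>D\<close> in mean square by a continuous function \<open>g\<close>, which is uniformly continuous on the
  rectangle. A translation moves \<open>g\<close> little, and replacing \<open>D\<close> by \<open>g\<close> costs the error of
  approximation twice.\<close>

lemma translation_continuous:
  fixes D :: "real \<Rightarrow> real \<Rightarrow> real"
  assumes D: "(\<lambda>(s, u). D s u) \<in> borel_measurable (borel \<Otimes>\<^sub>M borel)"
    and s: "\<And>s. sq_int I1 (D s)"
    and int: "integrable (lebesgue_on {0..T}) (\<lambda>s. (l2norm I1 (D s))\<^sup>2)"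
    and e: "0 < e" and T: "0 < T"
  shows "\<exists>\<delta>>0. \<forall>x. 0 \<le> x \<and> x < \<delta> \<longrightarrow>
    integrable (lebesgue_on {x..T}) (\<lambda>t. (l2norm I1 (\<lambda>u. D (t - x) u - D t u))\<^sup>2) \<and>
    (LINT t | lebesgue_on {x..T}. (l2norm I1 (\<lambda>u. D (t - x) u - D t u))\<^sup>2) \<le> e"
proof -
  let ?R = "{0..T} \<times> {0..1::real}"
  have "?R \<in> sets borel" by (intro borel_closed closed_Times) auto
  then have R: "?R \<in> sets lebesgue" by (intro sets_completionI_sets) simp
  have D': "(\<lambda>(s, u). D s u) \<in> borel_measurable borel" using D by (simp add: borel_prod)
  have sq: "sq_int (lebesgue_on ?R) (\<lambda>(s, u). D s u)" by (rule sq_int_Borel_rect[OF D s int])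
  have e1: "0 < sqrt (e / 12)" using e by simp
  from L2_approx_continuous[OF R finite_measure_rect sq e1] obtain g B where
    g: "continuous_on UNIV g" "\<And>x. \<bar>g x\<bar> \<le> B" and
    close: "l2norm (lebesgue_on ?R) (\<lambda>p. g p - (case p of (s, u) \<Rightarrow> D s u)) < sqrt (e / 12)"
    by blast
  have gm: "g \<in> borel_measurable borel" using g(1) by (rule borel_measurable_continuous_onI)
  have gm': "(\<lambda>(s, u). g (s, u)) \<in> borel_measurable (borel \<Otimes>\<^sub>M borel)" using gm by (simp add: borel_prod)
  have gc: "continuous_on {0..1} (\<lambda>u. g (s, u))" for s
    by (intro continuous_on_compose2[OF g(1)] continuous_intros) auto
  have gs: "sq_int I1 (\<lambda>u. g (s, u))" for s by (rule continuous_sq_int[OF gc])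
  define A where "A s = l2norm I1 (\<lambda>u. g (s, u) - D s u)" for s
  have Am: "A \<in> borel_measurable borel"
    unfolding A_def by (rule borel_measurable_l2norm) (use D gm' in measurable)
  define k where "k = (\<lambda>p. (g p - (case p of (s, u) \<Rightarrow> D s u))\<^sup>2)"
  have km: "k \<in> borel_measurable borel" unfolding k_def using gm D' by measurable
  have "sq_int (lebesgue_on ?R) g"
    using g(2) gm by (intro finite_measure.sq_int_bounded[OF finite_measure_rect, where B = B] borel_lebesgue_on) auto
  then have ki: "integrable (lebesgue_on ?R) k"
    using sq_int_diff[OF _ sq, of g] by (simp add: sq_int_def k_def)
  have kA: "(LINT u | I1. k (s, u)) = (A s)\<^sup>2" for s by (simp add: k_def A_def l2norm_sq)
  have Ai: "integrable (lebesgue_on {0..T}) (\<lambda>s. (A s)\<^sup>2)"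
    using integrable_rect_iterated[OF km ki] by (simp add: kA)
  have "(LINT s | lebesgue_on {0..T}. (A s)\<^sup>2) = (l2norm (lebesgue_on ?R) (\<lambda>p. g p - (case p of (s, u) \<Rightarrow> D s u)))\<^sup>2"
    using integral_rect_iterated[OF km ki, unfolded kA] by (simp add: l2norm_sq k_def)
  also have "\<dots> \<le> (sqrt (e / 12))\<^sup>2" by (rule power_mono[OF less_imp_le[OF close] l2norm_nonneg])
  finally have Ae: "(LINT s | lebesgue_on {0..T}. (A s)\<^sup>2) \<le> e / 12" using e by simp
  have A2m: "(\<lambda>s. (A s)\<^sup>2) \<in> borel_measurable borel" using Am by measurable
  have Ail: "integrable lborel (\<lambda>s. indicator {0..T} s * (A s)\<^sup>2)"
    using Ai by (subst (asm) integrable_lebesgue_on_borel[OF A2m]) auto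
  have Ael: "(LINT s | lborel. indicator {0..T} s * (A s)\<^sup>2) \<le> e / 12"
    using Ae by (subst (asm) integral_lebesgue_on_borel[OF A2m]) auto
  have "compact ?R" by (intro compact_Times) auto
  then have uc: "uniformly_continuous_on ?R g"
    by (intro compact_uniformly_continuous continuous_on_subset[OF g(1)]) auto
  define \<epsilon> where "\<epsilon> = sqrt (e / (6 * T))"
  have \<epsilon>: "0 < \<epsilon>" "\<epsilon>\<^sup>2 * T = e / 6" using e T by (auto simp: \<epsilon>_def)
  from uc \<epsilon>(1) obtain \<delta> where \<delta>: "0 < \<delta>" "\<And>p q. p \<in> ?R \<Longrightarrow> q \<in> ?R \<Longrightarrow> dist q p < \<delta> \<Longrightarrow> dist (g q) (g p) < \<epsilon>"
    unfolding uniformly_continuous_on_def by metis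
  show ?thesis
  proof (intro exI[of _ \<delta>] conjI allI impI \<delta>(1))
    fix x assume x: "0 \<le> x \<and> x < \<delta>"
    define N where "N t = l2norm I1 (\<lambda>u. D (t - x) u - D t u)" for t
    note [measurable] = D
    have [measurable]: "(\<lambda>(t, u). D (t - x) u) \<in> borel_measurable (borel \<Otimes>\<^sub>M borel)"
      using measurable_compose[of "\<lambda>(t, u). (t - x, u)" "borel \<Otimes>\<^sub>M borel" "borel \<Otimes>\<^sub>M borel", OF _ D]
      by (simp add: case_prod_unfold)
    have Nm: "(\<lambda>t. (N t)\<^sup>2) \<in> borel_measurable borel"
      unfolding N_def by (intro borel_measurable_power borel_measurable_l2norm) measurable
    \<comment> \<open>The square of a sum of three terms is at most three times the sum of their squares.\<close>
    define W where "W t = 3 * (indicator {0..T} (t - x) * (A (t - x))\<^sup>2) + 3 * (indicator {0..T} t * \<epsilon>\<^sup>2) + 3 * (indicator {0..T} t * (A t)\<^sup>2)" for t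
    have sh: "integrable lborel (\<lambda>t. indicator {0..T} (t - x) * (A (t - x))\<^sup>2)"
      "(LINT t | lborel. indicator {0..T} (t - x) * (A (t - x))\<^sup>2) = (LINT s | lborel. indicator {0..T} s * (A s)\<^sup>2)"
      using lborel_integrable_real_affine[OF Ail, of 1 "-x"]
        lborel_integral_real_affine[of 1 "\<lambda>s. indicator {0..T} s * (A s)\<^sup>2" "-x"] by simp_all
    have ii: "integrable lborel (indicat_real {0..T})"
      using T by (intro integrable_real_indicator) auto
    have Wi: "integrable lborel W"
      unfolding W_def by (intro Bochner_Integration.integrable_add Bochner_Integration.integrable_mult_right
          Bochner_Integration.integrable_mult_left sh Ail ii)
    have "(LINT t | lborel. W t) = 3 * (LINT s | lborel. indicator {0..T} s * (A s)\<^sup>2) + 3 * (\<epsilon>\<^sup>2 * T) + 3 * (LINT s | lborel. indicator {0..T} s * (A s)\<^sup>2)"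
      unfolding W_def using sh Ail T ii by (subst Bochner_Integration.integral_add, simp, simp)+ (simp add: mult.commute[of _ "\<epsilon>\<^sup>2"])
    also have "\<dots> \<le> 3 * (e / 12) + 3 * (e / 6) + 3 * (e / 12)" unfolding \<epsilon>(2) using Ael by linarith
    finally have We: "(LINT t | lborel. W t) \<le> e" by simp
    have NW: "indicator {x..T} t * (N t)\<^sup>2 \<le> W t" for t
    proof (cases "t \<in> {x..T}")
      case True
      then have tr: "t \<in> {0..T}" "t - x \<in> {0..T}" using x by auto
      have "N t \<le> l2norm I1 (\<lambda>u. D (t - x) u - g (t - x, u)) + l2norm I1 (\<lambda>u. g (t - x, u) - D t u)"
        unfolding N_def using l2norm_triangle[OF sq_int_diff[OF s[of "t - x"] gs[of "t - x"]] sq_int_diff[OF gs[of "t - x"] s[of t]]] by simp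
      also have "l2norm I1 (\<lambda>u. g (t - x, u) - D t u) \<le> l2norm I1 (\<lambda>u. g (t - x, u) - g (t, u)) + A t"
        unfolding A_def using l2norm_triangle[OF sq_int_diff[OF gs[of "t - x"] gs[of t]] sq_int_diff[OF gs[of t] s[of t]]] by simp
      also have "l2norm I1 (\<lambda>u. g (t - x, u) - g (t, u)) \<le> \<epsilon>"
      proof (rule power2_le_imp_le)
        have "(l2norm I1 (\<lambda>u. g (t - x, u) - g (t, u)))\<^sup>2 \<le> (LINT u | I1. \<epsilon>\<^sup>2)"
          unfolding l2norm_sq
        proof (rule integral_mono)
          show "integrable I1 (\<lambda>u. (g (t - x, u) - g (t, u))\<^sup>2)"
            using sq_int_diff[OF gs[of "t - x"] gs[of t]] by (simp add: sq_int_def)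
          fix u assume "u \<in> space I1"
          then have u: "u \<in> {0..1}" by simp
          have "dist (g (t - x, u)) (g (t, u)) < \<epsilon>"
            using tr u x by (intro \<delta>(2)) (auto simp: dist_Pair_Pair dist_real_def)
          then show "(g (t - x, u) - g (t, u))\<^sup>2 \<le> \<epsilon>\<^sup>2"
            by (intro power2_le_iff_abs_le[THEN iffD2]) (auto simp: dist_real_def)
        qed simp
        then show "(l2norm I1 (\<lambda>u. g (t - x, u) - g (t, u)))\<^sup>2 \<le> \<epsilon>\<^sup>2" by simp
      qed (use \<epsilon> in simp)
      finally have N: "N t \<le> A (t - x) + \<epsilon> + A t" by (simp add: A_def l2norm_minus_commute[of I1 "D _"])
      have sq3: "(a + b + c)\<^sup>2 \<le> 3 * a\<^sup>2 + 3 * b\<^sup>2 + 3 * c\<^sup>2" for a b c :: real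
        using sum_squares_bound[of a b] sum_squares_bound[of a c] sum_squares_bound[of b c]
        by (simp add: power2_eq_square algebra_simps)
      have "(N t)\<^sup>2 \<le> (A (t - x) + \<epsilon> + A t)\<^sup>2" by (intro power_mono N) (simp add: N_def)
      also note sq3
      finally show ?thesis using True tr by (simp add: W_def)
    next
      case False
      then show ?thesis by (simp add: W_def)
    qed
    have Ni: "integrable lborel (\<lambda>t. indicator {x..T} t * (N t)\<^sup>2)"
    proof (rule Bochner_Integration.integrable_bound[OF Wi])
      show "AE t in lborel. norm (indicator {x..T} t * (N t)\<^sup>2) \<le> norm (W t)"
        using NW by (intro AE_I2) (smt (verit) indicator_pos_le mult_nonneg_nonneg real_norm_def zero_le_power2)
    qed (use Nm in measurable)
    then show "integrable (lebesgue_on {x..T}) (\<lambda>t. (l2norm I1 (\<lambda>u. D (t - x) u - D t u))\<^sup>2)"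
      unfolding N_def[symmetric] by (subst integrable_lebesgue_on_borel[OF Nm]) auto
    have "(LINT t | lborel. indicator {x..T} t * (N t)\<^sup>2) \<le> (LINT t | lborel. W t)"
      by (rule integral_mono[OF Ni Wi NW])
    then show "(LINT t | lebesgue_on {x..T}. (l2norm I1 (\<lambda>u. D (t - x) u - D t u))\<^sup>2) \<le> e"
      unfolding N_def[symmetric] using We by (subst integral_lebesgue_on_borel[OF Nm]) auto
  qed
qed

text \<open>The rate of change of \<open>\<langle>\<rho> s, \<phi>\<rangle>\<close> for a test function \<open>\<phi>\<close> with derivative \<open>q\<close> and boundary values
  \<open>p0\<close> and \<open>p1\<close>, when \<open>w\<close> is the derivative of \<open>(\<rho> s)\<^sup>m\<close> and \<open>r0\<close>, \<open>r1\<close> are the boundary values of \<open>\<rho> s\<close>: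
  the weak equation after an integration by parts in space.\<close>

section \<open>The energy inequality\<close>

definition robin_flux :: "real \<Rightarrow> real \<Rightarrow> real \<Rightarrow> real \<Rightarrow> real \<Rightarrow> (real \<Rightarrow> real) \<Rightarrow> (real \<Rightarrow> real) \<Rightarrow> real \<Rightarrow> real \<Rightarrow> real" where
  "robin_flux \<kappa> \<alpha> \<beta> r0 r1 w q p0 p1 = - ip w q + \<kappa> * (p0 * (\<alpha> - r0) + p1 * (\<beta> - r1))"

lemma prim_0 [simp]: "prim c w 0 = c"
proof -
  have "ip (indicator {0..0}) w = (LINT v | I1. w 0 * indicat_real {0} v)"
    unfolding ip_def by (intro Bochner_Integration.integral_cong) (auto simp: indicator_def)
  also have "\<dots> = 0" by (simp add: measure_restrict_space)
  finally show ?thesis by (simp add: prim_def)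
qed

lemma prim_const: "u \<in> {0..1} \<Longrightarrow> prim c (\<lambda>_. \<gamma>) u = c + \<gamma> * u"
  by (simp add: prim_def ip_indicator measure_restrict_space)

lemma sq_int_const: "sq_int I1 (\<lambda>_. c)"
  by (intro continuous_sq_int continuous_on_const)

text \<open>A convex function lies above its tangents: here the tangent at \<open>x\<close>, evaluated at \<open>y\<close>.\<close>

lemma power_tangent_le:
  fixes x y :: real
  assumes "0 \<le> x" "0 \<le> y"
  shows "x ^ Suc m / Suc m - y ^ Suc m / Suc m \<le> (x - y) * x ^ m"
proof -
  have "x ^ Suc m - y ^ Suc m \<le> Suc m * ((x - y) * x ^ m)"
  proof (induction m)
    case (Suc m)
    have "0 \<le> (x - y) * (x ^ Suc m - y ^ Suc m)"
      using assms by (cases "x \<le> y") (auto simp: mult_nonpos_nonpos power_mono simp del: power_Suc)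
    moreover have "0 \<le> x * (Suc m * ((x - y) * x ^ m) - (x ^ Suc m - y ^ Suc m))"
      using Suc assms by (intro mult_nonneg_nonneg) auto
    moreover have "Suc (Suc m) * ((x - y) * x ^ Suc m) - (x ^ Suc (Suc m) - y ^ Suc (Suc m))
      = x * (Suc m * ((x - y) * x ^ m) - (x ^ Suc m - y ^ Suc m)) + (x - y) * (x ^ Suc m - y ^ Suc m)"
      by (simp add: algebra_simps)
    ultimately show ?case by linarith
  qed simp
  then have "(x ^ Suc m - y ^ Suc m) / Suc m \<le> (x - y) * x ^ m"
    by (subst pos_divide_le_eq) (auto simp: mult.commute simp del: power_Suc)
  then show ?thesis by (simp only: diff_divide_distrib)
qed

text \<open>What the energy inequality uses of a weak solution. The data are Borel functions defined for
  all real times, which permits translations in time; the equation is stated between two times of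
  the set \<open>G\<close>, of full measure in \<open>[0, T]\<close>, and for test functions that do not depend on time.\<close>

locale porous_trajectory =
  fixes T \<kappa> \<alpha> \<beta> :: real and m :: nat and a :: "real \<Rightarrow> real" and D :: "real \<Rightarrow> real \<Rightarrow> real" and G :: "real set"
  assumes T: "0 < T" and \<kappa>: "0 < \<kappa>" and \<alpha>: "\<alpha> \<in> {0<..<1}" and \<beta>: "\<beta> \<in> {0<..<1}" and m: "1 \<le> m"
    and a_measurable [measurable]: "a \<in> borel_measurable borel"
    and D_measurable: "(\<lambda>(s, u). D s u) \<in> borel_measurable (borel \<Otimes>\<^sub>M borel)"
    and G_borel [measurable]: "G \<in> sets borel"
    and G_AE: "AE s in lborel. s \<in> {0..T} \<longrightarrow> s \<in> G"
    and D_sq_int: "\<And>s. sq_int I1 (D s)"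
    and D_outside: "\<And>s u. s \<notin> {0..T} \<Longrightarrow> D s u = 0"
    and D_integrable: "integrable lborel (\<lambda>s. (l2norm I1 (D s))\<^sup>2)"
    and F_bounds: "\<And>s u. u \<in> {0..1} \<Longrightarrow> prim (a s) (D s) u \<in> {0..1}"
    and weak: "\<And>t1 t2 \<phi>. t1 \<in> G \<Longrightarrow> t2 \<in> G \<Longrightarrow> t1 \<le> t2 \<Longrightarrow> smooth \<phi> \<Longrightarrow>
      ip (\<lambda>u. root m (prim (a t2) (D t2) u)) \<phi> - ip (\<lambda>u. root m (prim (a t1) (D t1) u)) \<phi> =
      (LINT s | lebesgue_on {t1..t2}. robin_flux \<kappa> \<alpha> \<beta> (root m (prim (a s) (D s) 0)) (root m (prim (a s) (D s) 1))
         (D s) (deriv \<phi>) (\<phi> 0) (\<phi> 1))"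
begin

abbreviation "F s \<equiv> prim (a s) (D s)"

definition "r s u = root m (F s u)"
definition "flux s = robin_flux \<kappa> \<alpha> \<beta> (r s 0) (r s 1) (D s)"
definition "N s = (l2norm I1 (D s))\<^sup>2"
definition "\<psi> u = \<alpha> ^ m + (\<beta> ^ m - \<alpha> ^ m) * u"

text \<open>The functional whose formal derivative along the flow is \<open>\<langle>\<partial>\<^sub>t \<rho>, \<rho>\<^sup>m - \<psi>\<rangle>\<close>.\<close>

definition "E s = (LINT u | I1. r s u ^ Suc m / Suc m - r s u * \<psi> u)"

lemma weak': "t1 \<in> G \<Longrightarrow> t2 \<in> G \<Longrightarrow> t1 \<le> t2 \<Longrightarrow> smooth \<phi> \<Longrightarrow>
  ip (r t2) \<phi> - ip (r t1) \<phi> = (LINT s | lebesgue_on {t1..t2}. flux s (deriv \<phi>) (\<phi> 0) (\<phi> 1))"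
  using weak[of t1 t2 \<phi>] unfolding flux_def r_def[abs_def] .

lemma F_measurable: "(\<lambda>(s, u). F s u) \<in> borel_measurable (borel \<Otimes>\<^sub>M borel)"
  by (rule borel_measurable_prim) (use D_measurable in measurable)

lemma r_measurable: "(\<lambda>(s, u). r s u) \<in> borel_measurable (borel \<Otimes>\<^sub>M borel)"
  unfolding r_def using F_measurable by measurable

lemma r_section_measurable [measurable]: "(\<lambda>s. r s u) \<in> borel_measurable borel"
  using measurable_Pair1[OF r_measurable, of u] by simp

lemma r_bounds: "u \<in> {0..1} \<Longrightarrow> 0 \<le> r s u" "u \<in> {0..1} \<Longrightarrow> r s u \<le> 1"
  using F_bounds[of u s] m by (auto simp: r_def)

lemma r_power: "u \<in> {0..1} \<Longrightarrow> r s u ^ m = F s u"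
  using F_bounds[of u s] m by (simp add: r_def)

lemma r_continuous: "continuous_on {0..1} (r s)"
  unfolding r_def by (intro continuous_on_real_root prim_continuous D_sq_int)

lemma r_sq_int: "sq_int I1 (r s)"
  by (rule continuous_sq_int[OF r_continuous])

lemma l2norm_D_sq_int: "sq_int (lebesgue_on {b..c}) (\<lambda>s. l2norm I1 (D s))"
proof -
  have m: "(\<lambda>s. l2norm I1 (D s)) \<in> borel_measurable borel"
    by (rule borel_measurable_l2norm[OF D_measurable])
  then have m2: "(\<lambda>s. (l2norm I1 (D s))\<^sup>2) \<in> borel_measurable borel" by measurable
  have "integrable lborel (\<lambda>s. indicator {b..c} s * (l2norm I1 (D s))\<^sup>2)"
    using integrable_mult_indicator[OF _ D_integrable, of "{b..c}"] by simp
  then show ?thesis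
    using borel_lebesgue_on[OF m] by (simp add: sq_int_def integrable_lebesgue_on_borel[OF m2])
qed

lemma flux_measurable:
  assumes [measurable]: "q \<in> borel_measurable borel"
  shows "(\<lambda>s. flux s q p0 p1) \<in> borel_measurable borel"
proof -
  have [measurable]: "(\<lambda>s. ip (D s) q) \<in> borel_measurable borel"
    by (rule borel_measurable_ip) (use D_measurable in measurable)
  show ?thesis unfolding flux_def robin_flux_def by measurable
qed

lemma flux_bound:
  assumes "sq_int I1 q"
  shows "\<bar>flux s q p0 p1\<bar> \<le> l2norm I1 q * l2norm I1 (D s) + \<kappa> * (\<bar>p0\<bar> + \<bar>p1\<bar>)"
proof -
  have "\<bar>\<alpha> - r s 0\<bar> \<le> 1" "\<bar>\<beta> - r s 1\<bar> \<le> 1" using r_bounds[of 0 s] r_bounds[of 1 s] \<alpha> \<beta> by auto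
  then have "\<bar>p0 * (\<alpha> - r s 0)\<bar> \<le> \<bar>p0\<bar>" "\<bar>p1 * (\<beta> - r s 1)\<bar> \<le> \<bar>p1\<bar>" by (auto simp: abs_mult mult_left_le)
  then have "\<bar>p0 * (\<alpha> - r s 0) + p1 * (\<beta> - r s 1)\<bar> \<le> \<bar>p0\<bar> + \<bar>p1\<bar>" by linarith
  then have "\<bar>\<kappa> * (p0 * (\<alpha> - r s 0) + p1 * (\<beta> - r s 1))\<bar> \<le> \<kappa> * (\<bar>p0\<bar> + \<bar>p1\<bar>)"
    using \<kappa> by (simp add: abs_mult)
  then show ?thesis
    using ip_CS[OF D_sq_int assms, of s] unfolding flux_def robin_flux_def by (simp add: mult.commute)
qed

lemma flux_integrable:
  assumes "q \<in> borel_measurable borel" "sq_int I1 q"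
  shows "integrable (lebesgue_on {b..c}) (\<lambda>s. flux s q p0 p1)"
proof (rule Bochner_Integration.integrable_bound)
  show "integrable (lebesgue_on {b..c}) (\<lambda>s. l2norm I1 q * l2norm I1 (D s) + \<kappa> * (\<bar>p0\<bar> + \<bar>p1\<bar>))"
    using Icc.sq_int_integrable[OF l2norm_D_sq_int] by simp
  show "(\<lambda>s. flux s q p0 p1) \<in> borel_measurable (lebesgue_on {b..c})"
    by (rule borel_lebesgue_on[OF flux_measurable[OF assms(1)]])
  show "AE s in lebesgue_on {b..c}. norm (flux s q p0 p1) \<le> norm (l2norm I1 q * l2norm I1 (D s) + \<kappa> * (\<bar>p0\<bar> + \<bar>p1\<bar>))"
    unfolding real_norm_def by (intro AE_I2 order_trans[OF flux_bound[OF assms(2)] abs_ge_self])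
qed

lemma flux_diff:
  assumes "sq_int I1 q" "sq_int I1 q'"
  shows "flux s q p0 p1 - flux s q' p0' p1' = flux s (\<lambda>u. q u - q' u) (p0 - p0') (p1 - p1')"
  using ip_diff_right[OF D_sq_int assms, of s] by (simp add: flux_def robin_flux_def algebra_simps)

text \<open>Both sides are continuous in \<open>q\<close> for the \<open>L\<^sup>2\<close> norm. The test function may therefore be an arbitrary
  element of \<open>H1\<close>, in particular one built from the solution.\<close>

lemma weak_H1:
  assumes t: "t1 \<in> G" "t2 \<in> G" "t1 \<le> t2"
    and q: "q \<in> borel_measurable borel" "sq_int I1 q"
  shows "ip (\<lambda>u. r t2 u - r t1 u) (prim p0 q) = (LINT s | lebesgue_on {t1..t2}. flux s q p0 (prim p0 q 1))"
proof -
  let ?J = "lebesgue_on {t1..t2}"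
  define d where "d u = r t2 u - r t1 u" for u
  have d: "sq_int I1 d" unfolding d_def by (intro sq_int_diff r_sq_int)
  define C where "C = (LINT s | ?J. l2norm I1 (D s) + \<kappa>)"
  have C0: "0 \<le> C" unfolding C_def using \<kappa> by (intro Bochner_Integration.integral_nonneg) simp
  define K where "K = l2norm I1 d + C + 1"
  have K: "0 < K" using C0 l2norm_nonneg[of I1 d] unfolding K_def by linarith
  define \<Delta> where "\<Delta> = ip d (prim p0 q) - (LINT s | ?J. flux s q p0 (prim p0 q 1))"
  have "\<bar>\<Delta>\<bar> \<le> 0 + e" if e: "0 < e" for e
  proof -
    have "0 < e / K" using e K by simp
    from rpoly_dense_L2[OF q(2) this] obtain l where l: "l2norm I1 (\<lambda>x. rpoly l x - q x) < e / K" by blast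
    let ?v = "\<lambda>x. q x - rpoly l x"
    have v: "sq_int I1 ?v" by (rule sq_int_diff[OF q(2) rpoly_sq_int])
    obtain Q where Q: "smooth Q" "deriv Q = rpoly l" "Q 0 = p0" using smooth_antiderivative[OF smooth_rpoly] by blast
    have Qp: "prim p0 (rpoly l) u = Q u" if "u \<in> {0..1}" for u
      by (rule prim_smooth[OF smooth_rpoly Q that])
    have "ip d (prim p0 (rpoly l)) = ip d Q"
      unfolding ip_def by (intro Bochner_Integration.integral_cong) (simp_all add: Qp)
    also have "\<dots> = ip (r t2) Q - ip (r t1) Q"
      unfolding d_def by (intro ip_diff_left r_sq_int continuous_sq_int smooth_continuous Q)
    also have "\<dots> = (LINT s | ?J. flux s (rpoly l) p0 (prim p0 (rpoly l) 1))"
      using weak'[OF t Q(1)] Q Qp[of 1] by simp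
    finally have eq: "ip d (prim p0 (rpoly l)) = (LINT s | ?J. flux s (rpoly l) p0 (prim p0 (rpoly l) 1))" .
    have lm: "rpoly l \<in> borel_measurable borel"
      by (intro borel_measurable_continuous_onI smooth_continuous smooth_rpoly)
    have "\<Delta> = (ip d (prim p0 q) - ip d (prim p0 (rpoly l))) - ((LINT s | ?J. flux s q p0 (prim p0 q 1)) - (LINT s | ?J. flux s (rpoly l) p0 (prim p0 (rpoly l) 1)))"
      unfolding \<Delta>_def eq by simp
    also have "ip d (prim p0 q) - ip d (prim p0 (rpoly l)) = ip d (prim 0 ?v)"
      using prim_diff_w[OF q(2) rpoly_sq_int[of l], where c = p0 and d = p0]
      by (simp add: ip_diff_right[symmetric] d prim_sq_int q(2) rpoly_sq_int)
    also have "(LINT s | ?J. flux s q p0 (prim p0 q 1)) - (LINT s | ?J. flux s (rpoly l) p0 (prim p0 (rpoly l) 1))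
      = (LINT s | ?J. flux s ?v 0 (prim 0 ?v 1))"
      using prim_diff_w[OF q(2) rpoly_sq_int[of l], where c = p0 and d = p0] flux_diff[OF q(2) rpoly_sq_int[of l]]
      by (subst Bochner_Integration.integral_diff[symmetric]) (auto intro!: flux_integrable q rpoly_sq_int lm)
    finally have "\<bar>\<Delta>\<bar> \<le> \<bar>ip d (prim 0 ?v)\<bar> + \<bar>LINT s | ?J. flux s ?v 0 (prim 0 ?v 1)\<bar>" by linarith
    also have "\<bar>ip d (prim 0 ?v)\<bar> \<le> l2norm I1 d * l2norm I1 ?v"
      using ip_CS[OF d prim_sq_int[OF v], of 0] mult_left_mono[OF l2norm_prim[OF v] l2norm_nonneg, of I1 d] by linarith
    also have "\<bar>LINT s | ?J. flux s ?v 0 (prim 0 ?v 1)\<bar> \<le> (LINT s | ?J. \<bar>flux s ?v 0 (prim 0 ?v 1)\<bar>)"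
      by (rule integral_abs_bound)
    also have "\<dots> \<le> (LINT s | ?J. l2norm I1 ?v * (l2norm I1 (D s) + \<kappa>))"
    proof (rule integral_mono)
      show "integrable ?J (\<lambda>s. \<bar>flux s ?v 0 (prim 0 ?v 1)\<bar>)"
        using q lm v by (intro integrable_abs flux_integrable) auto
      show "integrable ?J (\<lambda>s. l2norm I1 ?v * (l2norm I1 (D s) + \<kappa>))"
        using Icc.sq_int_integrable[OF l2norm_D_sq_int] by simp
      fix s
      have "\<kappa> * (\<bar>0\<bar> + \<bar>prim 0 ?v 1\<bar>) \<le> \<kappa> * l2norm I1 ?v" using prim_bound[OF v, of 1] \<kappa> by simp
      then show "\<bar>flux s ?v 0 (prim 0 ?v 1)\<bar> \<le> l2norm I1 ?v * (l2norm I1 (D s) + \<kappa>)"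
        using flux_bound[OF v, of s 0 "prim 0 ?v 1"] by (simp add: algebra_simps)
    qed
    also have "\<dots> = l2norm I1 ?v * C" by (simp add: C_def)
    finally have "\<bar>\<Delta>\<bar> \<le> l2norm I1 ?v * (l2norm I1 d + C)" by (simp add: algebra_simps)
    also have "\<dots> \<le> l2norm I1 ?v * K" unfolding K_def by (intro mult_left_mono) auto
    also have "\<dots> \<le> e" using l K by (simp add: l2norm_minus_commute[of I1 q] field_simps)
    finally show ?thesis by simp
  qed
  then have "\<bar>\<Delta>\<bar> \<le> 0" by (rule field_le_epsilon)
  then show ?thesis unfolding \<Delta>_def d_def by simp
qed

lemma \<psi>_bounds: "u \<in> {0..1} \<Longrightarrow> 0 \<le> \<psi> u" "u \<in> {0..1} \<Longrightarrow> \<psi> u \<le> 1"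
proof -
  assume u: "u \<in> {0..1}"
  have e: "\<psi> u = (1 - u) * \<alpha> ^ m + u * \<beta> ^ m" by (simp add: \<psi>_def algebra_simps)
  have "\<alpha> ^ m \<in> {0..1}" "\<beta> ^ m \<in> {0..1}" using \<alpha> \<beta> by (auto intro: power_le_one)
  then show "0 \<le> \<psi> u" "\<psi> u \<le> 1"
    unfolding e using u by (auto intro!: convex_bound_le[of _ 1])
qed

lemma \<psi>_continuous: "continuous_on A \<psi>"
  unfolding \<psi>_def by (intro continuous_intros)

lemma E_continuous: "continuous_on {0..1} (\<lambda>u. r s u ^ Suc m / Suc m - r s u * \<psi> u)"
  by (intro continuous_intros r_continuous \<psi>_continuous) auto

lemma E_integrable: "integrable I1 (\<lambda>u. r s u ^ Suc m / Suc m - r s u * \<psi> u)"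
  by (rule Icc.sq_int_integrable[OF continuous_sq_int[OF E_continuous]])

lemma E_measurable: "E \<in> borel_measurable borel"
proof -
  have [measurable]: "\<psi> \<in> borel_measurable borel" by (intro borel_measurable_continuous_onI \<psi>_continuous)
  show ?thesis unfolding E_def by (rule borel_measurable_integral_I1) (use r_measurable in measurable)
qed

lemma E_bound: "\<bar>E s\<bar> \<le> 1"
proof -
  have "\<bar>E s\<bar> \<le> (LINT u | I1. \<bar>r s u ^ Suc m / Suc m - r s u * \<psi> u\<bar>)"
    unfolding E_def by (rule integral_abs_bound)
  also have "\<dots> \<le> (LINT u | I1. 1)"
  proof (rule integral_mono)
    fix u assume "u \<in> space I1"
    then have u: "u \<in> {0..1}" by simp
    have "0 \<le> r s u ^ Suc m" "r s u ^ Suc m \<le> 1" using r_bounds[OF u] by (auto intro: power_le_one simp del: power_Suc)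
    then have "0 \<le> r s u ^ Suc m / Suc m" "r s u ^ Suc m / Suc m \<le> 1" by (auto simp: divide_le_eq simp del: power_Suc)
    moreover have "0 \<le> r s u * \<psi> u" "r s u * \<psi> u \<le> 1" using r_bounds[OF u] \<psi>_bounds[OF u] by (auto intro: mult_le_one)
    ultimately show "\<bar>r s u ^ Suc m / Suc m - r s u * \<psi> u\<bar> \<le> 1" by linarith
  qed (use E_integrable in auto)
  finally show ?thesis by simp
qed

lemma D_section: "D t \<in> borel_measurable borel"
  using measurable_Pair2[OF D_measurable, of t] by simp

text \<open>Test with \<open>F t2 - \<psi>\<close>, whose boundary values are \<open>F t2 0 - \<alpha> ^ m\<close> and \<open>F t2 1 - \<beta> ^ m\<close>, and use the
  tangent inequality at \<open>r t2\<close>.\<close>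

lemma energy_increment:
  assumes t: "t1 \<in> G" "t2 \<in> G" "t1 \<le> t2"
  shows "E t2 - E t1 \<le> (LINT s | lebesgue_on {t1..t2}. flux s (\<lambda>u. D t2 u - (\<beta> ^ m - \<alpha> ^ m)) (F t2 0 - \<alpha> ^ m) (F t2 1 - \<beta> ^ m))"
proof -
  let ?q = "\<lambda>u. D t2 u - (\<beta> ^ m - \<alpha> ^ m)"
  have q: "sq_int I1 ?q" by (intro sq_int_diff D_sq_int sq_int_const)
  have p: "prim (F t2 0 - \<alpha> ^ m) ?q u = F t2 u - \<psi> u" if "u \<in> {0..1}" for u
    using prim_diff_w[OF D_sq_int[of t2] sq_int_const[of "\<beta> ^ m - \<alpha> ^ m"], of "F t2 0" u "\<alpha> ^ m"] prim_const[OF that, of "\<alpha> ^ m" "\<beta> ^ m - \<alpha> ^ m"]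
    by (simp add: \<psi>_def)
  have sq: "sq_int I1 (\<lambda>u. r t2 u - r t1 u)" by (intro sq_int_diff r_sq_int)
  have "E t2 - E t1 = (LINT u | I1. (r t2 u ^ Suc m / Suc m - r t2 u * \<psi> u) - (r t1 u ^ Suc m / Suc m - r t1 u * \<psi> u))"
    unfolding E_def by (intro Bochner_Integration.integral_diff[symmetric] E_integrable)
  also have "\<dots> \<le> (LINT u | I1. (r t2 u - r t1 u) * prim (F t2 0 - \<alpha> ^ m) ?q u)"
  proof (rule integral_mono)
    show "integrable I1 (\<lambda>u. (r t2 u - r t1 u) * prim (F t2 0 - \<alpha> ^ m) ?q u)"
      by (intro sq_int_mult sq prim_sq_int q)
    fix u assume "u \<in> space I1"
    then have u: "u \<in> {0..1}" by simp
    have "r t2 u ^ Suc m / Suc m - r t1 u ^ Suc m / Suc m \<le> (r t2 u - r t1 u) * r t2 u ^ m"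
      using r_bounds[OF u] by (intro power_tangent_le) auto
    then show "(r t2 u ^ Suc m / Suc m - r t2 u * \<psi> u) - (r t1 u ^ Suc m / Suc m - r t1 u * \<psi> u)
      \<le> (r t2 u - r t1 u) * prim (F t2 0 - \<alpha> ^ m) ?q u"
      unfolding p[OF u] r_power[OF u] by (simp add: algebra_simps)
  qed (intro Bochner_Integration.integrable_diff[OF E_integrable E_integrable])
  also have "\<dots> = ip (\<lambda>u. r t2 u - r t1 u) (prim (F t2 0 - \<alpha> ^ m) ?q)" by (simp add: ip_def)
  also have "\<dots> = (LINT s | lebesgue_on {t1..t2}. flux s ?q (F t2 0 - \<alpha> ^ m) (prim (F t2 0 - \<alpha> ^ m) ?q 1))"
    by (intro weak_H1 t q borel_measurable_diff D_section borel_measurable_const)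
  also have "prim (F t2 0 - \<alpha> ^ m) ?q 1 = F t2 1 - \<beta> ^ m" using p[of 1] by (simp add: \<psi>_def)
  finally show ?thesis .
qed

text \<open>\<open>Z \<eta> s t\<close> majorises the flux at time \<open>s\<close> tested with \<open>F t - \<psi>\<close>. On the diagonal \<open>s = t\<close> it
  equals \<open>1 + 2 * \<kappa> * \<eta> - N t\<close>; the remaining terms are squares of increments in time, which vanish in
  the mean as \<open>s - t\<close> tends to \<open>0\<close>. The parameter \<open>\<eta>\<close> converts increments of the boundary values into
  their squares.\<close>

definition "M s t = (l2norm I1 (\<lambda>u. D s u - D t u))\<^sup>2"

definition "Z \<eta> s t = 1 + 2 * \<kappa> * \<eta> + (M s t - N s - N t) / 2 + \<kappa> / \<eta> * ((r s 0 - r t 0)\<^sup>2 + (r s 1 - r t 1)\<^sup>2)"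

text \<open>With \<open>y\<close> in place of \<open>x\<close> the product is nonpositive, since \<open>y ^ m - c ^ m\<close> and \<open>c - y\<close> have opposite
  signs. The error is at most \<open>\<bar>x - y\<bar>\<close>, which is split by the inequality of arithmetic and geometric
  means.\<close>

lemma boundary_le:
  assumes x: "0 \<le> x" "x \<le> 1" and y: "0 \<le> y" "y \<le> 1" and c: "c \<in> {0<..<1::real}" and \<eta>: "0 < \<eta>"
  shows "(y ^ m - c ^ m) * (c - x) \<le> \<eta> + (x - y)\<^sup>2 / \<eta>"
proof -
  have "(y ^ m - c ^ m) * (c - y) \<le> 0"
    using y c by (cases "y \<le> c") (auto simp: mult_nonpos_nonneg mult_nonneg_nonpos power_mono)
  moreover have "(y ^ m - c ^ m) * (y - x) \<le> \<bar>x - y\<bar>"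
  proof -
    have "0 \<le> y ^ m" "y ^ m \<le> 1" "0 \<le> c ^ m" "c ^ m \<le> 1" using y c by (auto intro: power_le_one)
    then have "\<bar>y ^ m - c ^ m\<bar> \<le> 1" by linarith
    then have "\<bar>y ^ m - c ^ m\<bar> * \<bar>y - x\<bar> \<le> 1 * \<bar>y - x\<bar>" by (intro mult_right_mono) auto
    then show ?thesis
      using abs_ge_self[of "(y ^ m - c ^ m) * (y - x)"] by (simp add: abs_mult abs_minus_commute)
  qed
  moreover have "\<bar>x - y\<bar> \<le> \<eta> + (x - y)\<^sup>2 / \<eta>"
  proof -
    have "2 * \<bar>x - y\<bar> * \<eta> \<le> \<bar>x - y\<bar>\<^sup>2 + \<eta>\<^sup>2" by (rule sum_squares_bound)
    then have "\<bar>x - y\<bar> * \<eta> \<le> (x - y)\<^sup>2 + \<eta>\<^sup>2" using mult_nonneg_nonneg[of "\<bar>x - y\<bar>" \<eta>] \<eta>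
      unfolding power2_abs by linarith
    then have "\<bar>x - y\<bar> \<le> ((x - y)\<^sup>2 + \<eta>\<^sup>2) / \<eta>" using \<eta> by (simp add: field_simps)
    then show ?thesis using \<eta> by (simp add: add_divide_distrib power2_eq_square)
  qed
  ultimately show ?thesis by (simp add: algebra_simps)
qed

text \<open>Polarisation, \<open>- ip (D s) (D t) = (M s t - N s - N t) / 2\<close>, for the bulk term; for the affine part
  \<open>\<psi>\<close>, the integral of \<open>D s\<close> is an increment of \<open>F s\<close> and thus bounded.\<close>

lemma flux_le_Z:
  assumes "0 < \<eta>"
  shows "flux s (\<lambda>u. D t u - (\<beta> ^ m - \<alpha> ^ m)) (F t 0 - \<alpha> ^ m) (F t 1 - \<beta> ^ m) \<le> Z \<eta> s t"
proof -
  have "M s t = N s - 2 * ip (D s) (D t) + N t"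
    using integral_sum_sq[OF D_sq_int[of s] D_sq_int[of t], of "-1"] by (simp add: M_def N_def l2norm_sq ip_def)
  then have 1: "- ip (D s) (D t) = (M s t - N s - N t) / 2" by simp
  have "ip (D s) (\<lambda>_. \<beta> ^ m - \<alpha> ^ m) = (\<beta> ^ m - \<alpha> ^ m) * ip (indicator {0..1}) (D s)"
    unfolding ip_def by (subst Bochner_Integration.integral_mult_right_zero[symmetric], rule Bochner_Integration.integral_cong) auto
  also have "ip (indicator {0..1}) (D s) = F s 1 - F s 0" by (simp only: prim_0) (simp add: prim_def)
  finally have "ip (D s) (\<lambda>_. \<beta> ^ m - \<alpha> ^ m) = (\<beta> ^ m - \<alpha> ^ m) * (F s 1 - F s 0)" .
  moreover have "\<bar>(\<beta> ^ m - \<alpha> ^ m) * (F s 1 - F s 0)\<bar> \<le> 1"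
  proof -
    have "0 \<le> \<alpha> ^ m" "\<alpha> ^ m \<le> 1" "0 \<le> \<beta> ^ m" "\<beta> ^ m \<le> 1" using \<alpha> \<beta> by (auto intro: power_le_one)
    then have "\<bar>\<beta> ^ m - \<alpha> ^ m\<bar> \<le> 1" by linarith
    moreover have "\<bar>F s 1 - F s 0\<bar> \<le> 1" using F_bounds[of 0 s] F_bounds[of 1 s] by auto
    ultimately show ?thesis unfolding abs_mult by (intro mult_le_one) auto
  qed
  ultimately have 2: "ip (D s) (\<lambda>_. \<beta> ^ m - \<alpha> ^ m) \<le> 1" by linarith
  have "ip (D s) (\<lambda>u. D t u - (\<beta> ^ m - \<alpha> ^ m)) = ip (D s) (D t) - ip (D s) (\<lambda>_. \<beta> ^ m - \<alpha> ^ m)"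
    by (intro ip_diff_right D_sq_int sq_int_const)
  then have 3: "- ip (D s) (\<lambda>u. D t u - (\<beta> ^ m - \<alpha> ^ m)) \<le> 1 + (M s t - N s - N t) / 2"
    using 1 2 by linarith
  have "(F t 0 - \<alpha> ^ m) * (\<alpha> - r s 0) \<le> \<eta> + (r s 0 - r t 0)\<^sup>2 / \<eta>"
    using boundary_le[of "r s 0" "r t 0" \<alpha> \<eta>] r_bounds[of 0] \<alpha> assms r_power[of 0 t] by simp
  moreover have "(F t 1 - \<beta> ^ m) * (\<beta> - r s 1) \<le> \<eta> + (r s 1 - r t 1)\<^sup>2 / \<eta>"
    using boundary_le[of "r s 1" "r t 1" \<beta> \<eta>] r_bounds[of 1] \<beta> assms r_power[of 1 t] by simp
  ultimately have "\<kappa> * ((F t 0 - \<alpha> ^ m) * (\<alpha> - r s 0) + (F t 1 - \<beta> ^ m) * (\<beta> - r s 1))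
     \<le> \<kappa> * (2 * \<eta> + ((r s 0 - r t 0)\<^sup>2 + (r s 1 - r t 1)\<^sup>2) / \<eta>)"
    using \<kappa> by (intro mult_left_mono) (auto simp: add_divide_distrib)
  also have "\<dots> = 2 * \<kappa> * \<eta> + \<kappa> / \<eta> * ((r s 0 - r t 0)\<^sup>2 + (r s 1 - r t 1)\<^sup>2)"
    by (simp add: distrib_left add_divide_distrib)
  finally show ?thesis using 3 unfolding flux_def robin_flux_def Z_def by linarith
qed

lemma N_measurable [measurable]: "N \<in> borel_measurable borel"
  unfolding N_def using borel_measurable_l2norm[OF D_measurable] by measurable

lemma M_measurable: "(\<lambda>(s, t). M s t) \<in> borel_measurable (borel \<Otimes>\<^sub>M borel)"
proof -
  have 1: "(\<lambda>(p, u). D (fst p) u) \<in> borel_measurable ((borel \<Otimes>\<^sub>M borel) \<Otimes>\<^sub>M (borel :: real measure))"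
    using measurable_compose[of "\<lambda>(p, u). (fst p, u)" "(borel \<Otimes>\<^sub>M borel) \<Otimes>\<^sub>M borel" "borel \<Otimes>\<^sub>M borel", OF _ D_measurable]
    by (simp add: case_prod_unfold)
  have 2: "(\<lambda>(p, u). D (snd p) u) \<in> borel_measurable ((borel \<Otimes>\<^sub>M borel) \<Otimes>\<^sub>M (borel :: real measure))"
    using measurable_compose[of "\<lambda>(p, u). (snd p, u)" "(borel \<Otimes>\<^sub>M borel) \<Otimes>\<^sub>M borel" "borel \<Otimes>\<^sub>M borel", OF _ D_measurable]
    by (simp add: case_prod_unfold)
  have "(\<lambda>p. l2norm I1 (\<lambda>u. D (fst p) u - D (snd p) u)) \<in> borel_measurable (borel \<Otimes>\<^sub>M borel)"
    by (rule borel_measurable_l2norm) (use 1 2 in measurable)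
  then show ?thesis unfolding M_def by (simp add: case_prod_unfold)
qed

lemma Z_measurable: "(\<lambda>(s, t). Z \<eta> s t) \<in> borel_measurable (borel \<Otimes>\<^sub>M borel)"
  unfolding Z_def using M_measurable by measurable

lemma N_nonneg: "0 \<le> N s" by (simp add: N_def)

lemma M_nonneg: "0 \<le> M s t" by (simp add: M_def)

lemma M_le: "M s t \<le> 2 * N s + 2 * N t"
proof -
  have "M s t \<le> (l2norm I1 (D s) + l2norm I1 (D t))\<^sup>2"
    unfolding M_def using l2norm_triangle[OF D_sq_int[of s] sq_int_minus[OF D_sq_int[of t]]]
    by (intro power_mono) (auto simp: l2norm_def)
  also have "\<dots> \<le> 2 * N s + 2 * N t"
    unfolding N_def using sum_squares_bound[of "l2norm I1 (D s)" "l2norm I1 (D t)"] by (simp add: power2_sum)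
  finally show ?thesis .
qed

lemma Z_bound:
  assumes "0 < \<eta>"
  shows "\<bar>Z \<eta> s t\<bar> \<le> (1 + 2 * \<kappa> * \<eta> + 2 * \<kappa> / \<eta>) + 2 * N s + 2 * N t"
proof -
  have sq1: "(r s u - r t u)\<^sup>2 \<le> 1" if "u \<in> {0..1}" for u
    using r_bounds[OF that, of s] r_bounds[OF that, of t] by (simp add: abs_square_le_1)
  have "(r s 0 - r t 0)\<^sup>2 + (r s 1 - r t 1)\<^sup>2 \<le> 2" using sq1[of 0] sq1[of 1] by simp
  then have "\<kappa> / \<eta> * ((r s 0 - r t 0)\<^sup>2 + (r s 1 - r t 1)\<^sup>2) \<le> \<kappa> / \<eta> * 2"
    using \<kappa> assms by (intro mult_left_mono) auto
  also have "\<dots> = 2 * \<kappa> / \<eta>" by simp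
  finally have X1: "\<kappa> / \<eta> * ((r s 0 - r t 0)\<^sup>2 + (r s 1 - r t 1)\<^sup>2) \<le> 2 * \<kappa> / \<eta>" .
  have X0: "0 \<le> \<kappa> / \<eta> * ((r s 0 - r t 0)\<^sup>2 + (r s 1 - r t 1)\<^sup>2)" and k: "0 \<le> 2 * \<kappa> * \<eta>" using \<kappa> assms by auto
  define X where "X = \<kappa> / \<eta> * ((r s 0 - r t 0)\<^sup>2 + (r s 1 - r t 1)\<^sup>2)"
  have Z: "Z \<eta> s t = 1 + 2 * \<kappa> * \<eta> + (M s t - N s - N t) / 2 + X" by (simp add: Z_def X_def)
  have aux: "\<bar>1 + B + (M' - N1 - N2) / 2 + X'\<bar> \<le> 1 + B + A + 2 * N1 + 2 * N2"
    if "0 \<le> X'" "X' \<le> A" "0 \<le> B" "M' \<le> 2 * N1 + 2 * N2" "0 \<le> M'" "0 \<le> N1" "0 \<le> N2" for A B X' M' N1 N2 :: real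
    using that by (simp add: abs_le_iff field_simps)
  show ?thesis
    unfolding Z using X0 X1 unfolding X_def[symmetric]
    by (rule aux[OF _ _ k M_le M_nonneg N_nonneg N_nonneg])
qed

lemma N_integrable: "integrable lborel N"
  using D_integrable by (simp add: N_def[abs_def])

lemma N_shift:
  "integrable lborel (\<lambda>t. N (t - x))" "(LINT t | lborel. N (t - x)) = (LINT t | lborel. N t)"
  using lborel_integrable_real_affine[OF N_integrable, of 1 "-x"] lborel_integral_real_affine[of 1 N "-x"] by simp_all

lemma N_shift':
  "integrable lborel (\<lambda>x. N (t - x))"
  using lborel_integrable_real_affine[OF N_integrable, of "-1" t] by simp

text \<open>The substitution \<open>s = t - x\<close> gives the window of integration the same form for all \<open>t\<close>.\<close>

lemma energy_increment_Z:
  assumes t: "t \<in> G" "t - h \<in> G" "0 \<le> h" and \<eta>: "0 < \<eta>"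
  shows "E t - E (t - h) \<le> (LINT x | lborel. indicator {0..h} x * Z \<eta> (t - x) t)"
proof -
  let ?f = "\<lambda>s. flux s (\<lambda>u. D t u - (\<beta> ^ m - \<alpha> ^ m)) (F t 0 - \<alpha> ^ m) (F t 1 - \<beta> ^ m)"
  have q: "(\<lambda>u. D t u - (\<beta> ^ m - \<alpha> ^ m)) \<in> borel_measurable borel" "sq_int I1 (\<lambda>u. D t u - (\<beta> ^ m - \<alpha> ^ m))"
    using D_section[of t] by (auto intro!: borel_measurable_diff sq_int_diff D_sq_int sq_int_const)
  have fm: "?f \<in> borel_measurable borel" by (rule flux_measurable[OF q(1)])
  have fi: "integrable lborel (\<lambda>s. indicator {t - h..t} s * ?f s)"
    using flux_integrable[OF q, of "t - h" t] integrable_lebesgue_on_borel[OF fm, of "{t - h..t}"] by simp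
  have ind: "indicator {t - h..t} (t + (-1) * x) = (indicator {0..h} x :: real)" for x
    by (auto simp: indicator_def)
  have zi: "integrable lborel (\<lambda>x. indicator {0..h} x * Z \<eta> (t - x) t)"
  proof (rule Bochner_Integration.integrable_bound)
    let ?K = "1 + 2 * \<kappa> * \<eta> + 2 * \<kappa> / \<eta>"
    show "integrable lborel (\<lambda>x. indicator {0..h} x * (?K + 2 * N t) + 2 * N (t - x))"
      using N_shift'[of t] by (intro Bochner_Integration.integrable_add Bochner_Integration.integrable_mult_left
          Bochner_Integration.integrable_mult_right integrable_real_indicator) (auto simp: emeasure_lborel_Icc_eq)
    show "(\<lambda>x. indicator {0..h} x * Z \<eta> (t - x) t) \<in> borel_measurable lborel"
      using Z_measurable[of \<eta>] by measurable
    show "AE x in lborel. norm (indicator {0..h} x * Z \<eta> (t - x) t) \<le> norm (indicator {0..h} x * (?K + 2 * N t) + 2 * N (t - x))"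
    proof (rule AE_I2)
      fix x
      have "\<bar>indicator {0..h} x * Z \<eta> (t - x) t\<bar> \<le> indicator {0..h} x * (?K + 2 * N t) + 2 * N (t - x)"
        using Z_bound[OF \<eta>, of "t - x" t] N_nonneg[of "t - x"] by (auto simp: indicator_def)
      then show "norm (indicator {0..h} x * Z \<eta> (t - x) t) \<le> norm (indicator {0..h} x * (?K + 2 * N t) + 2 * N (t - x))"
        unfolding real_norm_def by (rule order_trans[OF _ abs_ge_self])
    qed
  qed
  have "E t - E (t - h) \<le> (LINT s | lebesgue_on {t - h..t}. ?f s)"
    by (rule energy_increment) (use t in auto)
  also have "\<dots> = (LINT s | lborel. indicator {t - h..t} s * ?f s)"
    by (rule integral_lebesgue_on_borel[OF fm]) simp
  also have "\<dots> = (LINT x | lborel. indicator {0..h} x * ?f (t - x))"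
    by (subst lborel_integral_real_affine[of "-1" _ t]) (simp_all only: ind, auto)
  also have "\<dots> \<le> (LINT x | lborel. indicator {0..h} x * Z \<eta> (t - x) t)"
  proof (rule integral_mono[OF _ zi])
    show "integrable lborel (\<lambda>x. indicator {0..h} x * ?f (t - x))"
      using lborel_integrable_real_affine[OF fi, of "-1" t] unfolding ind by simp
    show "indicator {0..h} x * ?f (t - x) \<le> indicator {0..h} x * Z \<eta> (t - x) t" for x
      by (intro mult_left_mono flux_le_Z \<eta>) auto
  qed
  finally show ?thesis .
qed

lemma indicator_Icc_integrable: "integrable lborel (indicat_real {b..c::real})"
  by (intro integrable_real_indicator) (auto simp: emeasure_lborel_Icc_eq)

lemma indicator_times_integrable:
  fixes f :: "real \<Rightarrow> real"
  assumes "f \<in> borel_measurable borel" "\<And>t. \<bar>f t\<bar> \<le> B"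
  shows "integrable lborel (\<lambda>t. indicator {b..c} t * f t)"
proof (rule Bochner_Integration.integrable_bound)
  show "integrable lborel (\<lambda>t. indicator {b..c} t * B)"
    by (intro Bochner_Integration.integrable_mult_left indicator_Icc_integrable)
  show "(\<lambda>t. indicator {b..c} t * f t) \<in> borel_measurable lborel" using assms(1) by measurable
  show "AE t in lborel. norm (indicator {b..c} t * f t) \<le> norm (indicator {b..c} t * B)"
    using assms(2) by (intro AE_I2) (auto simp: abs_mult intro!: mult_left_mono order_trans[OF _ abs_ge_self])
qed

lemma Z_pair_integrable:
  assumes \<eta>: "0 < \<eta>"
  shows "integrable (lborel \<Otimes>\<^sub>M lborel) (\<lambda>(x, t). indicator {0..h} x * (indicator {h..T} t * Z \<eta> (t - x) t))"
proof -
  let ?K = "1 + 2 * \<kappa> * \<eta> + 2 * \<kappa> / \<eta>"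
  have K: "0 \<le> ?K" using \<kappa> \<eta> by auto
  define Q where "Q = (\<lambda>(x, t). indicat_real {0..h} x * (indicator {h..T} t * ?K + 2 * N (t - x) + 2 * N t))"
  have Qt: "integrable lborel (\<lambda>t. indicator {h..T} t * ?K + 2 * N (t - x) + 2 * N t)" for x
    by (intro Bochner_Integration.integrable_add Bochner_Integration.integrable_mult_left
        Bochner_Integration.integrable_mult_right indicator_Icc_integrable N_shift N_integrable)
  have Q0: "0 \<le> indicator {h..T} t * ?K + 2 * N (t - x) + 2 * N t" for x t
    using mult_nonneg_nonneg[OF indicator_pos_le K, of "{h..T}" t] N_nonneg[of t] N_nonneg[of "t - x"] by linarith
  define W where "W = (LINT t | lborel. indicator {h..T} t * ?K) + 2 * (LINT t | lborel. N t) + 2 * (LINT t | lborel. N t)"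
  have QW: "(LINT t | lborel. indicator {h..T} t * ?K + 2 * N (t - x) + 2 * N t) = W" for x
  proof -
    have "integrable lborel (\<lambda>t. indicator {h..T} t * ?K)"
      by (intro Bochner_Integration.integrable_mult_left indicator_Icc_integrable)
    then show ?thesis unfolding W_def using N_shift[of x] N_integrable by simp
  qed
  have "integrable (lborel \<Otimes>\<^sub>M lborel) Q"
  proof (rule lborel_pair.Fubini_integrable)
    show "Q \<in> borel_measurable (lborel \<Otimes>\<^sub>M lborel)" unfolding Q_def by measurable
    have "(LINT t | lborel. norm (Q (x, t))) = indicator {0..h} x * W" for x
      unfolding Q_def using Q0 by (simp add: abs_mult QW)
    then show "integrable lborel (\<lambda>x. LINT t | lborel. norm (Q (x, t)))"
      by (simp only:) (intro Bochner_Integration.integrable_mult_left indicator_Icc_integrable)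
    show "AE x in lborel. integrable lborel (\<lambda>t. Q (x, t))"
      unfolding Q_def using Qt by (intro AE_I2) simp
  qed
  then show ?thesis
  proof (rule Bochner_Integration.integrable_bound)
    show "(\<lambda>(x, t). indicator {0..h} x * (indicator {h..T} t * Z \<eta> (t - x) t)) \<in> borel_measurable (lborel \<Otimes>\<^sub>M lborel)"
      using Z_measurable[of \<eta>] by measurable
    show "AE p in lborel \<Otimes>\<^sub>M lborel. norm (case p of (x, t) \<Rightarrow> indicator {0..h} x * (indicator {h..T} t * Z \<eta> (t - x) t)) \<le> norm (Q p)"
    proof (rule AE_I2)
      fix p :: "real \<times> real"
      obtain x t where p: "p = (x, t)" by (cases p)
      have "\<bar>indicator {h..T} t * Z \<eta> (t - x) t\<bar> \<le> indicator {h..T} t * ?K + 2 * N (t - x) + 2 * N t"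
        using Z_bound[OF \<eta>, of "t - x" t] N_nonneg[of t] N_nonneg[of "t - x"] by (auto simp: indicator_def)
      then show "norm (case p of (x, t) \<Rightarrow> indicator {0..h} x * (indicator {h..T} t * Z \<eta> (t - x) t)) \<le> norm (Q p)"
        unfolding p using Q0[of t x] by (auto simp: Q_def abs_mult intro!: mult_left_mono)
    qed
  qed
qed

text \<open>The integral of \<open>E t - E (t - h)\<close> over \<open>[h, T]\<close> telescopes to integrals over two intervals of length
  \<open>h\<close>, on which \<open>\<bar>E\<bar>\<close> is at most \<open>1\<close>. Fubini's theorem moves the average over \<open>x\<close> to the outside.\<close>

lemma averaged_increment:
  assumes h: "0 < h" "h \<le> T" and \<eta>: "0 < \<eta>"
  shows "- (2 * h) \<le> (LINT x | lborel. indicator {0..h} x * (LINT t | lborel. indicator {h..T} t * Z \<eta> (t - x) t))"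
proof -
  note [measurable] = E_measurable
  have iE: "integrable lborel (\<lambda>t. indicator {b..c} t * E (t - d))" for b c d
    by (rule indicator_times_integrable[where B = 1]) (use E_bound in measurable)
  have "- (2 * h) = - ((LINT t | lborel. indicat_real {0..h} t) + (LINT t | lborel. indicat_real {T - h..T} t))"
    using h by simp
  also have "\<dots> = (LINT t | lborel. - (indicator {0..h} t + indicator {T - h..T} t))"
    using indicator_Icc_integrable by simp
  also have "\<dots> \<le> (LINT t | lborel. indicator {h..T} t * E t - indicator {0..T - h} t * E t)"
  proof (rule integral_mono)
    show "integrable lborel (\<lambda>t. - (indicat_real {0..h} t + indicator {T - h..T} t))"
      by (intro Bochner_Integration.integrable_minus Bochner_Integration.integrable_add indicator_Icc_integrable)
    show "integrable lborel (\<lambda>t. indicator {h..T} t * E t - indicator {0..T - h} t * E t)"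
      using iE[of h T 0] iE[of 0 "T - h" 0] by simp
    show "- (indicat_real {0..h} t + indicator {T - h..T} t) \<le> indicator {h..T} t * E t - indicator {0..T - h} t * E t" for t
      using E_bound[of t] h by (auto simp: indicator_def)
  qed
  also have "\<dots> = (LINT t | lborel. indicator {h..T} t * E t) - (LINT t | lborel. indicator {0..T - h} t * E t)"
    using iE[of h T 0] iE[of 0 "T - h" 0] by simp
  also have "(LINT t | lborel. indicator {0..T - h} t * E t) = (LINT t | lborel. indicator {h..T} t * E (t - h))"
  proof -
    have "indicator {0..T - h} (- h + 1 * t) = (indicator {h..T} t :: real)" for t by (auto simp: indicator_def)
    then show ?thesis
      using lborel_integral_real_affine[of 1 "\<lambda>t. indicator {0..T - h} t * E t" "- h"] by simp
  qed
  also have "(LINT t | lborel. indicator {h..T} t * E t) - (LINT t | lborel. indicator {h..T} t * E (t - h))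
     = (LINT t | lborel. indicator {h..T} t * E t - indicator {h..T} t * E (t - h))"
    using iE[of h T 0] iE[of h T h] by simp
  also have "\<dots> \<le> (LINT t | lborel. LINT x | lborel. indicator {0..h} x * (indicator {h..T} t * Z \<eta> (t - x) t))"
  proof (rule integral_mono_AE)
    show "integrable lborel (\<lambda>t. indicator {h..T} t * E t - indicator {h..T} t * E (t - h))"
      using iE[of h T 0] iE[of h T h] by simp
    show "integrable lborel (\<lambda>t. LINT x | lborel. indicator {0..h} x * (indicator {h..T} t * Z \<eta> (t - x) t))"
      by (rule lborel_pair.integrable_snd[OF Z_pair_integrable[OF \<eta>]])
    have "AE t in lborel. (- h + 1 * t \<in> {0..T} \<longrightarrow> - h + 1 * t \<in> G)"
      by (rule AE_borel_affine[OF _ _ G_AE]) (simp, measurable)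
    with G_AE show "AE t in lborel. indicator {h..T} t * E t - indicator {h..T} t * E (t - h)
       \<le> (LINT x | lborel. indicator {0..h} x * (indicator {h..T} t * Z \<eta> (t - x) t))"
    proof eventually_elim
      case (elim t)
      show ?case
      proof (cases "t \<in> {h..T}")
        case True
        then have "t \<in> G" "t - h \<in> G" using elim h by auto
        from energy_increment_Z[OF this _ \<eta>] h True show ?thesis by simp
      next
        case False
        then show ?thesis by simp
      qed
    qed
  qed
  also have "\<dots> = (LINT x | lborel. LINT t | lborel. indicator {0..h} x * (indicator {h..T} t * Z \<eta> (t - x) t))"
    by (rule lborel_pair.Fubini_integral[OF Z_pair_integrable[OF \<eta>]])
  finally show ?thesis by simp
qed

lemma trace_translation:
  assumes u: "u \<in> {0..1}" and e: "0 < e"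
  shows "\<exists>\<delta>>0. \<forall>x. 0 \<le> x \<and> x < \<delta> \<longrightarrow> (LINT t | lborel. indicator {x..T} t * (r (t - x) u - r t u)\<^sup>2) \<le> e"
proof -
  have b: "\<bar>r s u\<bar> \<le> 1" for s using r_bounds[OF u] by simp
  have m: "(\<lambda>(s, v). r s u) \<in> borel_measurable (borel \<Otimes>\<^sub>M (borel :: real measure))" by measurable
  have sq: "(l2norm I1 (\<lambda>v::real. c))\<^sup>2 = c\<^sup>2" for c by simp
  have i: "integrable (lebesgue_on {0..T}) (\<lambda>s. (l2norm I1 (\<lambda>v::real. r s u))\<^sup>2)"
    using Icc.sq_int_bounded[OF borel_lebesgue_on[OF r_section_measurable[of u], of "{0..T}"], of 1] b
    unfolding sq by (simp add: sq_int_def)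
  from translation_continuous[OF m sq_int_const i e T, unfolded sq] obtain \<delta> where \<delta>: "0 < \<delta>"
    "\<And>x. 0 \<le> x \<Longrightarrow> x < \<delta> \<Longrightarrow> (LINT t | lebesgue_on {x..T}. (r (t - x) u - r t u)\<^sup>2) \<le> e" by blast
  have "(LINT t | lebesgue_on {x..T}. (r (t - x) u - r t u)\<^sup>2) = (LINT t | lborel. indicator {x..T} t * (r (t - x) u - r t u)\<^sup>2)" for x
    by (intro integral_lebesgue_on_borel) measurable
  with \<delta> show ?thesis by (intro exI[of _ \<delta>]) auto
qed

text \<open>For small \<open>h\<close> and \<open>x \<le> h\<close> the integral of \<open>Z \<eta> (t - x) t\<close> over \<open>t\<close> is at most a small constant plus
  \<open>T * (1 + 2 * \<kappa> * \<eta>)\<close> minus the integral of \<open>N\<close> over \<open>[h, T - h]\<close>, by continuity of translations.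
  Dividing the averaged inequality by \<open>h\<close> gives the claim.\<close>

lemma averaged_bound:
  assumes \<eta>: "0 < \<eta>" and e: "0 < e"
  shows "\<exists>\<delta>>0. \<forall>h. 0 < h \<and> h < \<delta> \<longrightarrow> (LINT t | lborel. indicator {h..T - h} t * N t)
     \<le> 2 + T * (1 + 2 * \<kappa> * \<eta>) + e / 2 + \<kappa> / \<eta> * (2 * e)"
proof -
  let ?c = "1 + 2 * \<kappa> * \<eta>"
  have c: "0 \<le> ?c" using \<kappa> \<eta> by simp
  have Mm: "(\<lambda>t. M (t - x) t) \<in> borel_measurable borel" for x
    using measurable_compose[of "\<lambda>t. (t - x, t)" borel "borel \<Otimes>\<^sub>M borel", OF _ M_measurable] by simp
  have Di: "integrable (lebesgue_on {0..T}) (\<lambda>s. (l2norm I1 (D s))\<^sup>2)"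
    using l2norm_D_sq_int by (simp add: sq_int_def)
  from translation_continuous[OF D_measurable D_sq_int Di e T] obtain \<delta>1 where \<delta>1: "0 < \<delta>1"
    "\<And>x. 0 \<le> x \<Longrightarrow> x < \<delta>1 \<Longrightarrow> integrable (lebesgue_on {x..T}) (\<lambda>t. M (t - x) t)"
    "\<And>x. 0 \<le> x \<Longrightarrow> x < \<delta>1 \<Longrightarrow> (LINT t | lebesgue_on {x..T}. M (t - x) t) \<le> e"
    unfolding M_def by blast
  have Mi: "integrable lborel (\<lambda>t. indicator {x..T} t * M (t - x) t)"
    and Me: "(LINT t | lborel. indicator {x..T} t * M (t - x) t) \<le> e" if "0 \<le> x" "x < \<delta>1" for x
    using \<delta>1(2,3)[OF that] by (simp_all add: integrable_lebesgue_on_borel[OF Mm] integral_lebesgue_on_borel[OF Mm])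
  obtain \<delta>2 where \<delta>2: "0 < \<delta>2" "\<And>x. 0 \<le> x \<Longrightarrow> x < \<delta>2 \<Longrightarrow> (LINT t | lborel. indicator {x..T} t * (r (t - x) 0 - r t 0)\<^sup>2) \<le> e"
    using trace_translation[of 0 e] e by auto
  obtain \<delta>3 where \<delta>3: "0 < \<delta>3" "\<And>x. 0 \<le> x \<Longrightarrow> x < \<delta>3 \<Longrightarrow> (LINT t | lborel. indicator {x..T} t * (r (t - x) 1 - r t 1)\<^sup>2) \<le> e"
    using trace_translation[of 1 e] e by auto
  have ri: "integrable lborel (\<lambda>t. indicator {x..T} t * (r (t - x) u - r t u)\<^sup>2)" if u: "u \<in> {0..1}" for x u
  proof (rule indicator_times_integrable[where B = 1])
    show "\<bar>(r (t - x) u - r t u)\<^sup>2\<bar> \<le> 1" for t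
      using r_bounds[OF u, of t] r_bounds[OF u, of "t - x"] by (simp add: abs_square_le_1)
  qed measurable
  define \<delta> where "\<delta> = Min {\<delta>1, \<delta>2, \<delta>3, T}"
  have \<delta>: "0 < \<delta>" "\<delta> \<le> \<delta>1" "\<delta> \<le> \<delta>2" "\<delta> \<le> \<delta>3" "\<delta> \<le> T" unfolding \<delta>_def using \<delta>1(1) \<delta>2(1) \<delta>3(1) T by auto
  show ?thesis
  proof (intro exI[of _ \<delta>] conjI allI impI \<delta>(1))
    fix h assume h: "0 < h \<and> h < \<delta>"
    define J where "J = (LINT t | lborel. indicator {h..T - h} t * N t)"
    have Ji: "integrable lborel (\<lambda>t. indicator {h..T - h} t * N t)"
      using integrable_mult_indicator[OF _ N_integrable, of "{h..T - h}"] by simp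
    have inner: "(LINT t | lborel. indicator {h..T} t * Z \<eta> (t - x) t) \<le> T * ?c + e / 2 + \<kappa> / \<eta> * (2 * e) - J"
      if x: "x \<in> {0..h}" for x
    proof -
      \<comment> \<open>Off \<open>[h, T]\<close> this is nonnegative: as \<open>x \<le> h\<close>, both windows \<open>[h, T - h]\<close> for \<open>t\<close> and \<open>t - x\<close> lie inside \<open>[h, T]\<close>.\<close>
      define Y where "Y t = ?c * indicator {0..T} t + (1/2) * (indicator {x..T} t * M (t - x) t)
         + \<kappa> / \<eta> * (indicator {x..T} t * (r (t - x) 0 - r t 0)\<^sup>2 + indicator {x..T} t * (r (t - x) 1 - r t 1)\<^sup>2)
         - (1/2) * (indicator {h..T - h} (t - x) * N (t - x)) - (1/2) * (indicator {h..T - h} t * N t)" for t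
      have xs: "0 \<le> x" "x < \<delta>1" "x < \<delta>2" "x < \<delta>3" "x \<le> h" using x h \<delta> by auto
      have Js: "integrable lborel (\<lambda>t. indicator {h..T - h} (t - x) * N (t - x))"
        "(LINT t | lborel. indicator {h..T - h} (t - x) * N (t - x)) = J"
        using lborel_integrable_real_affine[OF Ji, of 1 "-x"]
          lborel_integral_real_affine[of 1 "\<lambda>s. indicator {h..T - h} s * N s" "-x"] by (simp_all add: J_def)
      note ints = Mi[OF xs(1,2)] ri[of 0 x] ri[of 1 x] Js(1) Ji indicator_Icc_integrable[of 0 T]
      have Yi: "integrable lborel Y"
        unfolding Y_def using ints
        by (intro Bochner_Integration.integrable_add Bochner_Integration.integrable_diff Bochner_Integration.integrable_mult_right) auto
      have "(LINT t | lborel. indicator {h..T} t * Z \<eta> (t - x) t) \<le> (LINT t | lborel. Y t)"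
      proof (rule integral_mono[OF _ Yi])
        show "integrable lborel (\<lambda>t. indicator {h..T} t * Z \<eta> (t - x) t)"
        proof (rule Bochner_Integration.integrable_bound)
          let ?K = "1 + 2 * \<kappa> * \<eta> + 2 * \<kappa> / \<eta>"
          show "integrable lborel (\<lambda>t. indicator {h..T} t * ?K + 2 * N (t - x) + 2 * N t)"
            by (intro Bochner_Integration.integrable_add Bochner_Integration.integrable_mult_left
                Bochner_Integration.integrable_mult_right indicator_Icc_integrable N_shift N_integrable)
          show "(\<lambda>t. indicator {h..T} t * Z \<eta> (t - x) t) \<in> borel_measurable lborel"
            using Z_measurable[of \<eta>] by measurable
          show "AE t in lborel. norm (indicator {h..T} t * Z \<eta> (t - x) t) \<le> norm (indicator {h..T} t * ?K + 2 * N (t - x) + 2 * N t)"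
          proof (rule AE_I2)
            fix t
            have "\<bar>indicator {h..T} t * Z \<eta> (t - x) t\<bar> \<le> indicator {h..T} t * ?K + 2 * N (t - x) + 2 * N t"
              using Z_bound[OF \<eta>, of "t - x" t] N_nonneg[of t] N_nonneg[of "t - x"] by (auto simp: indicator_def)
            then show "norm (indicator {h..T} t * Z \<eta> (t - x) t) \<le> norm (indicator {h..T} t * ?K + 2 * N (t - x) + 2 * N t)"
              unfolding real_norm_def by (rule order_trans[OF _ abs_ge_self])
          qed
        qed
        fix t
        have k: "0 \<le> \<kappa> / \<eta>" using \<kappa> \<eta> by simp
        show "indicator {h..T} t * Z \<eta> (t - x) t \<le> Y t"
        proof (cases "t \<in> {h..T}")
          case True
          then have "t \<in> {x..T}" "t \<in> {0..T}" using xs by auto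
          moreover have "indicator {h..T - h} (t - x) * N (t - x) \<le> N (t - x)" "indicator {h..T - h} t * N t \<le> N t"
            using N_nonneg by (auto simp: indicator_def)
          ultimately show ?thesis using True by (simp add: Y_def Z_def)
        next
          case False
          then have "t - x \<notin> {h..T - h}" "t \<notin> {h..T - h}" using xs h by auto
          moreover have "0 \<le> indicator {x..T} t * M (t - x) t" using M_nonneg by simp
          moreover have "0 \<le> \<kappa> / \<eta> * (indicator {x..T} t * (r (t - x) 0 - r t 0)\<^sup>2 + indicator {x..T} t * (r (t - x) 1 - r t 1)\<^sup>2)"
            using k by (intro mult_nonneg_nonneg add_nonneg_nonneg) auto
          moreover have "0 \<le> ?c * indicator {0..T} t" using c by (intro mult_nonneg_nonneg) auto
          ultimately show ?thesis using False by (simp add: Y_def)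
        qed
      qed
      also have "(LINT t | lborel. Y t) = ?c * T + (1/2) * (LINT t | lborel. indicator {x..T} t * M (t - x) t)
         + \<kappa> / \<eta> * ((LINT t | lborel. indicator {x..T} t * (r (t - x) 0 - r t 0)\<^sup>2) + (LINT t | lborel. indicator {x..T} t * (r (t - x) 1 - r t 1)\<^sup>2))
         - (1/2) * J - (1/2) * J"
      proof -
        have "(LINT t | lborel. ?c * indicator {0..T} t) = ?c * T" using T by simp
        then show ?thesis
          unfolding Y_def using ints Js(2) J_def
          by (subst Bochner_Integration.integral_diff Bochner_Integration.integral_add,
              (intro Bochner_Integration.integrable_add Bochner_Integration.integrable_diff Bochner_Integration.integrable_mult_right; simp),
              (intro Bochner_Integration.integrable_add Bochner_Integration.integrable_diff Bochner_Integration.integrable_mult_right; simp))+ simp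
      qed
      also have "\<dots> \<le> ?c * T + (1/2) * e + \<kappa> / \<eta> * (e + e) - (1/2) * J - (1/2) * J"
        using Me[OF xs(1,2)] \<delta>2(2)[OF xs(1,3)] \<delta>3(2)[OF xs(1,4)] \<kappa> \<eta>
        by (intro diff_right_mono add_mono mult_left_mono) auto
      finally show ?thesis by (simp add: mult.commute)
    qed
    let ?C = "T * ?c + e / 2 + \<kappa> / \<eta> * (2 * e) - J"
    have "- (2 * h) \<le> (LINT x | lborel. indicator {0..h} x * (LINT t | lborel. indicator {h..T} t * Z \<eta> (t - x) t))"
      using h \<delta> by (intro averaged_increment \<eta>) auto
    also have "\<dots> \<le> (LINT x | lborel. indicator {0..h} x * ?C)"
    proof (rule integral_mono)
      show "integrable lborel (\<lambda>x. indicator {0..h} x * (LINT t | lborel. indicator {h..T} t * Z \<eta> (t - x) t))"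
        using lborel_pair.integrable_fst[OF Z_pair_integrable[OF \<eta>, of h]] by simp
      show "integrable lborel (\<lambda>x. indicator {0..h} x * ?C)"
        by (intro Bochner_Integration.integrable_mult_left indicator_Icc_integrable)
      show "indicator {0..h} x * (LINT t | lborel. indicator {h..T} t * Z \<eta> (t - x) t) \<le> indicator {0..h} x * ?C" for x
        using inner[of x] by (auto simp: indicator_def)
    qed
    also have "\<dots> = h * ?C" using h by simp
    finally have "0 \<le> h * (?C + 2)" by (simp add: algebra_simps)
    then have "0 \<le> ?C + 2" using h by (simp add: zero_le_mult_iff)
    then show "(LINT t | lborel. indicator {h..T - h} t * N t) \<le> 2 + T * ?c + e / 2 + \<kappa> / \<eta> * (2 * e)"
      unfolding J_def[symmetric] by linarith
  qed
qed

lemma approximate_energy_bound: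
  assumes \<eta>: "0 < \<eta>" and e: "0 < e"
  shows "(LINT t | lborel. N t) \<le> 2 + T * (1 + 2 * \<kappa> * \<eta>) + e / 2 + \<kappa> / \<eta> * (2 * e)"
proof -
  obtain \<delta> where \<delta>: "0 < \<delta>" and b: "\<And>h. 0 < h \<Longrightarrow> h < \<delta> \<Longrightarrow> (LINT t | lborel. indicator {h..T - h} t * N t)
     \<le> 2 + T * (1 + 2 * \<kappa> * \<eta>) + e / 2 + \<kappa> / \<eta> * (2 * e)"
    using averaged_bound[OF assms] by blast
  define h where "h n = \<delta> / (real n + 2)" for n
  have h: "0 < h n" "h n < \<delta>" for n using \<delta> by (auto simp: h_def divide_less_eq)
  have h0: "h \<longlonglongrightarrow> 0"
    using LIMSEQ_ignore_initial_segment[OF lim_const_over_n[of \<delta>], of 2] by (simp add: h_def[abs_def] add.commute)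
  have "(\<lambda>n. LINT t | lborel. indicator {h n..T - h n} t * N t) \<longlonglongrightarrow> (LINT t | lborel. N t)"
  proof (rule integral_dominated_convergence[where w = N])
    have "AE t in lborel. t \<notin> {0, T}" by (intro AE_not_in) (auto intro: finite_imp_null_set_lborel)
    then show "AE t in lborel. (\<lambda>n. indicator {h n..T - h n} t * N t) \<longlonglongrightarrow> N t"
    proof eventually_elim
      case (elim t)
      show ?case
      proof (cases "t \<in> {0..T}")
        case True
        with elim have t: "0 < t" "0 < T - t" by auto
        have "\<forall>\<^sub>F n in sequentially. h n < min t (T - t)"
          using order_tendstoD(2)[OF h0, of "min t (T - t)"] t by simp
        then have "\<forall>\<^sub>F n in sequentially. indicator {h n..T - h n} t * N t = N t"
          by eventually_elim (auto simp: indicator_def)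
        then show ?thesis by (rule tendsto_eventually)
      next
        case False
        then have "N t = 0" using D_outside[of t] by (simp add: N_def l2norm_def)
        then show ?thesis by simp
      qed
    qed
    show "AE t in lborel. norm (indicator {h n..T - h n} t * N t) \<le> N t" for n
      using N_nonneg by (intro AE_I2) (auto simp: indicator_def)
  qed (use N_integrable in measurable)
  then show ?thesis
    by (rule LIMSEQ_le_const2) (use b h in blast)
qed

text \<open>The choice \<open>e = \<eta>\<^sup>2\<close> makes all error terms of order \<open>\<eta>\<close>. The factor \<open>\<kappa>\<close> occurs in these error terms
  only, so that the bound in the limit does not depend on it.\<close>

lemma energy_bound: "(LINT t | lborel. (l2norm I1 (D t))\<^sup>2) \<le> 2 + T"
proof -
  define K where "K = 2 * \<kappa> * T + 1 / 2 + 2 * \<kappa>"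
  have K: "0 < K" using \<kappa> T by (simp add: K_def add_pos_pos)
  have "(LINT t | lborel. N t) \<le> (2 + T) + \<epsilon>" if \<epsilon>: "0 < \<epsilon>" for \<epsilon>
  proof -
    define \<eta> where "\<eta> = min 1 (\<epsilon> / K)"
    have \<eta>: "0 < \<eta>" "\<eta> \<le> 1" "\<eta> * K \<le> \<epsilon>" using \<epsilon> K by (auto simp: \<eta>_def min_def field_simps)
    have "(LINT t | lborel. N t) \<le> 2 + T * (1 + 2 * \<kappa> * \<eta>) + \<eta>\<^sup>2 / 2 + \<kappa> / \<eta> * (2 * \<eta>\<^sup>2)"
      using \<eta> by (intro approximate_energy_bound) auto
    also have "\<dots> = 2 + T + \<eta> * (2 * \<kappa> * T) + \<eta>\<^sup>2 / 2 + \<eta> * (2 * \<kappa>)"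
      using \<eta>(1) by (simp add: power2_eq_square algebra_simps)
    also have "\<eta>\<^sup>2 / 2 \<le> \<eta> * (1 / 2)" using \<eta> by (simp add: power2_eq_square)
    finally show ?thesis using \<eta>(3) by (simp add: K_def algebra_simps)
  qed
  then show ?thesis unfolding N_def by (rule field_le_epsilon)
qed

end

section \<open>Integrals of almost everywhere equal functions\<close>

lemma LINT_cong_AE_lebesgue_on:
  fixes f g :: "real \<Rightarrow> real"
  assumes "g \<in> borel_measurable (lebesgue_on {b..c})" "AE s in lebesgue_on {b..c}. f s = g s"
  shows "(LINT s | lebesgue_on {b..c}. f s) = (LINT s | lebesgue_on {b..c}. g s)"
    and "integrable (lebesgue_on {b..c}) f \<longleftrightarrow> integrable (lebesgue_on {b..c}) g"
proof -
  have "AE s in lebesgue_on {b..c}. g s = f s" using assms(2) by eventually_elim simp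
  from measurable_cong_AE_lebesgue_on[OF assms(1) this]
  have "f \<in> borel_measurable (lebesgue_on {b..c})" .
  then show "(LINT s | lebesgue_on {b..c}. f s) = (LINT s | lebesgue_on {b..c}. g s)"
    "integrable (lebesgue_on {b..c}) f \<longleftrightarrow> integrable (lebesgue_on {b..c}) g"
    using assms by (rule integral_cong_AE, rule integrable_cong_AE)
qed

lemma integrable_bounded_borel:
  fixes f :: "real \<Rightarrow> real"
  assumes "f \<in> borel_measurable borel" "\<And>s. \<bar>f s\<bar> \<le> B"
  shows "integrable (lebesgue_on {b..c}) f"
  using Icc.sq_int_integrable[OF Icc.sq_int_bounded[OF borel_lebesgue_on[OF assms(1)], of B]] assms(2) by simp

section \<open>Time-independent test functions\<close>

lemma vector_derivative_Icc:
  fixes f :: "real \<Rightarrow> real"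
  assumes "a < b" "x \<in> {a..b}" "(f has_vector_derivative f') (at x within {a..b})"
  shows "vector_derivative f (at x within {a..b}) = f'"
  using vector_derivative_within_cbox[of a b x f f'] assms by simp

lemma du_eqI:
  assumes "u \<in> {0..1}" "(H s has_vector_derivative f') (at u within {0..1})"
  shows "du H s u = f'"
  unfolding du_def using assms by (intro vector_derivative_Icc) auto

lemma du_time_independent:
  assumes "smooth \<phi>" "u \<in> {0..1}"
  shows "du (\<lambda>s. \<phi>) s u = deriv \<phi> u" "du (du (\<lambda>s. \<phi>)) s u = deriv (deriv \<phi>) u"
proof -
  have 1: "du (\<lambda>s. \<phi>) s v = deriv \<phi> v" if "v \<in> {0..1}" for v
    using that smooth_vector_derivative[OF assms(1)] by (intro du_eqI)
  then show "du (\<lambda>s. \<phi>) s u = deriv \<phi> u" using assms by simp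
  have "(du (\<lambda>s. \<phi>) s has_vector_derivative deriv (deriv \<phi>) u) (at u within {0..1})"
    by (rule has_vector_derivative_transform[OF assms(2) _ smooth_vector_derivative[OF smooth_deriv[OF assms(1)]]])
      (use 1 in auto)
  then show "du (du (\<lambda>s. \<phi>)) s u = deriv (deriv \<phi>) u" using assms by (intro du_eqI)
qed

lemma dt_time_independent:
  assumes "0 < T" "s \<in> {0..T}" shows "dt T (\<lambda>s. \<phi>) s u = 0"
  unfolding dt_def using assms by (intro vector_derivative_Icc has_vector_derivative_const)

lemma continuous_on_snd_rect:
  assumes "continuous_on {0..1} f" "\<And>s u. s \<in> {0..T} \<Longrightarrow> u \<in> {0..1} \<Longrightarrow> h s u = f u"
  shows "continuous_on ({0..T} \<times> {0..1}) (\<lambda>(s, u). h s u)"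
proof -
  have "continuous_on ({0..T} \<times> {0..1}) (\<lambda>p. f (snd p))"
    by (intro continuous_on_compose2[OF assms(1)] continuous_intros) auto
  then show ?thesis by (rule continuous_on_eq) (use assms(2) in auto)
qed

lemma time_independent_Cnp:
  assumes \<phi>: "smooth \<phi>" and T: "0 < T"
  shows "(\<lambda>s. \<phi>) \<in> Cnp 1 2 T"
proof -
  note c = smooth_continuous[OF \<phi>] smooth_continuous[OF smooth_deriv[OF \<phi>]] smooth_continuous[OF smooth_deriv[OF smooth_deriv[OF \<phi>]]]
  have t: "continuous_on ({0..T} \<times> {0..1}) (\<lambda>(s, u). (dt T ^^ j) (\<lambda>s. \<phi>) s u)" if j: "j \<le> 1" for j
  proof -
    consider "j = 0" | "j = 1" using j by (cases j) auto
    then show ?thesis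
    proof cases
      case 1 then show ?thesis by (intro continuous_on_snd_rect[OF c(1)]) simp
    next
      case 2 then show ?thesis
        by (intro continuous_on_snd_rect[OF continuous_on_const[of _ 0]]) (simp add: dt_time_independent[OF T])
    qed
  qed
  have x: "continuous_on ({0..T} \<times> {0..1}) (\<lambda>(s, u). (du ^^ k) (\<lambda>s. \<phi>) s u)" if k: "k \<le> 2" for k
  proof -
    consider "k = 0" | "k = 1" | "k = 2" using k by (auto simp: le_Suc_eq numeral_2_eq_2)
    then show ?thesis
    proof cases
      case 1 then show ?thesis by (intro continuous_on_snd_rect[OF c(1)]) simp
    next
      case 2 then show ?thesis by (intro continuous_on_snd_rect[OF c(2)]) (simp add: du_time_independent[OF \<phi>])
    next
      case 3 then show ?thesis by (intro continuous_on_snd_rect[OF c(3)]) (simp add: numeral_2_eq_2 du_time_independent[OF \<phi>])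
    qed
  qed
  have dx: "(du ^^ k) (\<lambda>s. \<phi>) s differentiable (at u within {0..1})" if k: "k < 2" and u: "u \<in> {0..1}" for k s u
  proof -
    consider "k = 0" | "k = 1" using k by (auto simp: less_Suc_eq numeral_2_eq_2)
    then show ?thesis
    proof cases
      case 1 then show ?thesis using differentiableI_vector[OF smooth_vector_derivative[OF \<phi>]] by simp
    next
      case 2
      have "(du (\<lambda>s. \<phi>) s has_vector_derivative deriv (deriv \<phi>) u) (at u within {0..1})"
        by (rule has_vector_derivative_transform[OF u _ smooth_vector_derivative[OF smooth_deriv[OF \<phi>]]])
          (simp add: du_time_independent[OF \<phi>])
      then show ?thesis using 2 differentiableI_vector by simp
    qed
  qed
  show ?thesis unfolding Cnp_def using t x dx by auto
qed

section \<open>The trajectory of a weak solution\<close>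

lemma continuous_AE_eq_unit:
  fixes f g :: "real \<Rightarrow> real"
  assumes f: "continuous_on {0..1} f" and g: "continuous_on {0..1} g"
    and ae: "AE u in I1. f u = g u" and u: "u \<in> {0..1}"
  shows "f u = g u"
proof -
  have sub: "{0<..<1::real} \<subseteq> {0..1}" by auto
  \<comment> \<open>The end points follow by continuity.\<close>
  have eq: "f v = g v" if "v \<in> {0<..<1}" for v
    by (rule continuous_eq_AE_open_unit[OF continuous_on_subset[OF f sub] continuous_on_subset[OF g sub] ae that])
  have "continuous_on (closure {0<..<1}) (\<lambda>v. f v - g v)"
    using f g by (simp add: continuous_on_diff)
  then have "f u - g u = 0"
    by (rule continuous_constant_on_closure) (use eq u in simp_all)
  then show ?thesis by simp
qed

text \<open>Bounds that hold almost everywhere hold everywhere for the continuous representative, including the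
  end points.\<close>

lemma H1_rep_range:
  assumes r: "H1_rep \<phi> c w" and \<phi>: "\<And>u. u \<in> {0..1} \<Longrightarrow> \<phi> u \<in> {0..1}" and u: "u \<in> {0..1}"
  shows "prim c w u \<in> {0..1}"
proof -
  have cont: "continuous_on {0..1} (prim c w)" using r by (intro prim_continuous) (simp add: H1_rep_def)
  have "AE v in I1. v \<in> {0..1}" by (rule AE_I2) simp
  moreover have "AE v in I1. \<phi> v = prim c w v" using r by (simp add: H1_rep_def)
  ultimately have "AE v in I1. prim c w v = max 0 (min 1 (prim c w v))"
  proof eventually_elim
    case (elim v)
    then show ?case using \<phi>[of v] by simp
  qed
  then have "prim c w u = max 0 (min 1 (prim c w u))"
    by (intro continuous_AE_eq_unit[OF cont _ _ u] continuous_intros cont)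
  then show ?thesis by auto
qed

text \<open>\<open>\<xi>\<close> is the solution with boundary values redefined through those of its \<open>m\<close>-th power; at times of
  \<open>G\<close> these are the boundary values of \<open>r\<close>.\<close>

locale traced_trajectory = porous_trajectory +
  fixes \<xi> :: "real \<Rightarrow> real \<Rightarrow> real"
  assumes G_subset: "G \<subseteq> {0..T}"
    and \<xi>_0: "\<And>s. s \<in> G \<Longrightarrow> \<xi> s 0 = root m (prim (a s) (D s) 0)"
    and \<xi>_1: "\<And>s. s \<in> G \<Longrightarrow> \<xi> s 1 = root m (prim (a s) (D s) 1)"
    and \<xi>_interior: "\<And>s. s \<in> G \<Longrightarrow> AE u in I1. \<xi> s u ^ m = prim (a s) (D s) u"

text \<open>For a test function without time dependence \<open>\<rho> * \<rho> ^ (m - 1) = \<rho> ^ m\<close> makes the equation linear in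
  the continuous representative, and one integration by parts in space yields the flux.\<close>

lemma weak_solution_increment:
  fixes \<alpha> \<beta> T \<kappa> :: real and m :: nat and a D
  assumes T: "0 < T" and m: "1 \<le> m" and \<alpha>: "\<alpha> \<in> {0<..<1}" and \<beta>: "\<beta> \<in> {0<..<1}"
    and sol: "robin_weak_solution \<alpha> \<beta> m T g \<kappa> \<rho>"
    and am: "a \<in> borel_measurable borel" and Dm: "(\<lambda>(s, u). D s u) \<in> borel_measurable (borel \<Otimes>\<^sub>M borel)"
    and Gae: "AE s in lborel. s \<in> {0..T} \<longrightarrow> s \<in> G"
    and rep: "\<And>s. s \<in> G \<Longrightarrow> H1_rep (\<lambda>u. \<rho> s u ^ m) (a s) (D s)"
    and b0: "\<And>s. s \<in> G \<Longrightarrow> bdry_ext m \<rho> s 0 = root m (prim (a s) (D s) 0)"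
    and b1: "\<And>s. s \<in> G \<Longrightarrow> bdry_ext m \<rho> s 1 = root m (prim (a s) (D s) 1)"
    and Ds: "\<And>s. sq_int I1 (D s)" and Fb: "\<And>s u. u \<in> {0..1} \<Longrightarrow> prim (a s) (D s) u \<in> {0..1}"
    and \<phi>: "smooth \<phi>" and t: "t \<in> {0..T}"
  shows "integrable (lebesgue_on {0..t}) (\<lambda>s. robin_flux \<kappa> \<alpha> \<beta> (root m (prim (a s) (D s) 0)) (root m (prim (a s) (D s) 1))
         (D s) (deriv \<phi>) (\<phi> 0) (\<phi> 1))"
    and "ip (\<rho> t) \<phi> - ip g \<phi> =
      (LINT s | lebesgue_on {0..t}. robin_flux \<kappa> \<alpha> \<beta> (root m (prim (a s) (D s) 0)) (root m (prim (a s) (D s) 1))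
         (D s) (deriv \<phi>) (\<phi> 0) (\<phi> 1))"
proof -
  let ?J = "lebesgue_on {0..t}"
  let ?F = "\<lambda>s. prim (a s) (D s)"
  let ?r = "\<lambda>s u. root m (?F s u)"
  note [measurable] = am Dm
  note c = smooth_continuous[OF \<phi>] smooth_continuous[OF smooth_deriv[OF \<phi>]] smooth_continuous[OF smooth_deriv[OF smooth_deriv[OF \<phi>]]]
  have bm: "deriv (deriv \<phi>) \<in> borel_measurable borel" by (rule borel_measurable_continuous_onI[OF c(3)])
  have Fm [measurable]: "(\<lambda>(s, u). ?F s u) \<in> borel_measurable (borel \<Otimes>\<^sub>M borel)" by (rule borel_measurable_prim) measurable
  have Fu [measurable]: "(\<lambda>s. ?F s u) \<in> borel_measurable borel" for u
    using measurable_Pair1[OF Fm, of u] by simp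
  have GJ: "AE s in ?J. s \<in> G"
    unfolding AE_lebesgue_on_lborel[OF borel_closed[OF closed_atLeastAtMost]]
    using Gae by eventually_elim (use t in auto)
  define A1 where "A1 s = ip (?F s) (deriv (deriv \<phi>))" for s
  define A2 where "A2 s = ?F s 1 * deriv \<phi> 1 - ?F s 0 * deriv \<phi> 0" for s
  define A3 where "A3 s = \<phi> 0 * (\<alpha> - ?r s 0) + \<phi> 1 * (\<beta> - ?r s 1)" for s
  have A1m: "A1 \<in> borel_measurable borel" unfolding A1_def by (rule borel_measurable_ip) (use bm in measurable)
  have A2m: "A2 \<in> borel_measurable borel" and A3m: "A3 \<in> borel_measurable borel" unfolding A2_def A3_def by measurable
  have Fs: "sq_int I1 (?F s)" for s by (rule prim_sq_int[OF Ds])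
  have "l2norm I1 (?F s) \<le> 1" for s
  proof (rule power2_le_imp_le)
    have "(l2norm I1 (?F s))\<^sup>2 \<le> (LINT u | I1. 1)"
      unfolding l2norm_sq
      by (rule integral_mono) (use Fs[of s] Fb[of _ s] in \<open>auto simp: sq_int_def abs_square_le_1\<close>)
    then show "(l2norm I1 (?F s))\<^sup>2 \<le> 1\<^sup>2" by simp
  qed simp
  then have A1b: "\<bar>A1 s\<bar> \<le> l2norm I1 (deriv (deriv \<phi>))" for s
    unfolding A1_def using ip_CS[OF Fs[of s] continuous_sq_int[OF c(3)]] mult_right_mono[of "l2norm I1 (?F s)" 1 "l2norm I1 (deriv (deriv \<phi>))"] 
    by (simp add: order_trans)
  have A2b: "\<bar>A2 s\<bar> \<le> \<bar>deriv \<phi> 1\<bar> + \<bar>deriv \<phi> 0\<bar>" for s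
  proof -
    have "\<bar>?F s 1 * deriv \<phi> 1\<bar> \<le> \<bar>deriv \<phi> 1\<bar>" "\<bar>?F s 0 * deriv \<phi> 0\<bar> \<le> \<bar>deriv \<phi> 0\<bar>"
      using Fb[of 1 s] Fb[of 0 s] by (auto simp: abs_mult mult_left_le_one_le)
    then show ?thesis unfolding A2_def by linarith
  qed
  have A3b: "\<bar>A3 s\<bar> \<le> \<bar>\<phi> 0\<bar> + \<bar>\<phi> 1\<bar>" for s
  proof -
    have "?r s 0 \<in> {0..1}" "?r s 1 \<in> {0..1}" using Fb[of 1 s] Fb[of 0 s] m by auto
    then have "\<bar>\<alpha> - ?r s 0\<bar> \<le> 1" "\<bar>\<beta> - ?r s 1\<bar> \<le> 1" using \<alpha> \<beta> by auto
    then have "\<bar>\<phi> 0 * (\<alpha> - ?r s 0)\<bar> \<le> \<bar>\<phi> 0\<bar>" "\<bar>\<phi> 1 * (\<beta> - ?r s 1)\<bar> \<le> \<bar>\<phi> 1\<bar>"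
      by (auto simp: abs_mult mult_left_le)
    then show ?thesis unfolding A3_def by linarith
  qed
  have int: "integrable ?J A1" "integrable ?J A2" "integrable ?J A3"
    using integrable_bounded_borel[OF A1m A1b] integrable_bounded_borel[OF A2m A2b] integrable_bounded_borel[OF A3m A3b] by auto
  have flux: "robin_flux \<kappa> \<alpha> \<beta> (?r s 0) (?r s 1) (D s) (deriv \<phi>) (\<phi> 0) (\<phi> 1) = A1 s - A2 s + \<kappa> * A3 s" for s
  proof -
    have "A1 s = ?F s 1 * deriv \<phi> 1 - a s * deriv \<phi> 0 - ip (D s) (deriv \<phi>)"
      unfolding A1_def by (intro prim_by_parts[OF Ds] smooth_vector_derivative[OF smooth_deriv[OF \<phi>]] c)
    then show ?thesis by (simp add: robin_flux_def A2_def A3_def)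
  qed
  show "integrable ?J (\<lambda>s. robin_flux \<kappa> \<alpha> \<beta> (?r s 0) (?r s 1) (D s) (deriv \<phi>) (\<phi> 0) (\<phi> 1))"
    unfolding flux using int by simp
  have e1: "(LINT s | ?J. ip (\<rho> s) (\<lambda>u. dt T (\<lambda>s. \<phi>) s u + \<rho> s u ^ (m - 1) * du (du (\<lambda>s. \<phi>)) s u)) = (LINT s | ?J. A1 s)"
  proof (rule LINT_cong_AE_lebesgue_on(1)[OF borel_lebesgue_on[OF A1m]])
    have "AE s in ?J. s \<in> {0..t}" by (rule AE_I2) simp
    with GJ show "AE s in ?J. ip (\<rho> s) (\<lambda>u. dt T (\<lambda>s. \<phi>) s u + \<rho> s u ^ (m - 1) * du (du (\<lambda>s. \<phi>)) s u) = A1 s"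
    proof eventually_elim
      case (elim s)
      have pw: "x * x ^ (m - 1) = x ^ m" for x :: real using m by (simp flip: power_Suc)
      have "ip (\<rho> s) (\<lambda>u. dt T (\<lambda>s. \<phi>) s u + \<rho> s u ^ (m - 1) * du (du (\<lambda>s. \<phi>)) s u) = ip (\<lambda>u. \<rho> s u ^ m) (deriv (deriv \<phi>))"
        unfolding ip_def
      proof (rule Bochner_Integration.integral_cong[OF refl])
        fix u assume "u \<in> space I1"
        then have u: "u \<in> {0..1}" by simp
        have "dt T (\<lambda>s. \<phi>) s u = 0" using elim(2) t by (intro dt_time_independent T) auto
        then show "\<rho> s u * (dt T (\<lambda>s. \<phi>) s u + \<rho> s u ^ (m - 1) * du (du (\<lambda>s. \<phi>)) s u) = \<rho> s u ^ m * deriv (deriv \<phi>) u"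
          using pw[of "\<rho> s u"] du_time_independent(2)[OF \<phi> u, of s] by (simp add: mult.assoc[symmetric])
      qed
      also have "\<dots> = A1 s"
        unfolding A1_def
      proof (rule ip_cong_AE)
        show "(\<lambda>u. \<rho> s u ^ m) \<in> borel_measurable I1" using H1_rep_sq_int[OF rep[OF elim(1)]] by (simp add: sq_int_def)
        show "AE u in I1. \<rho> s u ^ m = ?F s u" using rep[OF elim(1)] by (simp add: H1_rep_def)
      qed (use Fs bm borel_lebesgue_on in \<open>auto simp: sq_int_def\<close>)
      finally show ?case .
    qed
  qed
  have e2: "(LINT s | ?J. bdry_ext m \<rho> s 1 ^ m * du (\<lambda>s. \<phi>) s 1 - bdry_ext m \<rho> s 0 ^ m * du (\<lambda>s. \<phi>) s 0) = (LINT s | ?J. A2 s)"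
  proof (rule LINT_cong_AE_lebesgue_on(1)[OF borel_lebesgue_on[OF A2m]])
    have rp: "?r s u ^ m = ?F s u" if "u \<in> {0..1}" for s u using Fb[OF that, of s] m by simp
    show "AE s in ?J. bdry_ext m \<rho> s 1 ^ m * du (\<lambda>s. \<phi>) s 1 - bdry_ext m \<rho> s 0 ^ m * du (\<lambda>s. \<phi>) s 0 = A2 s"
      using GJ
    proof eventually_elim
      case (elim s)
      show ?case unfolding b0[OF elim] b1[OF elim] A2_def
        using rp[of 0 s] rp[of 1 s] du_time_independent(1)[OF \<phi>, of 0 s] du_time_independent(1)[OF \<phi>, of 1 s] by simp
    qed
  qed
  have e3: "(LINT s | ?J. \<phi> 0 * (\<alpha> - bdry_ext m \<rho> s 0) + \<phi> 1 * (\<beta> - bdry_ext m \<rho> s 1)) = (LINT s | ?J. A3 s)"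
    by (rule LINT_cong_AE_lebesgue_on(1)[OF borel_lebesgue_on[OF A3m]])
      (use GJ in \<open>eventually_elim, simp only: b0 b1 A3_def\<close>)
  have e4: "ip (\<rho> t) \<phi> - ip g \<phi>
        - (LINT s | ?J. ip (\<rho> s) (\<lambda>u. dt T (\<lambda>s. \<phi>) s u + \<rho> s u ^ (m - 1) * du (du (\<lambda>s. \<phi>)) s u))
        + (LINT s | ?J. bdry_ext m \<rho> s 1 ^ m * du (\<lambda>s. \<phi>) s 1 - bdry_ext m \<rho> s 0 ^ m * du (\<lambda>s. \<phi>) s 0)
        - \<kappa> * (LINT s | ?J. \<phi> 0 * (\<alpha> - bdry_ext m \<rho> s 0) + \<phi> 1 * (\<beta> - bdry_ext m \<rho> s 1)) = 0"
    using sol t time_independent_Cnp[OF \<phi> T] unfolding robin_weak_solution_def by fast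
  have "ip (\<rho> t) \<phi> - ip g \<phi> = (LINT s | ?J. A1 s) - (LINT s | ?J. A2 s) + \<kappa> * (LINT s | ?J. A3 s)"
    using e4 unfolding e1 e2 e3 by linarith
  also have "\<dots> = (LINT s | ?J. A1 s - A2 s + \<kappa> * A3 s)" using int by simp
  finally show "ip (\<rho> t) \<phi> - ip g \<phi> =
      (LINT s | ?J. robin_flux \<kappa> \<alpha> \<beta> (?r s 0) (?r s 1) (D s) (deriv \<phi>) (\<phi> 0) (\<phi> 1))"
    unfolding flux .
qed

text \<open>The increment of the equation from \<open>t1\<close> to \<open>t2\<close> no longer contains the initial datum. Values off
  \<open>G\<close> are zero, which satisfies the bounds required at all times.\<close>

lemma weak_solution_trajectory:
  assumes T: "0 < T" and m: "1 \<le> m" and \<alpha>: "\<alpha> \<in> {0<..<1}" and \<beta>: "\<beta> \<in> {0<..<1}" and \<kappa>: "0 < \<kappa>"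
    and sol: "robin_weak_solution \<alpha> \<beta> m T g \<kappa> \<rho>"
  obtains a D G where "traced_trajectory T \<kappa> \<alpha> \<beta> m a D G (bdry_ext m \<rho>)"
    "\<And>s. s \<in> G \<Longrightarrow> H1_rep (\<lambda>u. \<rho> s u ^ m) (a s) (D s)"
proof -
  have L: "(\<lambda>s u. \<rho> s u ^ m) \<in> L2H1 T" and \<rho>01: "\<And>s u. s \<in> {0..T} \<Longrightarrow> u \<in> {0..1} \<Longrightarrow> \<rho> s u \<in> {0..1}"
    and \<rho>m: "\<And>s. s \<in> {0..T} \<Longrightarrow> \<rho> s \<in> borel_measurable I1"
    using sol unfolding robin_weak_solution_def by blast+
  from measurable_representation[OF L] obtain a D G where
    am: "a \<in> borel_measurable borel" and Dm: "(\<lambda>(s, u). D s u) \<in> borel_measurable (borel \<Otimes>\<^sub>M borel)" and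
    Gb: "G \<in> sets borel" and Gs: "G \<subseteq> {0..T}" and Gae: "AE s in lborel. s \<in> {0..T} \<longrightarrow> s \<in> G" and
    rep: "\<And>s. s \<in> G \<Longrightarrow> H1_rep (\<lambda>u. \<rho> s u ^ m) (a s) (D s)" and
    a0: "\<And>s. s \<notin> G \<Longrightarrow> a s = 0" and D0: "\<And>s u. s \<notin> G \<Longrightarrow> D s u = 0" and
    Di: "integrable lborel (\<lambda>s. (l2norm I1 (D s))\<^sup>2)" by blast
  have b: "bdry_ext m \<rho> s u = root m (prim (a s) (D s) u)" if "s \<in> G" "u \<in> {0, 1}" for s u
    unfolding bdry_ext_def using H1_rep_value[OF rep[OF that(1)] that(2)] H1_rep_H1[OF rep[OF that(1)]] that(2) by simp
  have Ds: "sq_int I1 (D s)" for s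
  proof (cases "s \<in> G")
    case True then show ?thesis using rep by (simp add: H1_rep_def)
  next
    case False then have "D s = (\<lambda>_. 0)" using D0 by auto
    then show ?thesis using sq_int_const[of 0] by simp
  qed
  have Fb: "prim (a s) (D s) u \<in> {0..1}" if u: "u \<in> {0..1}" for s u
  proof (cases "s \<in> G")
    case True
    show ?thesis
    proof (rule H1_rep_range[OF rep[OF True] _ u])
      show "\<rho> s v ^ m \<in> {0..1}" if "v \<in> {0..1}" for v
      proof -
        have "0 \<le> \<rho> s v" "\<rho> s v \<le> 1" using \<rho>01[of s v] True Gs that by auto
        then show ?thesis by (simp add: power_le_one)
      qed
    qed
  next
    case False then have "D s = (\<lambda>_. 0)" using D0 by auto
    then show ?thesis using a0[OF False] prim_const[OF u, of 0 0] by simp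
  qed
  note inc = weak_solution_increment[OF T m \<alpha> \<beta> sol am Dm Gae rep b b Ds Fb]
  have \<rho>r: "AE u in I1. \<rho> s u = root m (prim (a s) (D s) u)" if s: "s \<in> G" for s
  proof -
    have "AE u in I1. u \<in> {0..1}" by (rule AE_I2) simp
    moreover have "AE u in I1. \<rho> s u ^ m = prim (a s) (D s) u" using rep[OF s] by (simp add: H1_rep_def)
    ultimately show ?thesis
    proof eventually_elim
      case (elim u)
      have "0 \<le> \<rho> s u" using \<rho>01[of s u] elim(1) s Gs by auto
      then have "root m (\<rho> s u ^ m) = \<rho> s u" using m by (intro real_root_power_cancel) auto
      then show ?case using elim(2) by simp
    qed
  qed
  have ip\<rho>: "ip (\<lambda>u. root m (prim (a s) (D s) u)) \<phi> = ip (\<rho> s) \<phi>" if s: "s \<in> G" and \<phi>: "smooth \<phi>" for s \<phi>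
  proof (rule ip_cong_AE)
    show "\<rho> s \<in> borel_measurable I1" using \<rho>m s Gs by auto
    then show "(\<lambda>u. root m (prim (a s) (D s) u)) \<in> borel_measurable I1"
      by (rule measurable_cong_AE_lebesgue_on[OF _ \<rho>r[OF s]])
    show "AE u in I1. root m (prim (a s) (D s) u) = \<rho> s u" using \<rho>r[OF s] by eventually_elim simp
  qed (use smooth_continuous[OF \<phi>] in auto)
  have D1: "D s u = 0" if "s \<notin> {0..T}" for s u using that D0[of s u] Gs by blast
  have "traced_trajectory T \<kappa> \<alpha> \<beta> m a D G (bdry_ext m \<rho>)"
  proof
    fix t1 t2 \<phi> assume t: "t1 \<in> G" "t2 \<in> G" "t1 \<le> t2" and \<phi>: "smooth \<phi>"
    let ?f = "\<lambda>s. robin_flux \<kappa> \<alpha> \<beta> (root m (prim (a s) (D s) 0)) (root m (prim (a s) (D s) 1)) (D s) (deriv \<phi>) (\<phi> 0) (\<phi> 1)"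
    have tt: "t1 \<in> {0..T}" "t2 \<in> {0..T}" using t Gs by auto
    have "(LINT s | lebesgue_on {0..t2}. ?f s) = (LINT s | lebesgue_on {0..t1}. ?f s) + (LINT s | lebesgue_on {t1..t2}. ?f s)"
      by (rule Equivalence_Measurable_On_Borel.integral_combine[OF inc(1)[OF _ _ _ _ _ _ \<phi> tt(2)]]) (use t tt in auto)
    then show "ip (\<lambda>u. root m (prim (a t2) (D t2) u)) \<phi> - ip (\<lambda>u. root m (prim (a t1) (D t1) u)) \<phi> = (LINT s | lebesgue_on {t1..t2}. ?f s)"
      using inc(2)[OF _ _ _ _ _ _ \<phi> tt(1)] inc(2)[OF _ _ _ _ _ _ \<phi> tt(2)] ip\<rho>[OF t(1) \<phi>] ip\<rho>[OF t(2) \<phi>] by simp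
  next
    fix s assume s: "s \<in> G"
    have "AE u in lebesgue. u \<notin> {0, 1::real}" by (intro AE_not_in) (auto simp flip: negligible_iff_null_sets)
    then have "AE u in I1. u \<notin> {0, 1::real}" unfolding AE_lebesgue_on_Icc by eventually_elim auto
    moreover have "AE u in I1. \<rho> s u ^ m = prim (a s) (D s) u" using rep[OF s] by (simp add: H1_rep_def)
    ultimately show "AE u in I1. bdry_ext m \<rho> s u ^ m = prim (a s) (D s) u"
      by eventually_elim (simp add: bdry_ext_def)
  qed (use T \<kappa> \<alpha> \<beta> m am Dm Gb Gae Ds D1 Di Fb Gs b in auto)
  then show ?thesis using rep by (rule that)
qed

section \<open>Test functions that depend on time\<close>

lemma Cnp_0_1D:
  assumes "H \<in> Cnp 0 1 T"
  shows "continuous_on ({0..T} \<times> {0..1}) (\<lambda>(s, u). H s u)"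
    and "\<And>s u. s \<in> {0..T} \<Longrightarrow> u \<in> {0..1} \<Longrightarrow> (H s has_vector_derivative du H s u) (at u within {0..1})"
    and "\<And>s. s \<in> {0..T} \<Longrightarrow> continuous_on {0..1} (du H s)"
proof -
  have c: "\<And>k. k \<le> 1 \<Longrightarrow> continuous_on ({0..T} \<times> {0..1}) (\<lambda>(s, u). (du ^^ k) H s u)"
    and d: "\<And>s u. s \<in> {0..T} \<Longrightarrow> u \<in> {0..1} \<Longrightarrow> (du ^^ 0) H s differentiable (at u within {0..1})"
    using assms unfolding Cnp_def by blast+
  show "continuous_on ({0..T} \<times> {0..1}) (\<lambda>(s, u). H s u)" using c[of 0] by simp
  show "(H s has_vector_derivative du H s u) (at u within {0..1})" if "s \<in> {0..T}" "u \<in> {0..1}" for s u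
    using d[OF that] unfolding du_def by (simp add: vector_derivative_works)
  show "continuous_on {0..1} (du H s)" if "s \<in> {0..T}" for s
  proof -
    have "continuous_on ({0..T} \<times> {0..1}) (\<lambda>(s, u). du H s u)" using c[of 1] by simp
    then have "continuous_on {0..1} (\<lambda>u. case (s, u) of (s, u) \<Rightarrow> du H s u)"
      by (rule continuous_on_compose2) (use that in \<open>auto intro!: continuous_intros\<close>)
    then show ?thesis by simp
  qed
qed

text \<open>Clamping the arguments to the rectangle extends a test function to a bounded continuous function on
  the plane, so that its sections and traces are Borel.\<close>

lemma Cnp_extension:
  assumes H: "H \<in> Cnp 0 1 T" and T: "0 < T"
  obtains H' B where "(\<lambda>(s, u). H' s u) \<in> borel_measurable (borel \<Otimes>\<^sub>M borel)" "\<And>s u. \<bar>H' s u\<bar> \<le> B"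
    "\<And>s u. s \<in> {0..T} \<Longrightarrow> u \<in> {0..1} \<Longrightarrow> H' s u = H s u" "\<And>s. sq_int I1 (H' s)"
proof -
  let ?cl = "\<lambda>p :: real \<times> real. (max 0 (min T (fst p)), max 0 (min 1 (snd p)))"
  define H' where "H' s u = H (max 0 (min T s)) (max 0 (min 1 u))" for s u
  have cl: "?cl p \<in> {0..T} \<times> {0..1}" for p using T by auto
  note c = Cnp_0_1D(1)[OF H]
  have "compact ((\<lambda>(s, u). H s u) ` ({0..T} \<times> {0..1}))"
    by (intro compact_continuous_image c compact_Times) auto
  then have "bounded ((\<lambda>(s, u). H s u) ` ({0..T} \<times> {0..1}))" by (rule compact_imp_bounded)
  then obtain B where B: "\<And>s u. s \<in> {0..T} \<Longrightarrow> u \<in> {0..1} \<Longrightarrow> \<bar>H s u\<bar> \<le> B" unfolding bounded_iff by force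
  have "continuous_on UNIV (\<lambda>p. (\<lambda>(s, u). H s u) (?cl p))"
    by (rule continuous_on_compose2[OF c]) (use cl in \<open>auto intro!: continuous_intros\<close>)
  then have "(\<lambda>p. (\<lambda>(s, u). H s u) (?cl p)) \<in> borel_measurable borel" by (rule borel_measurable_continuous_onI)
  then have m: "(\<lambda>(s, u). H' s u) \<in> borel_measurable (borel \<Otimes>\<^sub>M borel)"
    by (simp add: H'_def borel_prod case_prod_unfold)
  have b: "\<bar>H' s u\<bar> \<le> B" for s u unfolding H'_def using T by (intro B) auto
  have "sq_int I1 (H' s)" for s
    using borel_lebesgue_on[OF measurable_Pair2[OF m, of s]] b by (intro Icc.sq_int_bounded[where B = B]) auto
  then show ?thesis by (intro that[of H' B] m b) (auto simp: H'_def)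
qed

lemma separated_Cnp:
  assumes q: "continuous_on UNIV q" and e: "smooth e"
  shows "(\<lambda>s u. q s * e u) \<in> Cnp 0 1 T"
proof -
  have d: "((\<lambda>u. q s * e u) has_vector_derivative q s * deriv e u) (at u within {0..1})" for s u
    by (intro has_vector_derivative_mult_right smooth_vector_derivative e)
  have du: "du (\<lambda>s u. q s * e u) s u = q s * deriv e u" if "u \<in> {0..1}" for s u
    by (rule du_eqI[where H = "\<lambda>s u. q s * e u", OF that d])
  have c: "continuous_on ({0..T} \<times> {0..1}) (\<lambda>p. q (fst p) * f (snd p))" if "continuous_on UNIV f" for f :: "real \<Rightarrow> real"
    by (intro continuous_on_mult continuous_on_compose2[OF q] continuous_on_compose2[OF that] continuous_intros) auto
  have k0: "continuous_on ({0..T} \<times> {0..1}) (\<lambda>(s, u). q s * e u)"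
    using c[OF smooth_continuous[OF e]] by (simp add: case_prod_unfold)
  have k1: "continuous_on ({0..T} \<times> {0..1}) (\<lambda>(s, u). du (\<lambda>s u. q s * e u) s u)"
    by (rule continuous_on_eq[OF c[OF smooth_continuous[OF smooth_deriv[OF e]]]]) (use du in auto)
  have k: "continuous_on ({0..T} \<times> {0..1}) (\<lambda>(s, u). (du ^^ k) (\<lambda>s u. q s * e u) s u)" if "k \<le> 1" for k
    using that k0 k1 by (cases k) auto
  show ?thesis
    unfolding Cnp_def using k k0 differentiableI_vector[OF d] by auto
qed

section \<open>The weights of the boundary terms\<close>

text \<open>The reason for the weights \<open>P\<close>: they convert the Robin flux \<open>\<kappa> * (\<gamma> - x)\<close> into the difference of the
  \<open>m\<close>-th powers that integration by parts leaves at the boundary.\<close>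

lemma P_mult: "P m \<gamma> x * (\<gamma> - x) = \<gamma> ^ m - x ^ m"
  using power_diff_sumr2[of x m \<gamma>] by (simp add: P_def algebra_simps)

lemma P_bounds:
  assumes "0 \<le> \<gamma>" "\<gamma> \<le> 1" "0 \<le> x" "x \<le> 1" "1 \<le> m"
  shows "P m \<gamma> x \<le> m" "\<gamma> ^ (m - 1) \<le> P m \<gamma> x"
proof -
  have "P m \<gamma> x \<le> (\<Sum>i<m. 1)" unfolding P_def using assms by (intro sum_mono mult_le_one power_le_one) auto
  then show "P m \<gamma> x \<le> m" by simp
  have "\<gamma> ^ (m - 1 - 0) * x ^ 0 \<le> P m \<gamma> x" unfolding P_def using assms by (intro member_le_sum) auto
  then show "\<gamma> ^ (m - 1) \<le> P m \<gamma> x" by simp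
qed

lemma P_measurable [measurable]: "P m \<gamma> \<in> borel_measurable borel"
  unfolding P_def by measurable

lemma quadratic_bound: "0 \<le> p \<Longrightarrow> 1 \<le> k \<Longrightarrow> \<bar>y\<bar> \<le> 1 \<Longrightarrow> p * y * x - k * (p * x\<^sup>2) \<le> p" for p k x y :: real
proof -
  assume a: "0 \<le> p" "1 \<le> k" "\<bar>y\<bar> \<le> 1"
  have "y * x \<le> \<bar>y\<bar> * \<bar>x\<bar>" by (simp flip: abs_mult)
  also have "\<dots> \<le> \<bar>x\<bar>" using a(3) by (simp add: mult_left_le_one_le)
  also have "\<dots> \<le> 1 + x\<^sup>2" using sum_squares_bound[of 1 "\<bar>x\<bar>"] by simp
  also have "\<dots> \<le> 1 + k * x\<^sup>2" using mult_right_mono[OF a(2), of "x\<^sup>2"] by simp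
  finally have "p * (y * x) \<le> p * (1 + k * x\<^sup>2)" using a(1) by (rule mult_left_mono)
  then show ?thesis by (simp add: algebra_simps)
qed

context traced_trajectory
begin

lemma G_T: "AE s in lebesgue_on {0..T}. s \<in> G \<and> s \<in> {0..T}"
  unfolding AE_lebesgue_on_lborel[OF borel_closed[OF closed_atLeastAtMost]] using G_AE by eventually_elim auto

lemma \<xi>_r: "s \<in> G \<Longrightarrow> \<xi> s 0 = r s 0" "s \<in> G \<Longrightarrow> \<xi> s 1 = r s 1"
  using \<xi>_0 \<xi>_1 by (simp_all add: r_def)

lemma P_r_bounds:
  "0 < P m \<alpha> (r s 0)" "P m \<alpha> (r s 0) \<le> m" "0 < P m \<beta> (r s 1)" "P m \<beta> (r s 1) \<le> m"
proof -
  have pos: "0 < \<alpha> ^ (m - 1)" "0 < \<beta> ^ (m - 1)" using \<alpha> \<beta> by auto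
  have b: "P m \<alpha> (r s 0) \<le> m" "\<alpha> ^ (m - 1) \<le> P m \<alpha> (r s 0)" "P m \<beta> (r s 1) \<le> m" "\<beta> ^ (m - 1) \<le> P m \<beta> (r s 1)"
    using P_bounds[of \<alpha> "r s 0" m] P_bounds[of \<beta> "r s 1" m] \<alpha> \<beta> m r_bounds[of 0 s] r_bounds[of 1 s] by auto
  show "0 < P m \<alpha> (r s 0)" "0 < P m \<beta> (r s 1)"
    using less_le_trans[OF pos(1) b(2)] less_le_trans[OF pos(2) b(4)] .
  show "P m \<alpha> (r s 0) \<le> m" "P m \<beta> (r s 1) \<le> m" using b(1,3) .
qed

lemma P_r: "P m \<alpha> (r s 0) * (\<alpha> - r s 0) = \<alpha> ^ m - a s" "P m \<beta> (r s 1) * (\<beta> - r s 1) = \<beta> ^ m - F s 1"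
  using r_power[of 0 s] r_power[of 1 s] by (simp_all add: P_mult)

text \<open>The integrand that integration by parts in space leaves of the linear part of the energy.\<close>

definition "energy_density H s = (\<alpha> ^ m - a s) * H s 0 + (F s 1 - \<beta> ^ m) * H s 1 - ip (D s) (H s)"

lemma F_section_measurable [measurable]: "(\<lambda>s. F s u) \<in> borel_measurable borel"
  using measurable_Pair1[OF F_measurable, of u] by simp

lemma F_abs_le: "u \<in> {0..1} \<Longrightarrow> \<bar>F s u\<bar> \<le> 1"
  using F_bounds[of u s] by auto

lemma
  assumes H: "H \<in> Cnp 0 1 T"
  shows energy_density_integrable: "integrable (lebesgue_on {0..T}) (energy_density H)"
    and energy_lin_eq: "energy_lin \<alpha> \<beta> m T \<xi> H = (LINT s | lebesgue_on {0..T}. energy_density H s)"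
proof -
  let ?J = "lebesgue_on {0..T}"
  obtain H' B where H'm [measurable]: "(\<lambda>(s, u). H' s u) \<in> borel_measurable (borel \<Otimes>\<^sub>M borel)"
    and H'b: "\<And>s u. \<bar>H' s u\<bar> \<le> B" and H'e: "\<And>s u. s \<in> {0..T} \<Longrightarrow> u \<in> {0..1} \<Longrightarrow> H' s u = H s u"
    and H's: "\<And>s. sq_int I1 (H' s)" using Cnp_extension[OF H T] by blast
  have H'u [measurable]: "(\<lambda>s. H' s u) \<in> borel_measurable borel" for u using measurable_Pair1[OF H'm, of u] by simp
  have B: "0 \<le> B" using H'b[of 0 0] by linarith
  have ipe: "ip (D s) (H s) = ip (D s) (H' s)" if "s \<in> {0..T}" for s
    unfolding ip_def using H'e[OF that] by (intro Bochner_Integration.integral_cong) auto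
  define A where "A s = ip (D s) (H' s)" for s
  have Am [measurable]: "A \<in> borel_measurable borel" unfolding A_def by (rule borel_measurable_ip) (use D_measurable in measurable)
  have nH': "l2norm I1 (H' s) \<le> B" for s
  proof (rule power2_le_imp_le[OF _ B])
    have "(l2norm I1 (H' s))\<^sup>2 \<le> (LINT u | I1. B\<^sup>2)"
      unfolding l2norm_sq
      by (rule integral_mono) (use H's[of s] H'b[of s] in \<open>auto simp: sq_int_def intro!: power2_le_iff_abs_le[THEN iffD2] B\<close>)
    then show "(l2norm I1 (H' s))\<^sup>2 \<le> B\<^sup>2" by simp
  qed
  have Ai: "integrable ?J A"
  proof (rule Bochner_Integration.integrable_bound)
    show "integrable ?J (\<lambda>s. l2norm I1 (D s) * B)" using Icc.sq_int_integrable[OF l2norm_D_sq_int] by simp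
    show "A \<in> borel_measurable ?J" by (rule borel_lebesgue_on[OF Am])
    show "AE s in ?J. norm (A s) \<le> norm (l2norm I1 (D s) * B)"
    proof (rule AE_I2)
      fix s
      have "\<bar>A s\<bar> \<le> l2norm I1 (D s) * B"
        unfolding A_def using ip_CS[OF D_sq_int[of s] H's[of s]] mult_left_mono[OF nH'[of s], of "l2norm I1 (D s)"] by simp
      then show "norm (A s) \<le> norm (l2norm I1 (D s) * B)" by simp
    qed
  qed
  define Y1 where "Y1 s = F s 1 * H' s 1 - F s 0 * H' s 0" for s
  define Y2 where "Y2 s = \<alpha> ^ m * H' s 0 - \<beta> ^ m * H' s 1" for s
  have Ym: "Y1 \<in> borel_measurable borel" "Y2 \<in> borel_measurable borel" unfolding Y1_def Y2_def by measurable
  have "\<bar>x * H' s u\<bar> \<le> B" if "\<bar>x\<bar> \<le> 1" for x s u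
    using mult_mono[OF that H'b[of s u]] by (simp add: abs_mult)
  then have pr: "\<bar>F s 1 * H' s 1\<bar> \<le> B" "\<bar>F s 0 * H' s 0\<bar> \<le> B" "\<bar>\<alpha> ^ m * H' s 0\<bar> \<le> B" "\<bar>\<beta> ^ m * H' s 1\<bar> \<le> B" for s
    using F_abs_le[of 0 s] F_abs_le[of 1 s] \<alpha> \<beta> by (auto simp: power_le_one)
  have Yi: "integrable ?J Y1" "integrable ?J Y2"
  proof -
    have "\<bar>Y1 s\<bar> \<le> 2 * B" "\<bar>Y2 s\<bar> \<le> 2 * B" for s using pr[of s] unfolding Y1_def Y2_def by linarith+
    then show "integrable ?J Y1" "integrable ?J Y2" using integrable_bounded_borel Ym by blast+
  qed
  have lin: "energy_density H s = Y1 s - A s + Y2 s" if "s \<in> {0..T}" for s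
    using ipe[OF that] H'e[OF that, of 0] H'e[OF that, of 1] by (simp add: energy_density_def Y1_def Y2_def A_def algebra_simps)
  have "integrable ?J (energy_density H) \<longleftrightarrow> integrable ?J (\<lambda>s. Y1 s - A s + Y2 s)"
    by (rule Bochner_Integration.integrable_cong) (use lin in auto)
  then show "integrable ?J (energy_density H)" using Ai Yi by simp
  have "ipT T (\<lambda>s u. \<xi> s u ^ m) (du H) = (LINT s | ?J. Y1 s - A s)"
    unfolding ipT_def
  proof (rule LINT_cong_AE_lebesgue_on(1))
    show "(\<lambda>s. Y1 s - A s) \<in> borel_measurable ?J" by (intro borel_lebesgue_on borel_measurable_diff Ym Am)
    show "AE s in ?J. ip (\<lambda>u. \<xi> s u ^ m) (du H s) = Y1 s - A s"
      using G_T
    proof eventually_elim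
      case (elim s)
      then have s: "s \<in> G" "s \<in> {0..T}" by auto
      have Fs: "F s \<in> borel_measurable I1" using prim_sq_int[OF D_sq_int] by (simp add: sq_int_def)
      have ae: "AE u in I1. F s u = \<xi> s u ^ m" using \<xi>_interior[OF s(1)] by eventually_elim simp
      have "ip (\<lambda>u. \<xi> s u ^ m) (du H s) = ip (F s) (du H s)"
      proof (rule ip_cong_AE)
        show "(\<lambda>u. \<xi> s u ^ m) \<in> borel_measurable I1" by (rule measurable_cong_AE_lebesgue_on[OF Fs ae])
        show "du H s \<in> borel_measurable I1" by (rule continuous_on_Icc_measurable[OF Cnp_0_1D(3)[OF H s(2)]])
      qed (use Fs \<xi>_interior[OF s(1)] continuous_on_Icc_measurable[OF Cnp_0_1D(3)[OF H s(2)]] in auto)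
      also have "\<dots> = F s 1 * H s 1 - a s * H s 0 - ip (D s) (H s)"
        by (rule prim_by_parts[OF D_sq_int Cnp_0_1D(2,3)[OF H s(2)]])
      finally show ?case using ipe[OF s(2)] H'e[OF s(2), of 0] H'e[OF s(2), of 1] by (simp add: Y1_def A_def)
    qed
  qed
  moreover have "(LINT s | ?J. \<alpha> ^ m * H s 0 - \<beta> ^ m * H s 1) = (LINT s | ?J. Y2 s)"
    by (rule Bochner_Integration.integral_cong) (use H'e in \<open>auto simp: Y2_def\<close>)
  ultimately have "energy_lin \<alpha> \<beta> m T \<xi> H = (LINT s | ?J. Y1 s - A s) + (LINT s | ?J. Y2 s)"
    by (simp add: energy_lin_def)
  also have "\<dots> = (LINT s | ?J. Y1 s - A s + Y2 s)" using Ai Yi by simp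
  also have "\<dots> = (LINT s | ?J. energy_density H s)"
    by (rule Bochner_Integration.integral_cong) (use lin in auto)
  finally show "energy_lin \<alpha> \<beta> m T \<xi> H = (LINT s | ?J. energy_density H s)" .
qed

lemma N_integral: "integrable (lebesgue_on {0..T}) N" "(LINT s | lebesgue_on {0..T}. N s) = (LINT s | lborel. N s)"
proof -
  have "(\<lambda>s. indicator {0..T} s * N s) = N"
  proof
    fix s show "indicator {0..T} s * N s = N s"
      using D_outside[of s] by (cases "s \<in> {0..T}") (auto simp: N_def l2norm_def)
  qed
  then show "integrable (lebesgue_on {0..T}) N" "(LINT s | lebesgue_on {0..T}. N s) = (LINT s | lborel. N s)"
    using N_integrable by (simp_all add: integrable_lebesgue_on_borel integral_lebesgue_on_borel)
qed

text \<open>Both the interior and the two boundary terms have the form \<open>b x - c x\<^sup>2\<close>. In the interior \<open>c \<ge> 1\<close>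
  leaves at most \<open>N s\<close>; at the boundary the weights are \<open>P / \<kappa>\<close>, and \<open>c \<ge> \<kappa>\<close> leaves at most
  \<open>P \<le> m\<close> at each end point.\<close>

lemma energy_le: "energy \<alpha> \<beta> m T \<kappa> (1 + \<kappa>) \<xi> \<le> ereal (2 + T + 2 * m * T)"
  unfolding energy_def
proof (rule SUP_least)
  fix H assume H: "H \<in> Cnp 0 1 T"
  let ?J = "lebesgue_on {0..T}"
  let ?c = "1 + \<kappa>"
  obtain H' B where H'm [measurable]: "(\<lambda>(s, u). H' s u) \<in> borel_measurable (borel \<Otimes>\<^sub>M borel)"
    and H'b: "\<And>s u. \<bar>H' s u\<bar> \<le> B" and H'e: "\<And>s u. s \<in> {0..T} \<Longrightarrow> u \<in> {0..1} \<Longrightarrow> H' s u = H s u"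
    and H's: "\<And>s. sq_int I1 (H' s)" using Cnp_extension[OF H T] by blast
  have H'u [measurable]: "(\<lambda>s. H' s u) \<in> borel_measurable borel" for u using measurable_Pair1[OF H'm, of u] by simp
  have B: "0 \<le> B" using H'b[of 0 0] by linarith
  define V where "V s = (l2norm I1 (H' s))\<^sup>2" for s
  define W where "W s = P m \<alpha> (r s 0) / \<kappa> * (H' s 0)\<^sup>2 + P m \<beta> (r s 1) / \<kappa> * (H' s 1)\<^sup>2" for s
  have Vm: "V \<in> borel_measurable borel" unfolding V_def by (intro borel_measurable_power borel_measurable_l2norm) measurable
  have Wm: "W \<in> borel_measurable borel" unfolding W_def by measurable
  have Hsq: "(H' s u)\<^sup>2 \<le> B\<^sup>2" for s u by (rule power2_le_iff_abs_le[THEN iffD2, OF B H'b])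
  have "\<bar>V s\<bar> \<le> B\<^sup>2" for s
  proof -
    have "V s \<le> (LINT u | I1. B\<^sup>2)"
      unfolding V_def l2norm_sq by (rule integral_mono) (use H's[of s] Hsq in \<open>auto simp: sq_int_def\<close>)
    then show ?thesis by (simp add: V_def)
  qed
  then have Vi: "integrable ?J V" by (rule integrable_bounded_borel[OF Vm])
  have "\<bar>W s\<bar> \<le> m / \<kappa> * B\<^sup>2 + m / \<kappa> * B\<^sup>2" for s
  proof -
    have "0 \<le> P m \<alpha> (r s 0) / \<kappa> * (H' s 0)\<^sup>2" "0 \<le> P m \<beta> (r s 1) / \<kappa> * (H' s 1)\<^sup>2"
      using P_r_bounds[of s] \<kappa> by (auto intro!: mult_nonneg_nonneg)
    moreover have "P m \<alpha> (r s 0) / \<kappa> * (H' s 0)\<^sup>2 \<le> m / \<kappa> * B\<^sup>2" "P m \<beta> (r s 1) / \<kappa> * (H' s 1)\<^sup>2 \<le> m / \<kappa> * B\<^sup>2"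
      using P_r_bounds[of s] \<kappa> Hsq by (auto intro!: mult_mono divide_right_mono)
    ultimately show ?thesis unfolding W_def by linarith
  qed
  then have Wi: "integrable ?J W" by (rule integrable_bounded_borel[OF Wm])
  have "ipT T H H = (LINT s | ?J. V s)"
    unfolding ipT_def
  proof (rule Bochner_Integration.integral_cong[OF refl])
    fix s assume "s \<in> space ?J"
    then have "s \<in> {0..T}" by simp
    then have "ip (H s) (H s) = ip (H' s) (H' s)"
      unfolding ip_def using H'e by (intro Bochner_Integration.integral_cong) auto
    then show "ip (H s) (H s) = V s" by (simp add: V_def ip_self)
  qed
  moreover have "(LINT s | ?J. P m \<alpha> (\<xi> s 0) / \<kappa> * H s 0 * H s 0 + P m \<beta> (\<xi> s 1) / \<kappa> * H s 1 * H s 1) = (LINT s | ?J. W s)"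
  proof (rule LINT_cong_AE_lebesgue_on(1)[OF borel_lebesgue_on[OF Wm]])
    show "AE s in ?J. P m \<alpha> (\<xi> s 0) / \<kappa> * H s 0 * H s 0 + P m \<beta> (\<xi> s 1) / \<kappa> * H s 1 * H s 1 = W s"
      using G_T by eventually_elim (use H'e in \<open>simp add: W_def \<xi>_r power2_eq_square\<close>)
  qed
  ultimately have HH: "ip_bdry \<alpha> \<beta> m T \<kappa> \<xi> H H = (LINT s | ?J. V s) + (LINT s | ?J. W s)"
    by (simp add: ip_bdry_def)
  have "energy_lin \<alpha> \<beta> m T \<xi> H - ?c * ip_bdry \<alpha> \<beta> m T \<kappa> \<xi> H H = (LINT s | ?J. energy_density H s - ?c * (V s + W s))"
    unfolding energy_lin_eq[OF H] HH using energy_density_integrable[OF H] Vi Wi by simp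
  also have "\<dots> \<le> (LINT s | ?J. N s + 2 * m)"
  proof (rule integral_mono)
    show "integrable ?J (\<lambda>s. energy_density H s - ?c * (V s + W s))" using energy_density_integrable[OF H] Vi Wi by simp
    show "integrable ?J (\<lambda>s. N s + 2 * m)" using N_integral by simp
    fix s assume "s \<in> space ?J"
    then have s: "s \<in> {0..T}" by simp
    have h: "H s 0 = H' s 0" "H s 1 = H' s 1" "ip (D s) (H s) = ip (D s) (H' s)"
      using H'e[OF s] unfolding ip_def by (auto intro: Bochner_Integration.integral_cong)
    have "\<bar>ip (D s) (H' s)\<bar> \<le> N s + V s"
    proof -
      have nn: "0 \<le> l2norm I1 (D s) * l2norm I1 (H' s)" by simp
      have "2 * (l2norm I1 (D s) * l2norm I1 (H' s)) \<le> N s + V s"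
        using sum_squares_bound[of "l2norm I1 (D s)" "l2norm I1 (H' s)"] by (simp add: N_def V_def)
      then show ?thesis using ip_CS[OF D_sq_int[of s] H's[of s]] nn by linarith
    qed
    moreover have "0 \<le> \<kappa> * V s" using \<kappa> by (simp add: V_def)
    ultimately have 1: "- ip (D s) (H' s) - ?c * V s \<le> N s" by (simp add: distrib_right)
    have k: "1 \<le> ?c / \<kappa>" using \<kappa> by (simp add: field_simps)
    have y: "\<bar>\<alpha> - r s 0\<bar> \<le> 1" "\<bar>- (\<beta> - r s 1)\<bar> \<le> 1" using r_bounds[of 0 s] r_bounds[of 1 s] \<alpha> \<beta> by auto
    have "(\<alpha> ^ m - a s) * H' s 0 - ?c / \<kappa> * (P m \<alpha> (r s 0) * (H' s 0)\<^sup>2) \<le> m"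
      using quadratic_bound[OF less_imp_le[OF P_r_bounds(1)] k y(1), of s "H' s 0"] P_r_bounds(2)[of s] unfolding P_r by linarith
    moreover have "(F s 1 - \<beta> ^ m) * H' s 1 - ?c / \<kappa> * (P m \<beta> (r s 1) * (H' s 1)\<^sup>2) \<le> m"
    proof -
      have e: "P m \<beta> (r s 1) * - (\<beta> - r s 1) = F s 1 - \<beta> ^ m"
        unfolding mult_minus_right P_r by simp
      show ?thesis
        using quadratic_bound[OF less_imp_le[OF P_r_bounds(3)] k y(2), of s "H' s 1"] P_r_bounds(4)[of s]
        unfolding e by linarith
    qed
    moreover have "?c * W s = ?c / \<kappa> * (P m \<alpha> (r s 0) * (H' s 0)\<^sup>2) + ?c / \<kappa> * (P m \<beta> (r s 1) * (H' s 1)\<^sup>2)"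
      by (simp add: W_def distrib_left)
    ultimately show "energy_density H s - ?c * (V s + W s) \<le> N s + 2 * m"
      using 1 unfolding energy_density_def h by (simp add: distrib_left)
  qed
  also have "\<dots> = (LINT s | lborel. N s) + 2 * m * T" using N_integral T by (simp add: measure_restrict_space)
  also have "\<dots> \<le> 2 + T + 2 * m * T" using energy_bound by (simp add: N_def)
  finally show "ereal (energy_lin \<alpha> \<beta> m T \<xi> H - ?c * ip_bdry \<alpha> \<beta> m T \<kappa> \<xi> H H) \<le> ereal (2 + T + 2 * m * T)" by simp
qed

end

section \<open>Borel versions on the rectangle\<close>

lemma AE_rect_interior:
  fixes S :: "(real \<times> real) set"
  assumes "S \<in> sets lebesgue"
  shows "AE p in lebesgue_on S. snd p \<noteq> (c :: real)"
proof -
  have "negligible {p :: real \<times> real. p \<bullet> (0, 1) = c}"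
    by (rule negligible_standard_hyperplane) (simp add: Basis_prod_def)
  moreover have "{p :: real \<times> real. p \<bullet> (0, 1) = c} = {p. snd p = c}" by (auto simp: inner_prod_def)
  ultimately have "{p :: real \<times> real. snd p = c} \<in> null_sets lebesgue" by (simp add: negligible_iff_null_sets)
  then have "AE p in lebesgue. snd (p :: real \<times> real) \<noteq> c" by (rule AE_not_in[THEN AE_mp]) simp
  then have "AE p in lebesgue. p \<in> S \<longrightarrow> snd p \<noteq> c" by (rule eventually_mono) simp
  then show ?thesis using assms by (subst AE_restrict_space_iff) simp_all
qed

lemma rect_lebesgue: "{0..T} \<times> {0..1::real} \<in> sets lebesgue" for T :: real
proof -
  have "{0..T} \<times> {0..1::real} \<in> sets borel" by (intro borel_closed closed_Times) auto
  then show ?thesis by (intro sets_completionI_sets) simp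
qed

text \<open>For almost every time the Borel version agrees almost everywhere in space, by Fubini's theorem for
  the null set where the two functions differ.\<close>

lemma Borel_version_rect:
  fixes H :: "real \<Rightarrow> real \<Rightarrow> real"
  assumes Hm: "(\<lambda>(s, u). H s u) \<in> borel_measurable (lebesgue_on ({0..T} \<times> {0..1}))"
    and Hi: "integrable (lebesgue_on ({0..T} \<times> {0..1})) (\<lambda>(s, u). (H s u)\<^sup>2)"
  obtains h where "(\<lambda>(s, u). h s u) \<in> borel_measurable (borel \<Otimes>\<^sub>M borel)"
    "AE s in lebesgue_on {0..T}. (AE u in I1. H s u = h s u) \<and> sq_int I1 (h s)"
    "sq_int (lebesgue_on {0..T}) (\<lambda>s. l2norm I1 (h s))"
proof -
  let ?R = "{0..T} \<times> {0..1::real}"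
  have "(\<lambda>p. if p \<in> ?R then (\<lambda>(s, u). H s u) p else 0) \<in> borel_measurable lebesgue"
    using Hm by (subst measurable_if_lebesgue[OF rect_lebesgue])
  then obtain g where gm: "g \<in> borel_measurable lborel" and g: "AE p in lborel. (if p \<in> ?R then (\<lambda>(s, u). H s u) p else 0) = g p"
    using completion_ex_borel_measurable_real by blast
  have gb: "g \<in> borel_measurable borel" using gm by simp
  define h where "h s u = g (s, u)" for s u
  have hm: "(\<lambda>(s, u). h s u) \<in> borel_measurable (borel \<Otimes>\<^sub>M borel)"
    using gb by (simp add: h_def borel_prod case_prod_unfold)
  have hs: "h s \<in> borel_measurable borel" for s using measurable_Pair2[OF hm, of s] by simp
  have "AE p in lborel \<Otimes>\<^sub>M lborel. (if p \<in> ?R then (\<lambda>(s, u). H s u) p else 0) = g p"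
    using g unfolding lborel_prod .
  from lborel_pair.AE_pair[OF this]
  have ae: "AE s in lebesgue_on {0..T}. AE u in I1. H s u = h s u"
    unfolding AE_lebesgue_on_lborel[OF borel_closed[OF closed_atLeastAtMost]]
  proof eventually_elim
    case (elim s)
    show ?case
    proof
      assume "s \<in> {0..T}"
      with elim show "AE u in lborel. u \<in> {0..1} \<longrightarrow> H s u = h s u"
        by (auto simp: h_def elim!: eventually_mono)
    qed
  qed
  have g2: "(\<lambda>p. (g p)\<^sup>2) \<in> borel_measurable borel" using gb by measurable
  have "AE p in lborel. p \<in> ?R \<longrightarrow> (\<lambda>(s, u). H s u) p = g p"
    using g by eventually_elim auto
  moreover have "?R \<in> sets borel" by (intro borel_closed closed_Times) auto
  ultimately have "AE p in lebesgue_on ?R. (\<lambda>(s, u). H s u) p = g p"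
    by (simp only: AE_lebesgue_on_lborel)
  then have "AE p in lebesgue_on ?R. (case p of (s, u) \<Rightarrow> (H s u)\<^sup>2) = (g p)\<^sup>2"
    by eventually_elim (auto simp: case_prod_unfold)
  moreover have "(\<lambda>(s, u). (H s u)\<^sup>2) \<in> borel_measurable (lebesgue_on ?R)" using Hi by auto
  ultimately have gi: "integrable (lebesgue_on ?R) (\<lambda>p. (g p)\<^sup>2)"
    using Hi borel_lebesgue_on[OF g2] by (subst (asm) integrable_cong_AE) auto
  have "AE s in lebesgue_on {0..T}. sq_int I1 (h s)"
    using AE_integrable_rect[OF g2 gi] by eventually_elim (simp add: sq_int_def h_def[abs_def] borel_lebesgue_on[OF hs, unfolded h_def[abs_def]])
  with ae have 1: "AE s in lebesgue_on {0..T}. (AE u in I1. H s u = h s u) \<and> sq_int I1 (h s)"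
    by eventually_elim simp
  have "integrable (lebesgue_on {0..T}) (\<lambda>s. (l2norm I1 (h s))\<^sup>2)"
    using integrable_rect_iterated[OF g2 gi] by (simp add: l2norm_sq h_def)
  then have 2: "sq_int (lebesgue_on {0..T}) (\<lambda>s. l2norm I1 (h s))"
    using borel_lebesgue_on[OF borel_measurable_l2norm[OF hm]] by (simp add: sq_int_def)
  show ?thesis by (rule that[OF hm 1 2])
qed

lemma ip_cmult_right: "ip f (\<lambda>u. c * g u) = c * ip f g"
proof -
  have "ip f (\<lambda>u. c * g u) = (LINT u | I1. c * (f u * g u))"
    unfolding ip_def by (intro Bochner_Integration.integral_cong) auto
  then show ?thesis by (simp add: ip_def)
qed

context traced_trajectory
begin

definition "D_bdry s u = (if u = 0 then \<kappa> * (\<xi> s 0 - \<alpha>) else if u = 1 then \<kappa> * (\<beta> - \<xi> s 1) else D s u)"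

text \<open>The boundary part of the weighted inner product with \<open>D_bdry\<close>, once the weights are cancelled.\<close>

definition "trace_form H s = (a s - \<alpha> ^ m) * H s 0 + (\<beta> ^ m - F s 1) * H s (1::real)"

lemma energy_density_trace: "energy_density H s = - trace_form H s - ip (D s) (H s)"
  by (simp add: energy_density_def trace_form_def algebra_simps)

lemma trace_form_integrable:
  assumes H: "H \<in> Cnp 0 1 T" shows "integrable (lebesgue_on {0..T}) (trace_form H)"
proof -
  obtain H' B where H'm [measurable]: "(\<lambda>(s, u). H' s u) \<in> borel_measurable (borel \<Otimes>\<^sub>M borel)"
    and H'b: "\<And>s u. \<bar>H' s u\<bar> \<le> B" and H'e: "\<And>s u. s \<in> {0..T} \<Longrightarrow> u \<in> {0..1} \<Longrightarrow> H' s u = H s u"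
    and "\<And>s. sq_int I1 (H' s)" using Cnp_extension[OF H T] by blast
  have H'u [measurable]: "(\<lambda>s. H' s u) \<in> borel_measurable borel" for u using measurable_Pair1[OF H'm, of u] by simp
  have m: "trace_form H' \<in> borel_measurable borel" unfolding trace_form_def by measurable
  have "\<bar>trace_form H' s\<bar> \<le> B + B" for s
  proof -
    have mul: "\<bar>x * H' s u\<bar> \<le> B" if "\<bar>x\<bar> \<le> 1" for x u
      using mult_mono[OF that H'b[of s u]] by (simp add: abs_mult)
    have "0 \<le> F s 0" "F s 0 \<le> 1" "0 \<le> F s 1" "F s 1 \<le> 1" using F_bounds[of 0 s] F_bounds[of 1 s] by auto
    moreover have "0 \<le> \<alpha> ^ m" "\<alpha> ^ m \<le> 1" "0 \<le> \<beta> ^ m" "\<beta> ^ m \<le> 1" using \<alpha> \<beta> by (auto intro: power_le_one)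
    ultimately have "\<bar>a s - \<alpha> ^ m\<bar> \<le> 1" "\<bar>\<beta> ^ m - F s 1\<bar> \<le> 1"
      unfolding prim_0 by linarith+
    then have "\<bar>(a s - \<alpha> ^ m) * H' s 0\<bar> \<le> B" "\<bar>(\<beta> ^ m - F s 1) * H' s 1\<bar> \<le> B"
      using mul by auto
    then show ?thesis unfolding trace_form_def by linarith
  qed
  then have "integrable (lebesgue_on {0..T}) (trace_form H')" by (rule integrable_bounded_borel[OF m])
  then show ?thesis
    by (rule Bochner_Integration.integrable_cong[THEN iffD1, OF refl, rotated]) (use H'e in \<open>auto simp: trace_form_def\<close>)
qed

lemma D_bdry_0: "D_bdry s 0 = \<kappa> * (\<xi> s 0 - \<alpha>)" and D_bdry_1: "D_bdry s 1 = \<kappa> * (\<beta> - \<xi> s 1)"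
  by (simp_all add: D_bdry_def)

lemma D_bdry_L2: "D_bdry \<in> L2_bdry \<alpha> \<beta> m T \<kappa> \<xi>"
proof -
  let ?J = "lebesgue_on {0..T}" and ?R = "lebesgue_on ({0..T} \<times> {0..1::real})"
  have sq: "sq_int ?R (\<lambda>(s, u). D s u)"
    using N_integral(1) by (intro sq_int_Borel_rect D_measurable D_sq_int) (simp add: N_def[abs_def])
  have eq: "AE p in ?R. (\<lambda>(s, u). D s u) p = (\<lambda>(s, u). D_bdry s u) p"
    using AE_rect_interior[OF rect_lebesgue[of T], of 0] AE_rect_interior[OF rect_lebesgue[of T], of 1]
    by eventually_elim (simp add: D_bdry_def case_prod_unfold)
  have m: "(\<lambda>(s, u). D_bdry s u) \<in> borel_measurable ?R"
    by (rule measurable_cong_AE_set[OF rect_lebesgue sq_int_measurable[OF sq] eq])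
  have "sq_int ?R (\<lambda>(s, u). D_bdry s u)" by (rule sq_int_cong_AE[OF sq m eq])
  then have i: "integrable ?R (\<lambda>(s, u). (D_bdry s u)\<^sup>2)" by (simp add: sq_int_def case_prod_unfold)
  have e0: "AE s in ?J. \<kappa> * (r s 0 - \<alpha>) = D_bdry s 0" using G_T by eventually_elim (simp add: D_bdry_0 \<xi>_r)
  have e1: "AE s in ?J. \<kappa> * (\<beta> - r s 1) = D_bdry s 1" using G_T by eventually_elim (simp add: D_bdry_1 \<xi>_r)
  have m0: "(\<lambda>s. D_bdry s 0) \<in> borel_measurable ?J"
    by (rule measurable_cong_AE_lebesgue_on[OF _ e0]) (intro borel_lebesgue_on, measurable)
  have m1: "(\<lambda>s. D_bdry s 1) \<in> borel_measurable ?J"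
    by (rule measurable_cong_AE_lebesgue_on[OF _ e1]) (intro borel_lebesgue_on, measurable)
  define f0 where "f0 s = P m \<alpha> (r s 0) / \<kappa> * (\<kappa> * (r s 0 - \<alpha>))\<^sup>2" for s
  define f1 where "f1 s = P m \<beta> (r s 1) / \<kappa> * (\<kappa> * (\<beta> - r s 1))\<^sup>2" for s
  have fm: "f0 \<in> borel_measurable borel" "f1 \<in> borel_measurable borel" unfolding f0_def f1_def by measurable
  have sq1: "(\<kappa> * y)\<^sup>2 \<le> \<kappa>\<^sup>2" if "\<bar>y\<bar> \<le> 1" for y
    using that by (simp add: power_mult_distrib mult_left_le abs_square_le_1)
  have fb: "\<bar>f0 s\<bar> \<le> m / \<kappa> * \<kappa>\<^sup>2" "\<bar>f1 s\<bar> \<le> m / \<kappa> * \<kappa>\<^sup>2" for s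
  proof -
    have y: "\<bar>r s 0 - \<alpha>\<bar> \<le> 1" "\<bar>\<beta> - r s 1\<bar> \<le> 1" using r_bounds[of 0 s] r_bounds[of 1 s] \<alpha> \<beta> by auto
    have "0 \<le> f0 s" "0 \<le> f1 s" using P_r_bounds[of s] \<kappa> by (auto simp: f0_def f1_def intro!: mult_nonneg_nonneg)
    moreover have "f0 s \<le> m / \<kappa> * \<kappa>\<^sup>2" "f1 s \<le> m / \<kappa> * \<kappa>\<^sup>2"
      unfolding f0_def f1_def using P_r_bounds[of s] \<kappa> sq1[OF y(1)] sq1[OF y(2)] by (auto intro!: mult_mono divide_right_mono)
    ultimately show "\<bar>f0 s\<bar> \<le> m / \<kappa> * \<kappa>\<^sup>2" "\<bar>f1 s\<bar> \<le> m / \<kappa> * \<kappa>\<^sup>2" by simp_all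
  qed
  have "AE s in ?J. P m \<alpha> (\<xi> s 0) / \<kappa> * (D_bdry s 0)\<^sup>2 = f0 s"
    using G_T by eventually_elim (simp add: D_bdry_0 \<xi>_r f0_def)
  then have i0: "integrable ?J (\<lambda>s. P m \<alpha> (\<xi> s 0) / \<kappa> * (D_bdry s 0)\<^sup>2)"
    using integrable_bounded_borel[OF fm(1) fb(1)] by (subst LINT_cong_AE_lebesgue_on(2)[OF borel_lebesgue_on[OF fm(1)]])
  have "AE s in ?J. P m \<beta> (\<xi> s 1) / \<kappa> * (D_bdry s 1)\<^sup>2 = f1 s"
    using G_T by eventually_elim (simp add: D_bdry_1 \<xi>_r f1_def)
  then have i1: "integrable ?J (\<lambda>s. P m \<beta> (\<xi> s 1) / \<kappa> * (D_bdry s 1)\<^sup>2)"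
    using integrable_bounded_borel[OF fm(2) fb(2)] by (subst LINT_cong_AE_lebesgue_on(2)[OF borel_lebesgue_on[OF fm(2)]])
  show ?thesis unfolding L2_bdry_def using m m0 m1 i i0 i1 by simp
qed

lemma energy_deriv_exists: "is_energy_deriv \<alpha> \<beta> m T \<kappa> \<xi> D_bdry"
  unfolding is_energy_deriv_def
proof (intro conjI ballI D_bdry_L2)
  fix H assume H: "H \<in> Cnp 0 1 T"
  let ?J = "lebesgue_on {0..T}"
  have "ipT T D_bdry H = (LINT s | ?J. ip (D s) (H s))"
    unfolding ipT_def
  proof (rule Bochner_Integration.integral_cong[OF refl])
    fix s assume "s \<in> space ?J"
    then have s: "s \<in> {0..T}" by simp
    have Hs: "H s \<in> borel_measurable I1"
      by (rule continuous_on_Icc_measurable) (rule continuous_on_vector_derivative[OF Cnp_0_1D(2)[OF H s]])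
    have "AE u in lebesgue. u \<notin> {0, 1::real}" by (intro AE_not_in) (auto simp flip: negligible_iff_null_sets)
    then have ae: "AE u in I1. D s u = D_bdry s u"
      unfolding AE_lebesgue_on_Icc by eventually_elim (auto simp: D_bdry_def)
    have Dm: "D s \<in> borel_measurable I1" using D_sq_int by (simp add: sq_int_def)
    show "ip (D_bdry s) (H s) = ip (D s) (H s)"
      by (rule ip_cong_AE[symmetric, OF Dm measurable_cong_AE_lebesgue_on[OF Dm ae] ae Hs Hs]) simp
  qed
  moreover have "(LINT s | ?J. P m \<alpha> (\<xi> s 0) / \<kappa> * D_bdry s 0 * H s 0 + P m \<beta> (\<xi> s 1) / \<kappa> * D_bdry s 1 * H s 1) = (LINT s | ?J. trace_form H s)"
  proof (rule LINT_cong_AE_lebesgue_on(1)[OF borel_measurable_integrable[OF trace_form_integrable[OF H]]])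
    show "AE s in ?J. P m \<alpha> (\<xi> s 0) / \<kappa> * D_bdry s 0 * H s 0 + P m \<beta> (\<xi> s 1) / \<kappa> * D_bdry s 1 * H s 1 = trace_form H s"
      using G_T
    proof eventually_elim
      case (elim s)
      have "P m \<alpha> (r s 0) * (r s 0 - \<alpha>) = a s - \<alpha> ^ m"
        using P_r(1)[of s] by (simp add: algebra_simps)
      moreover have "P m \<alpha> (\<xi> s 0) / \<kappa> * D_bdry s 0 = P m \<alpha> (r s 0) * (r s 0 - \<alpha>)"
        "P m \<beta> (\<xi> s 1) / \<kappa> * D_bdry s 1 = P m \<beta> (r s 1) * (\<beta> - r s 1)"
        using elim \<kappa> by (simp_all add: D_bdry_0 D_bdry_1 \<xi>_r)
      ultimately show ?case unfolding trace_form_def P_r by simp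
    qed
  qed
  ultimately have "ip_bdry \<alpha> \<beta> m T \<kappa> \<xi> D_bdry H = (LINT s | ?J. ip (D s) (H s)) + (LINT s | ?J. trace_form H s)"
    by (simp add: ip_bdry_def)
  moreover have "integrable ?J (\<lambda>s. ip (D s) (H s))"
  proof -
    have "integrable ?J (\<lambda>s. - (energy_density H s) - trace_form H s)" using energy_density_integrable[OF H] trace_form_integrable[OF H] by simp
    then show ?thesis by (simp add: energy_density_trace)
  qed
  then have "(LINT s | ?J. energy_density H s) = - (LINT s | ?J. trace_form H s) - (LINT s | ?J. ip (D s) (H s))"
    unfolding energy_density_trace using trace_form_integrable[OF H] by simp
  ultimately show "energy_lin \<alpha> \<beta> m T \<xi> H = - ip_bdry \<alpha> \<beta> m T \<kappa> \<xi> D_bdry H"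
    using energy_lin_eq[OF H] by simp
qed

text \<open>From \<open>\<bar>y\<bar> \<le> 1 + y\<^sup>2\<close>, as the weight is bounded.\<close>

lemma weighted_trace_integrable:
  assumes D'm: "D' \<in> borel_measurable (lebesgue_on {0..T})"
    and rm: "\<rho>b \<in> borel_measurable borel" and e: "AE s in lebesgue_on {0..T}. \<xi>b s = \<rho>b s"
    and b: "\<And>s. 0 \<le> P m \<gamma> (\<rho>b s)" "\<And>s. P m \<gamma> (\<rho>b s) \<le> m"
    and int: "integrable (lebesgue_on {0..T}) (\<lambda>s. P m \<gamma> (\<xi>b s) / \<kappa> * (D' s)\<^sup>2)"
  shows "integrable (lebesgue_on {0..T}) (\<lambda>s. P m \<gamma> (\<xi>b s) / \<kappa> * D' s)"
proof (rule Bochner_Integration.integrable_bound)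
  let ?J = "lebesgue_on {0..T}"
  show "integrable ?J (\<lambda>s. m / \<kappa> + P m \<gamma> (\<xi>b s) / \<kappa> * (D' s)\<^sup>2)" using int by simp
  have Pm: "(\<lambda>s. P m \<gamma> (\<rho>b s)) \<in> borel_measurable borel" using rm by measurable
  have "AE s in ?J. P m \<gamma> (\<rho>b s) = P m \<gamma> (\<xi>b s)" using e by eventually_elim simp
  from measurable_cong_AE_lebesgue_on[OF borel_lebesgue_on[OF Pm] this]
  show "(\<lambda>s. P m \<gamma> (\<xi>b s) / \<kappa> * D' s) \<in> borel_measurable ?J" using D'm by measurable
  show "AE s in ?J. norm (P m \<gamma> (\<xi>b s) / \<kappa> * D' s) \<le> norm (m / \<kappa> + P m \<gamma> (\<xi>b s) / \<kappa> * (D' s)\<^sup>2)"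
    using e
  proof eventually_elim
    case (elim s)
    let ?p = "P m \<gamma> (\<rho>b s) / \<kappa>"
    have p: "0 \<le> ?p" "?p \<le> m / \<kappa>" using b[of s] \<kappa> by (auto intro: divide_right_mono)
    have "\<bar>D' s\<bar> \<le> 1 + (D' s)\<^sup>2" using sum_squares_bound[of 1 "\<bar>D' s\<bar>"] by simp
    then have "?p * \<bar>D' s\<bar> \<le> ?p * (1 + (D' s)\<^sup>2)" using p(1) by (rule mult_left_mono)
    also have "\<dots> \<le> m / \<kappa> + ?p * (D' s)\<^sup>2" using p(2) by (simp add: distrib_left)
    finally have "\<bar>?p * D' s\<bar> \<le> m / \<kappa> + ?p * (D' s)\<^sup>2" unfolding abs_mult abs_of_nonneg[OF p(1)] .
    then show ?case unfolding elim real_norm_def by (rule order_trans[OF _ abs_ge_self])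
  qed
qed

text \<open>Test both representations of the energy with \<open>q s * e n u\<close>. The interior terms are bounded by a
  multiple of the norm of \<open>e n\<close> and disappear in the limit, while the boundary terms do not depend on
  \<open>n\<close>; so the boundary defect is orthogonal to every continuous \<open>q\<close>.\<close>

lemma boundary_orthogonality:
  assumes D': "is_energy_deriv \<alpha> \<beta> m T \<kappa> \<xi> D'"
    and e: "\<And>n. smooth (e n)" "\<And>n. e n 0 = \<delta>0" "\<And>n. e n 1 = \<delta>1" "(\<lambda>n. l2norm I1 (e n)) \<longlonglongrightarrow> 0"
  shows "AE s in lebesgue_on {0..T}.
    \<delta>0 * (P m \<alpha> (\<xi> s 0) / \<kappa> * D' s 0 + \<alpha> ^ m - F s 0) + \<delta>1 * (P m \<beta> (\<xi> s 1) / \<kappa> * D' s 1 + F s 1 - \<beta> ^ m) = 0"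
proof -
  let ?J = "lebesgue_on {0..T}"
  define \<chi>0 where "\<chi>0 s = P m \<alpha> (\<xi> s 0) / \<kappa> * D' s 0" for s
  define \<chi>1 where "\<chi>1 s = P m \<beta> (\<xi> s 1) / \<kappa> * D' s 1" for s
  define f where "f s = \<delta>0 * (\<chi>0 s + \<alpha> ^ m - F s 0) + \<delta>1 * (\<chi>1 s + F s 1 - \<beta> ^ m)" for s
  have L: "(\<lambda>(s, u). D' s u) \<in> borel_measurable (lebesgue_on ({0..T} \<times> {0..1}))"
    "integrable (lebesgue_on ({0..T} \<times> {0..1})) (\<lambda>(s, u). (D' s u)\<^sup>2)"
    "(\<lambda>s. D' s 0) \<in> borel_measurable ?J" "(\<lambda>s. D' s 1) \<in> borel_measurable ?J"
    "integrable ?J (\<lambda>s. P m \<alpha> (\<xi> s 0) / \<kappa> * (D' s 0)\<^sup>2)" "integrable ?J (\<lambda>s. P m \<beta> (\<xi> s 1) / \<kappa> * (D' s 1)\<^sup>2)"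
    using D' unfolding is_energy_deriv_def L2_bdry_def by auto
  have DH: "energy_lin \<alpha> \<beta> m T \<xi> H = - ip_bdry \<alpha> \<beta> m T \<kappa> \<xi> D' H" if "H \<in> Cnp 0 1 T" for H
    using D' that unfolding is_energy_deriv_def by blast
  have ae0: "AE s in ?J. \<xi> s 0 = r s 0" and ae1: "AE s in ?J. \<xi> s 1 = r s 1"
    using G_T by (eventually_elim, simp add: \<xi>_r)+
  have \<chi>i: "integrable ?J \<chi>0" "integrable ?J \<chi>1"
    unfolding \<chi>0_def \<chi>1_def
    by (rule weighted_trace_integrable[OF L(3) r_section_measurable ae0 _ _ L(5)];
        use P_r_bounds in \<open>auto intro: less_imp_le\<close>)
      (rule weighted_trace_integrable[OF L(4) r_section_measurable ae1 _ _ L(6)];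
        use P_r_bounds in \<open>auto intro: less_imp_le\<close>)
  have Fi: "integrable ?J (\<lambda>s. F s u)" if "u \<in> {0..1}" for u
    by (rule integrable_bounded_borel[OF F_section_measurable F_abs_le[OF that]])
  have fi: "integrable ?J f" unfolding f_def using \<chi>i Fi[of 0] Fi[of 1] by simp
  obtain h where hm: "(\<lambda>(s, u). h s u) \<in> borel_measurable (borel \<Otimes>\<^sub>M borel)"
    and h: "AE s in ?J. (AE u in I1. D' s u = h s u) \<and> sq_int I1 (h s)"
    and hsq: "sq_int ?J (\<lambda>s. l2norm I1 (h s))"
    by (rule Borel_version_rect[OF L(1,2)])
  have es: "sq_int I1 (e n)" for n by (rule continuous_sq_int[OF smooth_continuous[OF e(1)]])
  have em: "e n \<in> borel_measurable borel" for n by (rule borel_measurable_continuous_onI[OF smooth_continuous[OF e(1)]])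
  have emp [measurable]: "(\<lambda>(s :: real, u). e n u) \<in> borel_measurable (borel \<Otimes>\<^sub>M borel)" for n using em[of n] by measurable
  define K where "K = (LINT s | ?J. l2norm I1 (D s) + l2norm I1 (h s))"
  have nDi: "integrable ?J (\<lambda>s. l2norm I1 (D s))" "integrable ?J (\<lambda>s. l2norm I1 (h s))"
    using Icc.sq_int_integrable[OF l2norm_D_sq_int] Icc.sq_int_integrable[OF hsq] by auto
  have "AE s in ?J. f s = 0"
  proof (rule AE_zero_if_orthogonal_continuous[OF fi])
    fix q :: "real \<Rightarrow> real" and B assume q: "continuous_on UNIV q" "\<And>x. \<bar>q x\<bar> \<le> B"
    have B: "0 \<le> B" using q(2)[of 0] by linarith
    have qm: "q \<in> borel_measurable borel" by (rule borel_measurable_continuous_onI[OF q(1)])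
    have bound: "\<bar>LINT s | ?J. f s * q s\<bar> \<le> B * K * l2norm I1 (e n)" for n
    proof -
      define H where "H s u = q s * e n u" for s u
      have H: "H \<in> Cnp 0 1 T" unfolding H_def[abs_def] by (rule separated_Cnp[OF q(1) e(1)])
      define A1 where "A1 s = q s * ip (D s) (e n)" for s
      define A2 where "A2 s = q s * ip (h s) (e n)" for s
      have A1m: "A1 \<in> borel_measurable borel"
      proof -
        have [measurable]: "(\<lambda>s. ip (D s) (e n)) \<in> borel_measurable borel"
          by (rule borel_measurable_ip) (use D_measurable in measurable)
        show ?thesis unfolding A1_def using qm by measurable
      qed
      have A2m: "A2 \<in> borel_measurable borel"
      proof -
        have [measurable]: "(\<lambda>s. ip (h s) (e n)) \<in> borel_measurable borel"
          by (rule borel_measurable_ip) (use hm in measurable)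
        show ?thesis unfolding A2_def using qm by measurable
      qed
      have A1b: "\<bar>A1 s\<bar> \<le> B * (l2norm I1 (D s) * l2norm I1 (e n))" for s
        unfolding A1_def abs_mult using ip_CS[OF D_sq_int[of s] es[of n]] q(2) B by (intro mult_mono) auto
      have A2b: "AE s in ?J. \<bar>A2 s\<bar> \<le> B * (l2norm I1 (h s) * l2norm I1 (e n))"
        using h
      proof eventually_elim
        case (elim s)
        then show ?case unfolding A2_def abs_mult using ip_CS[of "h s" "e n"] es[of n] q(2) B by (intro mult_mono) auto
      qed
      have A1i: "integrable ?J A1"
        by (rule Bochner_Integration.integrable_bound[of _ "\<lambda>s. B * (l2norm I1 (D s) * l2norm I1 (e n))"])
          (use nDi(1) borel_lebesgue_on[OF A1m] A1b in \<open>auto intro!: AE_I2 order_trans[OF _ abs_ge_self]\<close>)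
      have A2i: "integrable ?J A2"
      proof (rule Bochner_Integration.integrable_bound[of _ "\<lambda>s. B * (l2norm I1 (h s) * l2norm I1 (e n))"])
        show "integrable ?J (\<lambda>s. B * (l2norm I1 (h s) * l2norm I1 (e n)))" using nDi(2) by simp
        show "A2 \<in> borel_measurable ?J" by (rule borel_lebesgue_on[OF A2m])
        show "AE s in ?J. norm (A2 s) \<le> norm (B * (l2norm I1 (h s) * l2norm I1 (e n)))"
          using A2b by eventually_elim (simp add: order_trans[OF _ abs_ge_self])
      qed
      have ipT: "ipT T D' H = (LINT s | ?J. A2 s)"
        unfolding ipT_def
      proof (rule LINT_cong_AE_lebesgue_on(1)[OF borel_lebesgue_on[OF A2m]])
        show "AE s in ?J. ip (D' s) (H s) = A2 s"
          using h
        proof eventually_elim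
          case (elim s)
          have hs: "h s \<in> borel_measurable I1" using elim by (simp add: sq_int_def)
          have ae: "AE u in I1. h s u = D' s u" using elim[THEN conjunct1] by eventually_elim simp
          have "ip (D' s) (H s) = q s * ip (D' s) (e n)"
            unfolding H_def by (rule ip_cmult_right)
          also have "ip (D' s) (e n) = ip (h s) (e n)"
            by (rule ip_cong_AE[symmetric, OF hs measurable_cong_AE_lebesgue_on[OF hs ae] ae
                  sq_int_measurable[OF es] sq_int_measurable[OF es]]) (rule AE_I2, rule refl)
          finally show ?case by (simp add: A2_def)
        qed
      qed
      have bdt: "P m \<alpha> (\<xi> s 0) / \<kappa> * D' s 0 * H s 0 + P m \<beta> (\<xi> s 1) / \<kappa> * D' s 1 * H s 1 = (\<delta>0 * \<chi>0 s + \<delta>1 * \<chi>1 s) * q s" for s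
        unfolding H_def e(2,3) \<chi>0_def \<chi>1_def by (simp only: distrib_right distrib_left mult.assoc mult.commute mult.left_commute)
      have lin: "energy_density H s = f s * q s - (\<delta>0 * \<chi>0 s + \<delta>1 * \<chi>1 s) * q s - A1 s" for s
      proof -
        have "ip (D s) (H s) = A1 s"
          unfolding A1_def H_def by (rule ip_cmult_right)
        then show ?thesis unfolding energy_density_def f_def by (simp add: H_def e(2,3) algebra_simps)
      qed
      have mult_q: "integrable ?J (\<lambda>s. k s * q s)" if "integrable ?J k" for k
      proof (rule Bochner_Integration.integrable_bound[of _ "\<lambda>s. B * k s"])
        show "integrable ?J (\<lambda>s. B * k s)" using that by simp
        show "(\<lambda>s. k s * q s) \<in> borel_measurable ?J"
          by (rule borel_measurable_times[OF borel_measurable_integrable[OF that] borel_lebesgue_on[OF qm]])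
        have "\<bar>q s\<bar> \<le> \<bar>B\<bar>" for s using q(2)[of s] by linarith
        then show "AE s in ?J. norm (k s * q s) \<le> norm (B * k s)"
          by (intro AE_I2) (simp add: abs_mult mult.commute[of "\<bar>k _\<bar>"] mult_right_mono)
      qed
      have i2: "integrable ?J (\<lambda>s. (\<delta>0 * \<chi>0 s + \<delta>1 * \<chi>1 s) * q s)" using \<chi>i by (intro mult_q) simp
      have "(LINT s | ?J. f s * q s) - (LINT s | ?J. (\<delta>0 * \<chi>0 s + \<delta>1 * \<chi>1 s) * q s) - (LINT s | ?J. A1 s) = (LINT s | ?J. energy_density H s)"
        unfolding lin using mult_q[OF fi] i2 A1i by simp
      also have "\<dots> = - ((LINT s | ?J. A2 s) + (LINT s | ?J. (\<delta>0 * \<chi>0 s + \<delta>1 * \<chi>1 s) * q s))"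
        using DH[OF H] unfolding energy_lin_eq[OF H] ip_bdry_def ipT bdt .
      finally have "(LINT s | ?J. f s * q s) = (LINT s | ?J. A1 s) - (LINT s | ?J. A2 s)" by linarith
      also have "\<dots> = (LINT s | ?J. A1 s - A2 s)" using A1i A2i by simp
      finally have "\<bar>LINT s | ?J. f s * q s\<bar> \<le> (LINT s | ?J. \<bar>A1 s - A2 s\<bar>)" by simp
      also have "\<dots> \<le> (LINT s | ?J. B * l2norm I1 (e n) * (l2norm I1 (D s) + l2norm I1 (h s)))"
      proof (rule integral_mono_AE)
        show "integrable ?J (\<lambda>s. \<bar>A1 s - A2 s\<bar>)" using A1i A2i by simp
        show "integrable ?J (\<lambda>s. B * l2norm I1 (e n) * (l2norm I1 (D s) + l2norm I1 (h s)))" using nDi by simp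
        show "AE s in ?J. \<bar>A1 s - A2 s\<bar> \<le> B * l2norm I1 (e n) * (l2norm I1 (D s) + l2norm I1 (h s))"
          using A2b
        proof eventually_elim
          case (elim s)
          then show ?case using A1b[of s] by (simp add: algebra_simps)
        qed
      qed
      also have "\<dots> = B * K * l2norm I1 (e n)" by (simp add: K_def)
      finally show ?thesis .
    qed
    have "(\<lambda>n. B * K * l2norm I1 (e n)) \<longlonglongrightarrow> B * K * 0" by (intro tendsto_intros e(4))
    then have "\<bar>LINT s | ?J. f s * q s\<bar> \<le> B * K * 0"
      by (rule LIMSEQ_le_const) (use bound in auto)
    then show "(LINT s | ?J. f s * q s) = 0" by simp
  qed
  then show ?thesis by (simp add: f_def \<chi>0_def \<chi>1_def)
qed

lemma l2norm_power_tendsto_0: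
  fixes b :: "real \<Rightarrow> real"
  assumes b: "continuous_on {0..1} b" "\<And>u. u \<in> {0..1} \<Longrightarrow> \<bar>b u\<bar> \<le> 1" and c: "\<And>u. u \<in> {0..1} \<Longrightarrow> u \<noteq> c \<Longrightarrow> \<bar>b u\<bar> < 1"
  shows "(\<lambda>n. l2norm I1 (\<lambda>u. b u ^ Suc n)) \<longlonglongrightarrow> 0"
proof -
  have "(\<lambda>n. l2norm I1 (\<lambda>u. b u ^ Suc n - 0)) \<longlonglongrightarrow> 0"
  proof (rule l2norm_tendsto_0[where w = "\<lambda>_. 1"])
    show "(\<lambda>u. b u ^ Suc n) \<in> borel_measurable I1" for n
      by (intro continuous_on_Icc_measurable continuous_intros b)
    have "AE u in lebesgue. u \<notin> {c}" by (intro AE_not_in) (auto simp flip: negligible_iff_null_sets)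
    then show "AE u in I1. (\<lambda>n. b u ^ Suc n) \<longlonglongrightarrow> 0"
      unfolding AE_lebesgue_on_Icc
    proof eventually_elim
      case (elim u)
      show ?case
      proof
        assume "u \<in> {0..1}"
        then have "\<bar>b u\<bar> < 1" using c elim by simp
        then show "(\<lambda>n. b u ^ Suc n) \<longlonglongrightarrow> 0" by (intro LIMSEQ_Suc LIMSEQ_abs_realpow_zero2)
      qed
    qed
    show "AE u in I1. (b u ^ Suc n - 0)\<^sup>2 \<le> 1" for n
    proof (rule AE_I2)
      fix u assume "u \<in> space I1"
      then have "\<bar>b u\<bar> \<le> 1" using b(2) by simp
      then have "\<bar>b u ^ Suc n\<bar> \<le> 1" unfolding power_abs by (intro power_le_one) auto
      then show "(b u ^ Suc n - 0)\<^sup>2 \<le> 1" by (simp only: diff_zero abs_square_le_1)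
    qed
  qed auto
  then show ?thesis by simp
qed

text \<open>The powers of \<open>1 - u\<close> isolate the end point \<open>0\<close>, those of \<open>u\<close> the end point \<open>1\<close>; the weights are
  positive, so they can be divided out.\<close>

lemma energy_deriv_unique:
  assumes D': "is_energy_deriv \<alpha> \<beta> m T \<kappa> \<xi> D'"
  shows "AE s in lebesgue_on {0<..T}. D' s 0 = \<kappa> * (\<xi> s 0 - \<alpha>) \<and> D' s 1 = \<kappa> * (\<beta> - \<xi> s 1)"
proof -
  let ?J = "lebesgue_on {0..T}"
  have "AE s in ?J. 1 * (P m \<alpha> (\<xi> s 0) / \<kappa> * D' s 0 + \<alpha> ^ m - F s 0) + 0 * (P m \<beta> (\<xi> s 1) / \<kappa> * D' s 1 + F s 1 - \<beta> ^ m) = 0"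
  proof (rule boundary_orthogonality[OF D', of "\<lambda>n u. (1 - u) ^ Suc n"])
    show "smooth (\<lambda>u. (1 - u) ^ Suc n)" for n by (intro smooth_power smooth_diff smooth_const smooth_id)
    show "(\<lambda>n. l2norm I1 (\<lambda>u. (1 - u) ^ Suc n)) \<longlonglongrightarrow> 0"
      by (rule l2norm_power_tendsto_0[of _ 0]) (auto intro!: continuous_intros)
  qed auto
  moreover have "AE s in ?J. 0 * (P m \<alpha> (\<xi> s 0) / \<kappa> * D' s 0 + \<alpha> ^ m - F s 0) + 1 * (P m \<beta> (\<xi> s 1) / \<kappa> * D' s 1 + F s 1 - \<beta> ^ m) = 0"
  proof (rule boundary_orthogonality[OF D', of "\<lambda>n u. u ^ Suc n"])
    show "smooth (\<lambda>u. u ^ Suc n)" for n by (intro smooth_power smooth_id)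
    show "(\<lambda>n. l2norm I1 (\<lambda>u. u ^ Suc n)) \<longlonglongrightarrow> 0"
      by (rule l2norm_power_tendsto_0[of _ 1]) (auto intro!: continuous_intros)
  qed auto
  ultimately have "AE s in ?J. D' s 0 = \<kappa> * (\<xi> s 0 - \<alpha>) \<and> D' s 1 = \<kappa> * (\<beta> - \<xi> s 1)"
    using G_T
  proof eventually_elim
    case (elim s)
    then have x: "\<xi> s 0 = r s 0" "\<xi> s 1 = r s 1" by (auto simp: \<xi>_r)
    have F0: "F s 0 = a s" by simp
    have "P m \<alpha> (r s 0) / \<kappa> * D' s 0 = - (P m \<alpha> (r s 0) * (\<alpha> - r s 0))"
      unfolding P_r using elim(1) by (simp add: x)
    then have "P m \<alpha> (r s 0) * D' s 0 = P m \<alpha> (r s 0) * (\<kappa> * (r s 0 - \<alpha>))" using \<kappa> by (simp add: field_simps)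
    then have 0: "D' s 0 = \<kappa> * (r s 0 - \<alpha>)" using P_r_bounds(1)[of s] by simp
    have "P m \<beta> (r s 1) / \<kappa> * D' s 1 = P m \<beta> (r s 1) * (\<beta> - r s 1)"
      unfolding P_r using elim(2) by (simp add: x)
    then have "P m \<beta> (r s 1) * D' s 1 = P m \<beta> (r s 1) * (\<kappa> * (\<beta> - r s 1))" using \<kappa> by (simp add: field_simps)
    then have "D' s 1 = \<kappa> * (\<beta> - r s 1)" using P_r_bounds(3)[of s] by simp
    with 0 show ?case by (simp add: x)
  qed
  then have "AE s in lebesgue. s \<in> {0<..T} \<longrightarrow> D' s 0 = \<kappa> * (\<xi> s 0 - \<alpha>) \<and> D' s 1 = \<kappa> * (\<beta> - \<xi> s 1)"
    unfolding AE_lebesgue_on_Icc by eventually_elim auto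
  then show ?thesis by (subst AE_restrict_space_iff) auto
qed

lemma L2H1_norm_le:
  assumes rep: "\<And>s. s \<in> G \<Longrightarrow> H1_rep (\<zeta> s) (a s) (D s)"
  shows "L2H1_norm T \<zeta> \<le> sqrt (2 + 2 * T)"
proof -
  let ?J = "lebesgue_on {0..T}"
  define V where "V s = (l2norm I1 (F s))\<^sup>2" for s
  have Vm: "V \<in> borel_measurable borel" unfolding V_def using F_measurable by (intro borel_measurable_power borel_measurable_l2norm)
  have Vb: "\<bar>V s\<bar> \<le> 1" for s
  proof -
    have "V s \<le> (LINT u | I1. 1)"
      unfolding V_def l2norm_sq
      by (rule integral_mono) (use prim_sq_int[OF D_sq_int, of "a s" s] F_abs_le[of _ s] in \<open>auto simp: sq_int_def abs_square_le_1\<close>)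
    then show ?thesis by (simp add: V_def)
  qed
  have Vi: "integrable ?J V" by (rule integrable_bounded_borel[OF Vm Vb])
  have "AE s in ?J. (H1_norm (\<zeta> s))\<^sup>2 = V s + N s"
    using G_T
  proof eventually_elim
    case (elim s)
    note rs = rep[OF elim[THEN conjunct1]]
    have "l2norm I1 (\<zeta> s) = l2norm I1 (F s)"
      using H1_rep_sq_int[OF rs] prim_sq_int[OF D_sq_int, of "a s" s] rs by (intro l2norm_cong_AE) (auto simp: sq_int_def H1_rep_def)
    then show ?case by (simp add: H1_norm_rep[OF rs] V_def N_def)
  qed
  then have "(LINT s | ?J. (H1_norm (\<zeta> s))\<^sup>2) = (LINT s | ?J. V s + N s)"
    by (intro LINT_cong_AE_lebesgue_on(1) borel_lebesgue_on borel_measurable_add Vm N_measurable)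
  also have "\<dots> = (LINT s | ?J. V s) + (LINT s | ?J. N s)" using Vi N_integral by simp
  also have "(LINT s | ?J. V s) \<le> (LINT s | ?J. 1)"
    by (rule integral_mono[OF Vi]) (use Vb in \<open>auto simp: abs_le_iff\<close>)
  also have "(LINT s | ?J. 1) = T" using T by (simp add: measure_restrict_space)
  also have "(LINT s | ?J. N s) \<le> 2 + T" using energy_bound N_integral(2) by (simp add: N_def)
  finally show ?thesis unfolding L2H1_norm_def by (intro real_sqrt_le_mono) simp
qed

end

theorem theorem2p4:
  fixes \<alpha> \<beta> T :: real and m :: nat and g :: "real \<Rightarrow> real"
  assumes "\<alpha> \<in> {0<..<1}" and "\<beta> \<in> {0<..<1}" and "m \<ge> 1" and "T > 0"
    and "g \<in> borel_measurable (lebesgue_on {0..1})" and "\<forall>u\<in>{0..1}. g u \<in> {0..1}"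
  shows "(\<exists>M0::real. \<forall>\<kappa>>0. \<exists>c>0. \<forall>\<rho>. robin_weak_solution \<alpha> \<beta> m T g \<kappa> \<rho> \<longrightarrow>
            energy \<alpha> \<beta> m T \<kappa> c (bdry_ext m \<rho>) \<le> ereal M0)
       \<and> (\<forall>\<kappa>>0. \<forall>\<rho>. robin_weak_solution \<alpha> \<beta> m T g \<kappa> \<rho> \<longrightarrow>
            (\<exists>D. is_energy_deriv \<alpha> \<beta> m T \<kappa> (bdry_ext m \<rho>) D) \<and>
            (\<forall>D. is_energy_deriv \<alpha> \<beta> m T \<kappa> (bdry_ext m \<rho>) D \<longrightarrow>
               (AE s in lebesgue_on {0<..T}.
                  D s 0 = \<kappa> * (bdry_ext m \<rho> s 0 - \<alpha>) \<and>
                  D s 1 = \<kappa> * (\<beta> - bdry_ext m \<rho> s 1))))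
       \<and> (\<exists>M. \<forall>\<kappa>>0. \<forall>\<rho>. robin_weak_solution \<alpha> \<beta> m T g \<kappa> \<rho> \<longrightarrow>
            (\<lambda>s u. \<rho> s u ^ m) \<in> L2H1 T \<and> L2H1_norm T (\<lambda>s u. \<rho> s u ^ m) \<le> M)"
proof -
  have main: "energy \<alpha> \<beta> m T \<kappa> (1 + \<kappa>) (bdry_ext m \<rho>) \<le> ereal (2 + T + 2 * m * T) \<and>
      (\<exists>D. is_energy_deriv \<alpha> \<beta> m T \<kappa> (bdry_ext m \<rho>) D) \<and>
      (\<forall>D. is_energy_deriv \<alpha> \<beta> m T \<kappa> (bdry_ext m \<rho>) D \<longrightarrow>
         (AE s in lebesgue_on {0<..T}.
            D s 0 = \<kappa> * (bdry_ext m \<rho> s 0 - \<alpha>) \<and> D s 1 = \<kappa> * (\<beta> - bdry_ext m \<rho> s 1))) \<and>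
      (\<lambda>s u. \<rho> s u ^ m) \<in> L2H1 T \<and> L2H1_norm T (\<lambda>s u. \<rho> s u ^ m) \<le> sqrt (2 + 2 * T)"
    if \<kappa>: "0 < \<kappa>" and sol: "robin_weak_solution \<alpha> \<beta> m T g \<kappa> \<rho>" for \<kappa> \<rho>
  proof -
    obtain a D G where tr: "traced_trajectory T \<kappa> \<alpha> \<beta> m a D G (bdry_ext m \<rho>)"
      and rep: "\<And>s. s \<in> G \<Longrightarrow> H1_rep (\<lambda>u. \<rho> s u ^ m) (a s) (D s)"
      using weak_solution_trajectory[OF assms(4,3,1,2) \<kappa> sol] by blast
    interpret traced_trajectory T \<kappa> \<alpha> \<beta> m a D G "bdry_ext m \<rho>" by (rule tr)
    have "(\<lambda>s u. \<rho> s u ^ m) \<in> L2H1 T" using sol by (simp add: robin_weak_solution_def)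
    moreover have "L2H1_norm T (\<lambda>s u. \<rho> s u ^ m) \<le> sqrt (2 + 2 * T)" by (rule L2H1_norm_le[OF rep])
    ultimately show ?thesis using energy_le energy_deriv_exists energy_deriv_unique by blast
  qed
  have "\<forall>\<kappa>>0. \<exists>c>0. \<forall>\<rho>. robin_weak_solution \<alpha> \<beta> m T g \<kappa> \<rho> \<longrightarrow>
            energy \<alpha> \<beta> m T \<kappa> c (bdry_ext m \<rho>) \<le> ereal (2 + T + 2 * m * T)"
  proof (intro allI impI)
    fix \<kappa> :: real assume "0 < \<kappa>"
    then show "\<exists>c>0. \<forall>\<rho>. robin_weak_solution \<alpha> \<beta> m T g \<kappa> \<rho> \<longrightarrow>
            energy \<alpha> \<beta> m T \<kappa> c (bdry_ext m \<rho>) \<le> ereal (2 + T + 2 * m * T)"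
      using main by (intro exI[of _ "1 + \<kappa>"]) simp
  qed
  then show ?thesis using main by blast
qed

end
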